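(* Let $(\xi_j)_{j\ge 0}$ be independent, identically distributed random variables taking values in $\{-1,0,1\}$ with \[\max_{x\in\{-1,0,1\}} \mathbb{P}(\xi_0 = x) < \frac{1}{\sqrt{3}},\] and for $n\ge 1$ let $P(z):=\sum_{j=0}^n \xi_j z^j$. Then: (1) $\lim_{n\to\infty} \mathbb{P}(P\text{ has a double root}) = \mathbb{P}(\xi_0 = 0)^2$. (2) If moreover $\mathbb{P}(\xi_0=0)=0$, then \[\mathbb{P}(P\text{ has a double root}) = \frac{L_n}{n^2} + o(n^{-2})\quad\text{as } n\to\infty,\] where $L_n$ is the periodic sequence \[L_n := \begin{cases} \frac{8\sqrt{3}}{\pi \operatorname{Var}(\xi_0)}& \text{if } \mathbb{E}(\xi_0) = 0 \text{ and } n+1 \text{ is divisible by } 4,\\ \frac{4\sqrt{3}}{\pi \operatorname{Var}(\xi_0)}&\text{if } \mathbb{E}(\xi_0) \neq 0 \text{ and } n+1 \text{ is divisible by } 4,\\ 0&\text{if } n+1 \text{ is not divisible by } 4.\end{cases}\]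
   Context: Here $o(n^{-2})$ denotes a term $\delta_n$, where the sequence $(\delta_n)$ depends only on the distribution of $\xi_0$ and satisfies $\lim_{n\to\infty}\delta_n n^{2}=0$. A double root means a root of multiplicity at least $2$. *)

theory Defs
  imports "HOL-Probability.Probability" "HOL-Computational_Algebra.Polynomial"
begin

definition has_double_root :: "complex poly \<Rightarrow> bool" where
  "has_double_root P \<longleftrightarrow> (\<exists>z::complex. [:-z, 1:] ^ 2 dvd P)"

definition rand_poly :: "nat \<Rightarrow> (nat \<Rightarrow> int) \<Rightarrow> complex poly" where
  "rand_poly n a = (\<Sum>j\<le>n. monom (of_int (a j)) j)"

definition prob_double_root :: "int pmf \<Rightarrow> nat \<Rightarrow> real" where
  "prob_double_root d n =
     measure_pmf.prob (Pi_pmf {..n} 0 (\<lambda>_. d)) {a. has_double_root (rand_poly n a)}"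

definition L_const :: "int pmf \<Rightarrow> nat \<Rightarrow> real" where
  "L_const d n =
     (if 4 dvd (n + 1) then
        (if measure_pmf.expectation d real_of_int = 0
         then 8 * sqrt 3 / (pi * measure_pmf.variance d real_of_int)
         else 4 * sqrt 3 / (pi * measure_pmf.variance d real_of_int))
      else 0)"

end

theory Submission
  imports
    Defs
    "HOL-Number_Theory.Totient"
    "HOL-Computational_Algebra.Computational_Algebra"
    "HOL-Library.Numeral_Type"
    "HOL-Real_Asymp.Real_Asymp"
begin

text \<open>
  If $P$ has a double root $z$, then the minimal polynomial $f$ of $z$ over the integers satisfies
  $f^2 | P$. Fix $D$ of order $\log n$. If $\deg f \ge D$, reduce modulo 3: there are $3^k$ monic
  residues $g$ of degree $k$, and $g^2 | P$ determines the lowest $2k$ coefficients of $P$ from the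
  others, so this case has probability at most $\sum_{k \ge D} (3M^2)^k$, where $M < 1/\sqrt 3$ is
  the largest atom. If $\deg f < D$ and $f$ has a root $b$ with $|b| > 1 + 1/(32D^2)$, then
  $P(b) = 0$ determines the coefficients at the multiples of $64D^2$ from the others, and the
  resulting bound survives a union over all such $f$. In the remaining case the Gauss congruences
  $s_{kp^r} = s_{kp^{r-1}}$ mod $p^r$ for the power sums of the roots of $f$ become equalities, so
  $x \mapsto x^p$ permutes powers of these roots; hence $z$ is $0$ or a root of unity of order
  $m \le 2D^2$. If $z$ is not real, the coefficients in each of the residue classes $0$ and $1$
  mod $m$ satisfy a linear equation of probability $O((n/m)^{-3/2})$, which gives $O((m/n)^3)$.
  So only the double roots $0$, $1$ and $-1$ matter. At $\pm 1$ the vector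
  $(\sum_j \xi_j z^j, \sum_j j \xi_j z^j)$ has to vanish; for $P(\xi_0 = 0) = 0$ parity forces
  $4 | n + 1$, and then a two-dimensional local limit computation gives the constant.
\<close>

subsection \<open>Integer polynomials and their complex roots\<close>

text \<open>The threshold 1 / sqrt 3 is a balance: 3 is the least modulus that keeps -1, 0, 1 apart,
  it leaves at most 3^k candidates of degree k, and squareness makes each cost M^(2 k). The cut D
  must be logarithmic: (3 M^2)^D has to beat n^(-2), while the 3^(O(D^2)) polynomials of lower
  degree must be outweighed by M^(n / (64 D^2)). Roots close to the unit circle admit no such gain,
  so they have to be identified exactly, as roots of unity of polylogarithmic order. For these a
  single linear equation has probability of order n^(-3/2), which is not o(n^(-2)); a second,
  independent one is needed, and it exists because 1 and a nonreal z are linearly independent over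
  the reals. At 1 and -1 this fails, and these roots carry the main term. At -1 the alternating
  signs cancel the drift caused by a nonzero mean, so -1 always contributes; at 1 a nonzero mean
  makes a vanishing sum exponentially unlikely. Hence the factor 2 between the two nonzero values of
  \<open>L_const\<close>.\<close>

abbreviation cpoly :: "int poly \<Rightarrow> complex poly" where
  "cpoly \<equiv> map_poly of_int"

lemma cpoly_mult: "cpoly (p * q) = cpoly p * cpoly q"
  by (rule poly_eqI) (simp add: coeff_mult coeff_map_poly of_int_sum)

lemma poly_cpoly_mult: "poly (cpoly (p * q)) z = poly (cpoly p) z * poly (cpoly q) z"
  by (simp add: cpoly_mult)

lemma cpoly_add: "cpoly (p + q) = cpoly p + cpoly q"
  by (rule poly_eqI) (simp add: coeff_map_poly)

lemma cpoly_diff: "cpoly (p - q) = cpoly p - cpoly q"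
  by (rule poly_eqI) (simp add: coeff_map_poly)

lemma cpoly_smult: "cpoly (smult c p) = smult (of_int c) (cpoly p)"
  by (rule poly_eqI) (simp add: coeff_map_poly)

lemma degree_cpoly [simp]: "degree (cpoly p) = degree p"
  by (rule degree_map_poly) auto

lemma cpoly_eq_0_iff [simp]: "cpoly p = 0 \<longleftrightarrow> p = 0"
  by (simp add: map_poly_eq_0_iff)

lemma cpoly_pderiv: "pderiv (cpoly p) = cpoly (pderiv p)"
  by (rule poly_eqI) (simp add: coeff_map_poly coeff_pderiv)

lemma prime_factor_with_root:
  fixes p :: "int poly" and z :: complex
  assumes "p \<noteq> 0" "poly (cpoly p) z = 0"
  obtains f where "prime_elem f" "f dvd p" "poly (cpoly f) z = 0"
proof -
  have "\<exists>f. prime_elem f \<and> f dvd p \<and> poly (cpoly f) z = 0"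
    using assms
  proof (induction p rule: prime_divisors_induct)
    case zero
    then show ?case by simp
  next
    case (unit x)
    then obtain c where "x = [:c:]" "c dvd 1" by (auto simp: is_unit_poly_iff)
    with unit show ?case by (auto simp: map_poly_pCons)
  next
    case (factor q x)
    from factor.prems have "poly (cpoly q) z = 0 \<or> poly (cpoly x) z = 0"
      by (simp add: poly_cpoly_mult)
    then show ?case
    proof
      assume "poly (cpoly q) z = 0"
      then show ?thesis using factor.hyps by (auto simp: prime_imp_prime_elem)
    next
      assume "poly (cpoly x) z = 0"
      then show ?thesis using factor.IH factor.prems by auto
    qed
  qed
  then show ?thesis using that by blast
qed

text \<open>Pseudo-division replaces division over the rationals: dividing by a polynomial
  \<open>h\<close> of least degree vanishing at \<open>z\<close> leaves remainder 0, up to an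
  integer factor. Primality shows that \<open>f\<close> has this least degree too, so
  \<open>f\<close> divides \<open>c g\<close> for some nonzero integer \<open>c\<close>; as a
  nonconstant prime it divides \<open>g\<close>.\<close>

lemma prime_elem_dvd_of_common_root:
  fixes f g :: "int poly" and z :: complex
  assumes f: "prime_elem f" "poly (cpoly f) z = 0" and g: "poly (cpoly g) z = 0"
  shows "f dvd g"
proof -
  have f0: "f \<noteq> 0" using f by auto
  define S where "S = {h :: int poly. h \<noteq> 0 \<and> poly (cpoly h) z = 0}"
  have fS: "f \<in> S" using f f0 by (auto simp: S_def)
  define h where "h = arg_min degree (\<lambda>h. h \<in> S)"
  have hS: "h \<in> S" and hmin: "\<And>q. q \<in> S \<Longrightarrow> degree h \<le> degree q"
    using arg_min_nat_lemma[of "\<lambda>h. h \<in> S" f degree] fS by (auto simp: h_def)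
  have degpos: "degree q > 0" if "q \<in> S" for q
  proof (rule ccontr)
    assume "\<not> degree q > 0"
    then obtain c where "q = [:c:]" using degree_eq_zeroE by blast
    with that show False by (auto simp: S_def map_poly_pCons)
  qed
  have div: "\<exists>c q. c \<noteq> 0 \<and> smult c a = b * q" if b: "b \<in> S" "\<And>q. q \<in> S \<Longrightarrow> degree b \<le> degree q" and a: "poly (cpoly a) z = 0" for a b
  proof -
    obtain q r where qr: "pseudo_divmod a b = (q, r)" by (cases "pseudo_divmod a b") auto
    from b have "b \<noteq> 0" by (auto simp: S_def)
    from pseudo_divmod[OF this qr] have e: "smult (coeff b (degree b) ^ (Suc (degree a) - degree b)) a = b * q + r"
      and r: "r = 0 \<or> degree r < degree b" by auto
    from arg_cong[OF e, of "\<lambda>p. poly (cpoly p) z"] a b(1)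
    have "poly (cpoly r) z = 0"
      by (simp add: cpoly_smult cpoly_add cpoly_mult S_def)
    with r b(2)[of r] have "r = 0" by (fastforce simp: S_def)
    with e \<open>b \<noteq> 0\<close> show ?thesis
      by (intro exI[of _ "coeff b (degree b) ^ (Suc (degree a) - degree b)"] exI[of _ q]) auto
  qed
  have nconst: "\<not> f dvd [:c:]" if "c \<noteq> 0" for c
    using degpos[OF fS] that by (auto dest: dvd_imp_degree_le)
  \<comment> \<open>From \<open>c f = h q\<close> the prime \<open>f\<close> divides
    \<open>h\<close>, which is what is wanted, or \<open>q\<close>. In the latter case cancelling
    \<open>f\<close> would make the nonconstant \<open>h\<close> divide the constant
    \<open>c\<close>.\<close>
  have "degree f \<le> degree h"
  proof -
    obtain c q where cq: "c \<noteq> 0" "smult c f = h * q" using div[OF hS hmin f(2)] by blast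
    then have "f dvd h * q" by (metis dvd_refl dvd_smult)
    then consider "f dvd h" | "f dvd q" using f(1) prime_elem_dvd_mult_iff by blast
    then show ?thesis
    proof cases
      case 1
      then show ?thesis using hS by (auto simp: S_def intro: dvd_imp_degree_le)
    next
      case 2
      then obtain q' where "q = f * q'" by auto
      with cq have "f * [:c:] = f * (h * q')" by (simp add: mult_ac)
      then have "[:c:] = h * q'" using f0 by (metis mult_cancel_left)
      then have "h dvd [:c:]" by simp
      then have "degree h = 0" using cq(1) by (auto dest: dvd_imp_degree_le)
      then show ?thesis using degpos[OF hS] by simp
    qed
  qed
  then have "\<And>q. q \<in> S \<Longrightarrow> degree f \<le> degree q" using hmin le_trans by blast
  then obtain c q where cq: "c \<noteq> 0" "smult c g = f * q" using div[OF fS _ g] by blast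
  then have "f dvd [:c:] * g" by simp
  then show ?thesis using f(1) nconst[OF cq(1)] prime_elem_dvd_mult_iff by blast
qed

text \<open>Separability in characteristic 0: a prime factor vanishing at \<open>z\<close> cannot
  divide its own nonzero derivative of smaller degree, so \<open>z\<close> is a simple root of it.
  The second zero must come from the cofactor, which is then divisible by \<open>f\<close>
  again.\<close>

lemma prime_square_dvd_of_double_root:
  fixes p :: "int poly" and z :: complex
  assumes p: "p \<noteq> 0" and "poly (cpoly p) z = 0" and d: "poly (pderiv (cpoly p)) z = 0"
  obtains f where "prime_elem f" "f\<^sup>2 dvd p" "poly (cpoly f) z = 0"
proof -
  obtain f where f: "prime_elem f" "f dvd p" "poly (cpoly f) z = 0"
    using prime_factor_with_root assms by blast
  then obtain g where g: "p = f * g" by auto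
  have f0: "f \<noteq> 0" using f by auto
  have "degree f \<noteq> 0"
  proof
    assume "degree f = 0"
    then obtain c where "f = [:c:]" using degree_eq_zeroE by blast
    with f0 f(3) show False by (auto simp: map_poly_pCons)
  qed
  have "poly (cpoly (pderiv f)) z \<noteq> 0"
  proof
    assume "poly (cpoly (pderiv f)) z = 0"
    from prime_elem_dvd_of_common_root[OF f(1,3) this] have "f dvd pderiv f" .
    moreover have "pderiv f \<noteq> 0" using \<open>degree f \<noteq> 0\<close> by (simp add: pderiv_eq_0_iff)
    ultimately have "degree f \<le> degree (pderiv f)" by (rule dvd_imp_degree_le)
    then show False using \<open>degree f \<noteq> 0\<close> by (simp add: degree_pderiv)
  qed
  moreover have "poly (cpoly (pderiv f)) z * poly (cpoly g) z = 0"
    using d f(3) by (auto simp: g cpoly_mult pderiv_mult cpoly_pderiv)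
  ultimately have "poly (cpoly g) z = 0" by simp
  from prime_elem_dvd_of_common_root[OF f(1,3) this] have "f\<^sup>2 dvd p"
    by (simp add: g power2_eq_square)
  with f that show ?thesis by blast
qed

subsection \<open>Euler's totient function from below\<close>

text \<open>Removing one prime factor p divides the totient by at least p - 1, and (p - 1)^2 >= p
  once p >= 3. This fails for p = 2, hence the restriction to odd numbers.\<close>

lemma totient_odd_bound: "odd m \<Longrightarrow> m \<le> (totient m)\<^sup>2"
proof (induction m rule: less_induct)
  case (less m)
  show ?case
  proof (cases "m = 1")
    case False
    then obtain p where p: "prime p" "p dvd m" using prime_factor_nat by blast
    then obtain u where u: "m = p * u" by auto
    have "odd p" "odd u" "u > 0" using less.prems u by (auto simp: odd_pos)
    have p3: "p \<ge> 3" using p \<open>odd p\<close> by (metis One_nat_def Suc_leI eval_nat_numeral(3) even_numeral le_neq_implies_less prime_ge_2_nat)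
    have "u < m" using u p3 \<open>u > 0\<close> by auto
    then have IH: "u \<le> (totient u)\<^sup>2" using less.IH \<open>odd u\<close> by blast
    obtain q where q: "p = q + 3" using p3 le_Suc_ex by (metis add.commute)
    have tp: "totient p = p - 1" using p totient_prime by blast
    have "(p - 1) * totient u \<le> totient m"
    proof (cases "p dvd u")
      case True
      then have "gcd p u = p" by (simp add: gcd_nat.absorb1)
      with totient_gcd[of p u] have "totient m * (p - 1) = p * totient u * (p - 1)"
        by (simp add: u tp mult_ac)
      then have "totient m = p * totient u" using p3 by simp
      then show ?thesis by simp
    next
      case False
      then have "coprime p u" using p by (simp add: prime_imp_coprime)
      then show ?thesis by (simp add: u totient_mult_coprime tp)
    qed
    then have "((p - 1) * totient u)\<^sup>2 \<le> (totient m)\<^sup>2" by (rule power_mono) simp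
    moreover have "p * u \<le> (p - 1)\<^sup>2 * (totient u)\<^sup>2"
      by (rule mult_mono) (use IH in \<open>auto simp: q power2_eq_square algebra_simps\<close>)
    ultimately show ?thesis by (simp add: u power_mult_distrib)
  qed auto
qed

text \<open>Each factor 2 beyond the first doubles the totient and so quadruples its square. Only
  the first one leaves the totient unchanged, and the constant 2 pays for it.\<close>

lemma le_double_totient_square: "m \<le> 2 * (totient m)\<^sup>2"
proof (induction m rule: less_induct)
  case (less m)
  show ?case
  proof (cases "odd m \<or> m = 0")
    case True
    then show ?thesis using totient_odd_bound[of m] by auto
  next
    case False
    then obtain u where u: "m = 2 * u" "u > 0" by auto
    show ?thesis
    proof (cases "even u")
      case True
      have "u \<le> 2 * (totient u)\<^sup>2" using less.IH[of u] u by auto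
      then show ?thesis using True u by (simp add: totient_double power_mult_distrib)
    next
      case False
      then show ?thesis using totient_odd_bound[of u] u by (simp add: totient_double)
    qed
  qed
qed

subsection \<open>Gauss congruences for power sums\<close>

text \<open>
  The relation says $S = -xR'/R$: for $R = \prod_b (1 - bx)$ the coefficients of $S$ are the power
  sums of the $b$.
\<close>
definition log_deriv_eq :: "complex fps \<Rightarrow> complex fps \<Rightarrow> bool" where
  "log_deriv_eq R S \<longleftrightarrow> fps_X * fps_deriv R = - (R * S)"

lemma log_deriv_eq_1: "log_deriv_eq 1 0"
  by (simp add: log_deriv_eq_def)

lemma log_deriv_eq_mult:
  assumes "log_deriv_eq R S" "log_deriv_eq R' S'"
  shows "log_deriv_eq (R * R') (S + S')"
proof -
  have "fps_X * fps_deriv (R * R') = R * (fps_X * fps_deriv R') + (fps_X * fps_deriv R) * R'"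
    by (simp add: algebra_simps)
  also have "\<dots> = - (R * R' * (S + S'))"
    using assms by (simp add: log_deriv_eq_def algebra_simps)
  finally show ?thesis by (simp add: log_deriv_eq_def)
qed

lemma log_deriv_eq_power: "log_deriv_eq R S \<Longrightarrow> log_deriv_eq (R ^ n) (of_nat n * S)"
proof (induction n)
  case (Suc n)
  from log_deriv_eq_mult[OF Suc.prems Suc.IH[OF Suc.prems]] show ?case
    by (simp add: algebra_simps)
qed (simp add: log_deriv_eq_1)

lemma fps_Ints_power:
  fixes F :: "complex fps"
  assumes "\<And>k. F $ k \<in> \<int>"
  shows "(F ^ n) $ k \<in> \<int>"
proof (induction n arbitrary: k)
  case (Suc n)
  then show ?case using assms by (auto simp: fps_mult_nth intro!: Ints_sum)
qed simp

text \<open>The geometric series 1 / (1 - x^n). Its powers stand for the negative powers of 1 - x^n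
  and visibly have integer coefficients.\<close>

definition multiples_fps :: "nat \<Rightarrow> complex fps" where
  "multiples_fps n = Abs_fps (\<lambda>k. if n dvd k then 1 else 0)"

lemma multiples_fps_inverse: "n > 0 \<Longrightarrow> (1 - fps_X ^ n) * multiples_fps n = 1"
  by (rule fps_ext) (auto simp: algebra_simps fps_X_power_mult_nth multiples_fps_def not_less
      dest: dvd_imp_le intro: dvd_diffD)

text \<open>Here \<open>L\<close> is n x^n / (1 - x^n), with coefficient n at every positive
  multiple of n. This is how exponents of the factors 1 - x^n become divisor sums.\<close>

lemma log_deriv_eq_one_minus_power:
  assumes n: "n > 0"
  defines "L \<equiv> of_nat n * (fps_X ^ n * multiples_fps n)"
  shows "log_deriv_eq (1 - fps_X ^ n) L" "log_deriv_eq (multiples_fps n) (- L)"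
proof -
  let ?H = "1 - fps_X ^ n :: complex fps" and ?G = "multiples_fps n"
  have HG: "?H * ?G = 1" by (rule multiples_fps_inverse[OF n])
  have XH: "fps_X * fps_deriv ?H = - (of_nat n * fps_X ^ n)"
  proof -
    have "fps_X * fps_deriv ?H = - (of_nat n * (fps_X * fps_X ^ (n - 1)))"
      by (simp add: fps_deriv_power algebra_simps fps_of_nat)
    also have "fps_X * fps_X ^ (n - 1) = (fps_X :: complex fps) ^ n"
      using n by (simp flip: power_Suc)
    finally show ?thesis .
  qed
  have "?H * L = of_nat n * fps_X ^ n * (?H * ?G)"
    by (simp add: L_def algebra_simps)
  then have "- (of_nat n * fps_X ^ n) = - (?H * L)" by (simp add: HG)
  with XH show "log_deriv_eq ?H L" unfolding log_deriv_eq_def by (rule trans)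
  have "fps_X * fps_deriv (?H * ?G) = 0" unfolding HG by simp
  moreover have "fps_X * fps_deriv (?H * ?G) = ?H * (fps_X * fps_deriv ?G) + (fps_X * fps_deriv ?H) * ?G"
    unfolding fps_deriv_mult by (simp only: algebra_simps)
  ultimately have "?H * (fps_X * fps_deriv ?G) = of_nat n * fps_X ^ n * ?G"
    unfolding XH by simp
  then have "?G * (?H * (fps_X * fps_deriv ?G)) = ?G * (of_nat n * fps_X ^ n * ?G)" by simp
  then have "(?H * ?G) * (fps_X * fps_deriv ?G) = ?G * L"
    by (simp add: L_def mult_ac)
  then show "log_deriv_eq ?G (- L)" by (simp add: HG log_deriv_eq_def)
qed

text \<open>
  In terms of $R$: $R = R' \prod_{n \le K} (1 - x^n)^{c_n}$ with $R' = 1 + O(x^{K+1})$ integral; each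
  step removes one more coefficient.
\<close>
lemma log_deriv_eq_coeffs_aux:
  fixes R S :: "complex fps"
  assumes "R $ 0 = 1" "\<And>k. R $ k \<in> \<int>" "log_deriv_eq R S"
  shows "\<exists>(R' :: complex fps) (S' :: complex fps) (c :: nat \<Rightarrow> int). R' $ 0 = 1 \<and> (\<forall>k. R' $ k \<in> \<int>) \<and> log_deriv_eq R' S' \<and>
     (\<forall>k\<le>K. S' $ k = 0) \<and>
     (\<forall>k\<ge>1. S $ k = S' $ k + (\<Sum>n | n dvd k \<and> n \<le> K. of_nat n * of_int (c n)))"
proof (induction K)
  case 0
  have "(fps_X * fps_deriv R) $ 0 = - (R * S) $ 0" using assms by (simp add: log_deriv_eq_def)
  then have S0: "S $ 0 = 0" using assms by simp
  show ?case
    by (rule exI[of _ R], rule exI[of _ S], rule exI[of _ "\<lambda>_. 0"]) (use assms S0 in auto)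
next
  case (Suc K)
  then obtain R' S' :: "complex fps" and c :: "nat \<Rightarrow> int" where
    R': "R' $ 0 = 1" "\<And>k. R' $ k \<in> \<int>" "log_deriv_eq R' S'" and
    S': "\<And>k. k \<le> K \<Longrightarrow> S' $ k = 0"
    "\<And>k. k \<ge> 1 \<Longrightarrow> S $ k = S' $ k + (\<Sum>n | n dvd k \<and> n \<le> K. of_nat n * of_int (c n))"
    by blast
  define N where "N = Suc K"
  have N: "N > 0" by (simp add: N_def)
  obtain a where a: "R' $ N = of_int a" using R'(2) by (metis Ints_cases)
  have "(fps_X * fps_deriv R') $ N = - ((R' * S') $ N)" using R'(3) by (simp add: log_deriv_eq_def)
  \<comment> \<open>All lower coefficients of \<open>S'\<close> vanish, so comparing coefficients at
    N gives -N a for \<open>S' $ N\<close>. Multiplying \<open>R'\<close> by (1 - x^N)^a adds N a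
    there and makes it 0; moving this factor to the other side records the exponent -a in
    \<open>c'\<close>.\<close>
  moreover have "(R' * S') $ N = (\<Sum>i\<in>{0}. R' $ i * S' $ (N - i))"
    unfolding fps_mult_nth by (rule sum.mono_neutral_right) (auto simp: S' N_def)
  ultimately have SN: "S' $ N = of_nat N * of_int (- a)"
    using N R'(1) a by (simp add: N_def)
  define L where "L = of_nat N * (fps_X ^ N * multiples_fps N)"
  have Lnth: "L $ k = (if N dvd k \<and> k > 0 then of_nat N else 0)" for k
  proof -
    have "L $ k = of_nat N * ((fps_X ^ N * multiples_fps N) $ k)"
      unfolding L_def fps_of_nat[symmetric] by (rule fps_mult_left_const_nth)
    then show ?thesis using N
      by (auto simp: fps_X_power_mult_nth multiples_fps_def not_less dest: dvd_imp_le intro: dvd_diffD)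
  qed
  define F where "F = (if a \<ge> 0 then (1 - fps_X ^ N) ^ nat a else multiples_fps N ^ nat (- a))"
  have F: "log_deriv_eq F (of_int a * L)"
  proof (cases "a \<ge> 0")
    case True
    then show ?thesis
      using log_deriv_eq_power[OF log_deriv_eq_one_minus_power(1)[OF N], of "nat a"]
      by (simp add: F_def L_def)
  next
    case False
    then show ?thesis
      using log_deriv_eq_power[OF log_deriv_eq_one_minus_power(2)[OF N], of "nat (-a)"]
      by (simp add: F_def L_def)
  qed
  have FI: "F $ k \<in> \<int>" for k
    unfolding F_def by (auto intro!: fps_Ints_power simp: multiples_fps_def)
  have F0: "F $ 0 = 1" using N by (auto simp: F_def multiples_fps_def fps_power_zeroth zero_power power_0_left)
  define c' where "c' = c(N := - a)"
  have aL: "(of_int a * L) $ k = of_int a * L $ k" for k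
    unfolding fps_of_int[symmetric] by (rule fps_mult_left_const_nth)
  show ?case
  proof (rule exI[of _ "R' * F"], rule exI[of _ "S' + of_int a * L"], rule exI[of _ c'], intro conjI allI impI)
    show "(R' * F) $ 0 = 1" using R' F0 by simp
    show "(R' * F) $ k \<in> \<int>" for k using R' FI by (auto simp: fps_mult_nth intro!: Ints_sum)
    show "log_deriv_eq (R' * F) (S' + of_int a * L)" by (rule log_deriv_eq_mult[OF R'(3) F])
    show "(S' + of_int a * L) $ k = 0" if "k \<le> Suc K" for k
    proof (cases "k = N")
      case True
      then show ?thesis using SN N by (simp add: aL Lnth)
    next
      case False
      then have "k \<le> K" using that by (simp add: N_def)
      then have "\<not> (N dvd k \<and> k > 0)" by (auto simp: N_def dest: dvd_imp_le)
      then have "L $ k = 0" by (auto simp: Lnth)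
      with S'(1)[OF \<open>k \<le> K\<close>] show ?thesis by (simp add: aL)
    qed
    show "S $ k = (S' + of_int a * L) $ k + (\<Sum>n | n dvd k \<and> n \<le> Suc K. of_nat n * of_int (c' n))"
      if k: "k \<ge> 1" for k
    proof -
      have fin: "finite {n. n dvd k \<and> n \<le> K}" by (rule finite_subset[of _ "{..K}"]) auto
      have e: "(\<Sum>n | n dvd k \<and> n \<le> K. of_nat n * of_int (c' n)) = (\<Sum>n | n dvd k \<and> n \<le> K. of_nat n * of_int (c n) :: complex)"
        by (rule sum.cong) (auto simp: c'_def N_def)
      show ?thesis
      proof (cases "N dvd k")
        case True
        then have "{n. n dvd k \<and> n \<le> Suc K} = insert N {n. n dvd k \<and> n \<le> K}"
          by (auto simp: N_def le_Suc_eq)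
        moreover have "N \<notin> {n. n dvd k \<and> n \<le> K}" by (auto simp: N_def)
        ultimately show ?thesis using S'(2)[OF k] True k fin by (simp add: e aL Lnth c'_def)
      next
        case False
        then have "{n. n dvd k \<and> n \<le> Suc K} = {n. n dvd k \<and> n \<le> K}"
          by (auto simp: N_def le_Suc_eq)
        then show ?thesis using S'(2)[OF k] False e by (simp add: aL Lnth)
      qed
    qed
  qed
qed

lemma log_deriv_eq_coeffs:
  fixes R S :: "complex fps"
  assumes "R $ 0 = 1" "\<And>k. R $ k \<in> \<int>" "log_deriv_eq R S"
  shows "\<exists>c :: nat \<Rightarrow> int. \<forall>k\<in>{1..K}. S $ k = (\<Sum>n | n dvd k. of_nat n * of_int (c n))"
proof -
  obtain S' :: "complex fps" and c :: "nat \<Rightarrow> int" where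
    c: "\<And>k. k \<le> K \<Longrightarrow> S' $ k = 0"
      "\<And>k. k \<ge> 1 \<Longrightarrow> S $ k = S' $ k + (\<Sum>n | n dvd k \<and> n \<le> K. of_nat n * of_int (c n))"
    using log_deriv_eq_coeffs_aux[OF assms, of K] by blast
  have "S $ k = (\<Sum>n | n dvd k. of_nat n * of_int (c n))" if "k \<in> {1..K}" for k
  proof -
    have "{n. n dvd k \<and> n \<le> K} = {n. n dvd k}" using that by (auto dest: dvd_imp_le)
    then show ?thesis using c that by simp
  qed
  then show ?thesis by blast
qed

section \<open>Power sums of the roots and their congruences\<close>

definition power_sum :: "complex multiset \<Rightarrow> nat \<Rightarrow> complex" where
  "power_sum A k = (\<Sum>b\<in>#A. b ^ k)"

lemma power_sum_image: "power_sum (image_mset (\<lambda>b. b ^ j) A) k = power_sum A (k * j)"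
  by (induction A) (simp_all add: power_sum_def mult.commute flip: power_mult)

lemma log_deriv_eq_linear:
  "log_deriv_eq (1 - fps_const b * fps_X) (Abs_fps (\<lambda>k. if k = 0 then 0 else b ^ k))"
  unfolding log_deriv_eq_def
proof (rule fps_ext)
  fix k
  let ?S = "Abs_fps (\<lambda>k. if k = 0 then 0 else b ^ k)"
  have "(1 - fps_const b * fps_X) * ?S = ?S - fps_const b * (fps_X * ?S)"
    by (simp add: algebra_simps)
  moreover have "fps_deriv (1 - fps_const b * fps_X) = - fps_const b"
    by simp
  ultimately show "(fps_X * fps_deriv (1 - fps_const b * fps_X)) $ k = (- ((1 - fps_const b * fps_X) * ?S)) $ k"
    by (cases k rule: nat.exhaust; cases "k - 1") (auto simp: numeral_2_eq_2)
qed

lemma log_deriv_eq_prod_linear: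
  "log_deriv_eq (\<Prod>b\<in>#A. 1 - fps_const b * fps_X) (Abs_fps (\<lambda>k. if k = 0 then 0 else power_sum A k))"
proof (induction A)
  case empty
  have "Abs_fps (\<lambda>k. if k = 0 then 0 else power_sum {#} k) = 0"
    by (rule fps_ext) (simp add: power_sum_def)
  then show ?case by (simp add: log_deriv_eq_1)
next
  case (add b A)
  have "Abs_fps (\<lambda>k. if k = 0 then 0 else power_sum (add_mset b A) k) =
    Abs_fps (\<lambda>k. if k = 0 then 0 else b ^ k) + Abs_fps (\<lambda>k. if k = 0 then 0 else power_sum A k)"
    by (rule fps_ext) (simp add: power_sum_def)
  with log_deriv_eq_mult[OF log_deriv_eq_linear add.IH, of b] show ?case by simp
qed

lemma reflect_poly_prod_mset: "reflect_poly (\<Prod>x\<in>#A. f x) = (\<Prod>x\<in>#A. reflect_poly (f x :: complex poly))"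
  by (induction A) (simp_all add: reflect_poly_mult)

lemma fps_of_poly_prod_mset: "fps_of_poly (\<Prod>x\<in>#A. f x) = (\<Prod>x\<in>#A. fps_of_poly (f x :: complex poly))"
  by (induction A) (simp_all add: fps_of_poly_mult)

text \<open>Reversing the coefficients turns each factor x - b into 1 - b x. The series keeps
  integer coefficients and, as \<open>f\<close> is monic, gets constant coefficient 1, as
  \<open>log_deriv_eq_coeffs\<close> requires.\<close>

lemma fps_of_reflect_cpoly:
  assumes "lead_coeff f = 1"
  shows "fps_of_poly (reflect_poly (cpoly f)) = (\<Prod>b\<in>#proots (cpoly f). 1 - fps_const b * fps_X)"
proof -
  have "lead_coeff (cpoly f) = 1" using assms by (simp add: coeff_map_poly)
  then have "cpoly f = (\<Prod>x\<in>#proots (cpoly f). [:-x, 1:])"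
    using complex_poly_decompose_multiset[of "cpoly f"] by simp
  then have "fps_of_poly (reflect_poly (cpoly f)) =
      fps_of_poly (reflect_poly (\<Prod>x\<in>#proots (cpoly f). [:-x, 1:]))" by simp
  also have "\<dots> = (\<Prod>x\<in>#proots (cpoly f). fps_of_poly (reflect_poly [:-x, 1:]))"
    by (simp add: reflect_poly_prod_mset fps_of_poly_prod_mset)
  also have "\<dots> = (\<Prod>b\<in>#proots (cpoly f). 1 - fps_const b * fps_X)"
  proof -
    have "fps_of_poly (reflect_poly [:-x, 1:]) = 1 - fps_const x * fps_X" for x :: complex
    proof -
      have "reflect_poly [:-x, 1:] = [:1, -x:]"
        by (rule poly_eqI) (auto simp: coeff_reflect_poly coeff_pCons split: nat.split)
      then show ?thesis by (simp add: fps_of_poly_pCons algebra_simps flip: fps_const_neg)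
    qed
    then show ?thesis by (simp only:)
  qed
  finally show ?thesis .
qed

text \<open>Each power sum is a divisor sum of terms n c(n) with integral c. The difference keeps
  just those n that divide k p^r but not k p^(r-1), and all of these are multiples of p^r.\<close>

lemma power_sum_prime_power_cong:
  fixes f :: "int poly" and p r k :: nat
  assumes f: "lead_coeff f = 1" and p: "prime p" and r: "r > 0" and k: "k > 0"
  obtains t :: int where
    "power_sum (proots (cpoly f)) (k * p ^ r) - power_sum (proots (cpoly f)) (k * p ^ (r - 1)) = of_int (t * int (p ^ r))"
proof -
  let ?A = "proots (cpoly f)"
  let ?R = "fps_of_poly (reflect_poly (cpoly f))"
  let ?S = "Abs_fps (\<lambda>k. if k = 0 then 0 else power_sum ?A k)"
  have R1: "log_deriv_eq ?R ?S"
    unfolding fps_of_reflect_cpoly[OF f] by (rule log_deriv_eq_prod_linear)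
  have R2: "?R $ 0 = 1" using f by (simp add: coeff_map_poly)
  have R3: "?R $ j \<in> \<int>" for j by (simp add: coeff_reflect_poly coeff_map_poly)
  obtain c :: "nat \<Rightarrow> int" where
    c: "\<forall>j\<in>{1..k * p ^ r}. ?S $ j = (\<Sum>n | n dvd j. of_nat n * of_int (c n))"
    using log_deriv_eq_coeffs[OF R2 R3 R1] by (rule exE)
  have p0: "p > 0" using p prime_gt_0_nat by blast
  have pr: "p ^ r = p * p ^ (r - 1)" using r by (cases r) auto
  have le: "k * p ^ (r - 1) \<le> k * p ^ r" using p0 by (simp add: pr)
  have s: "power_sum ?A j = (\<Sum>n | n dvd j. of_nat n * of_int (c n))" if "0 < j" "j \<le> k * p ^ r" for j
    using bspec[OF c, of j] that by simp
  let ?D = "{n. n dvd k * p ^ r} - {n. n dvd k * p ^ (r - 1)}"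
  have pos: "k * p ^ r > 0" "k * p ^ (r - 1) > 0" using k p0 by auto
  have sub: "{n. n dvd k * p ^ (r - 1)} \<subseteq> {n. n dvd k * p ^ r}" by (auto simp: pr intro: dvd_trans)
  have "power_sum ?A (k * p ^ r) - power_sum ?A (k * p ^ (r - 1)) = (\<Sum>n\<in>?D. of_nat n * of_int (c n))"
    using pos le sub by (simp add: s sum_diff)
  also have "\<dots> = of_int (\<Sum>n\<in>?D. int n * c n)" by simp
  also have "int (p ^ r) dvd (\<Sum>n\<in>?D. int n * c n)"
  proof (intro dvd_sum dvd_mult2)
    fix n assume n: "n \<in> ?D"
    then have n0: "n \<noteq> 0" using k p0 by (intro notI) simp
    obtain a u where u: "n = p ^ a * u" "\<not> p dvd u"
      by (rule multiplicity_decompose'[of n p, OF n0]) (use p not_prime_unit in \<open>auto simp: prime_nat_iff\<close>)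
    \<comment> \<open>The part u of n prime to p divides k; with a < r the product p^a u would
      already divide k p^(r-1).\<close>
    have "a \<ge> r"
    proof (rule ccontr)
      assume "\<not> a \<ge> r"
      then have "a \<le> r - 1" by simp
      have "u dvd k * p ^ r" using n u(1) by (auto dest: dvd_mult_right)
      moreover have "coprime u (p ^ r)" using u(2) p prime_imp_coprime coprime_commute by auto
      ultimately have "u dvd k" by (simp add: coprime_dvd_mult_left_iff)
      then have "u * p ^ a dvd k * p ^ (r - 1)" using \<open>a \<le> r - 1\<close> by (intro mult_dvd_mono le_imp_power_dvd)
      then show False using n u(1) by (simp add: mult.commute)
    qed
    then have "p ^ r dvd n" using u(1) by (simp add: le_imp_power_dvd)
    then show "int (p ^ r) dvd int n" by (metis of_nat_dvd_iff)
  qed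
  then obtain t where "(\<Sum>n\<in>?D. int n * c n) = t * int (p ^ r)" by (metis dvdE mult.commute)
  finally show ?thesis using that by blast
qed

text \<open>Power sums determine the sum over the multiset of every polynomial of degree at most 2
  d. A polynomial vanishing on both supports except at \<open>x\<close> has such a degree, and its
  sum isolates the multiplicity of \<open>x\<close>.\<close>

lemma power_sum_eq_imp_eq:
  assumes sz: "size A \<le> d" "size B \<le> d" and eq: "\<And>k. k \<le> 2 * d \<Longrightarrow> power_sum A k = power_sum B k"
  shows "A = B"
proof (rule multiset_eqI)
  fix x
  define q where "q = (\<Prod>y\<in>(set_mset A \<union> set_mset B) - {x}. [:-y, 1:])"
  have "card (set_mset A \<union> set_mset B - {x}) \<le> 2 * d"
  proof -
    have "card (set_mset C) \<le> size C" for C :: "complex multiset"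
      by (induction C) (auto simp: card_insert_if)
    from this[of A] this[of B] show ?thesis
      using sz card_Un_le[of "set_mset A" "set_mset B"] card_Diff1_le[of "set_mset A \<union> set_mset B" x]
      by linarith
  qed
  then have deg: "degree q \<le> 2 * d" by (simp add: q_def degree_prod_sum_eq)
  have qz: "poly q y = 0" if "y \<in># A \<or> y \<in># B" "y \<noteq> x" for y
    using that by (auto simp: q_def poly_prod)
  have qx: "poly q x \<noteq> 0" by (auto simp: q_def poly_prod)
  have sum_poly: "(\<Sum>b\<in>#C. poly q b) = (\<Sum>i\<le>degree q. coeff q i * power_sum C i)" for C
    by (induction C) (simp_all add: power_sum_def poly_altdef algebra_simps sum.distrib)
  have cnt: "(\<Sum>b\<in>#C. poly q b) = of_nat (count C x) * poly q x" if "set_mset C \<subseteq> set_mset A \<union> set_mset B" for C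
    using that by (induction C) (auto simp: algebra_simps qz)
  have "(\<Sum>b\<in>#A. poly q b) = (\<Sum>b\<in>#B. poly q b)"
    unfolding sum_poly using deg eq by (intro sum.cong) auto
  then show "count A x = count B x" using qx by (simp add: cnt)
qed

text \<open>
  The power sums of both families agree modulo $p^r$ and are too small to differ by a nonzero
  multiple of $p^r$.
\<close>
lemma prime_power_roots_eq:
  fixes f :: "int poly" and p r :: nat
  assumes f: "lead_coeff f = 1" and p: "prime p" and r: "r > 0"
    and bnd: "\<And>b j. poly (cpoly f) b = 0 \<Longrightarrow> j \<le> 2 * degree f * p ^ r \<Longrightarrow> cmod b ^ j \<le> B"
    and B: "2 * real (degree f) * B < real (p ^ r)"
  shows "(\<lambda>b. b ^ p ^ r) ` {b. poly (cpoly f) b = 0} = (\<lambda>b. b ^ p ^ (r - 1)) ` {b. poly (cpoly f) b = 0}"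
proof -
  let ?A = "proots (cpoly f)"
  have f0: "f \<noteq> 0" using f by auto
  have pr: "p ^ (r - 1) \<le> p ^ r" using prime_gt_0_nat[OF p] by (intro power_increasing) auto
  have sz: "size ?A = degree f" by (simp add: size_proots_complex)
  have ps: "cmod (power_sum ?A j) \<le> degree f * B" if "j \<le> 2 * degree f * p ^ r" for j
  proof -
    have "cmod (\<Sum>b\<in>#C. b ^ j) \<le> size C * B" if "set_mset C \<subseteq> {b. poly (cpoly f) b = 0}" for C
      using that
    proof (induction C)
      case (add b C)
      then have "cmod (b ^ j) \<le> B" using bnd[of b j] \<open>j \<le> _\<close> by (simp add: norm_power)
      then show ?case using add norm_triangle_ineq[of "b ^ j" "\<Sum>b\<in>#C. b ^ j"]
        by (auto simp: algebra_simps)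
    qed simp
    from this[of ?A] show ?thesis using f0 by (simp add: sz power_sum_def)
  qed
  have "image_mset (\<lambda>b. b ^ p ^ r) ?A = image_mset (\<lambda>b. b ^ p ^ (r - 1)) ?A"
  proof (rule power_sum_eq_imp_eq[where d = "degree f"])
    fix k assume k: "k \<le> 2 * degree f"
    show "power_sum (image_mset (\<lambda>b. b ^ p ^ r) ?A) k = power_sum (image_mset (\<lambda>b. b ^ p ^ (r - 1)) ?A) k"
    proof (cases "k = 0")
      case True
      then show ?thesis by (simp add: power_sum_def)
    next
      case False
      obtain t where t: "power_sum ?A (k * p ^ r) - power_sum ?A (k * p ^ (r - 1)) = of_int (t * int (p ^ r))"
        using power_sum_prime_power_cong[OF f p r, of k] False by auto
      have "k * p ^ r \<le> 2 * degree f * p ^ r" using k by simp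
      moreover have "k * p ^ (r - 1) \<le> 2 * degree f * p ^ r" using k pr by (intro mult_le_mono)
      ultimately have "cmod (power_sum ?A (k * p ^ r)) \<le> degree f * B" "cmod (power_sum ?A (k * p ^ (r - 1))) \<le> degree f * B"
        using ps by auto
      then have "cmod (power_sum ?A (k * p ^ r) - power_sum ?A (k * p ^ (r - 1))) \<le> 2 * degree f * B"
        using norm_triangle_ineq4[of "power_sum ?A (k * p ^ r)" "power_sum ?A (k * p ^ (r - 1))"] by linarith
      then have "\<bar>real_of_int (t * int (p ^ r))\<bar> < real (p ^ r)" using B unfolding t norm_of_int by linarith
      then have "\<bar>t * int (p ^ r)\<bar> < int (p ^ r)" by linarith
      then have "\<bar>t\<bar> * int (p ^ r) < 1 * int (p ^ r)" by (simp only: abs_mult abs_of_nat mult_1)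
      then have "\<bar>t\<bar> < 1" by (rule mult_right_less_imp_less) simp
      then have "t = 0" by simp
      then show ?thesis using t by (simp add: power_sum_image)
    qed
  qed (simp_all add: sz)
  from arg_cong[OF this, of set_mset] show ?thesis using f0 by simp
qed

section \<open>Roots near the unit disc are 0 or roots of unity of bounded order\<close>

lemma finite_roots_cpoly: "f \<noteq> 0 \<Longrightarrow> finite {b. poly (cpoly f) b = 0}"
  by (rule poly_roots_finite) simp

text \<open>A quantitative form of Kronecker's theorem. Take p = 2 and r with 4 d < 2^r <= 8 d. The
  powers involved have exponent at most 2 d 2^r <= 16 d^2, and (1 + 1/(32 d^2))^(16 d^2) <= exp(1/2)
  <= 2, so \<open>prime_power_roots_eq\<close> applies with B = 2, its size condition being 4 d <
  2^r. This is the origin of the constant 32.\<close>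

lemma root_of_unity_of_small_house:
  fixes f :: "int poly"
  assumes f: "lead_coeff f = 1"
    and house: "\<And>b. poly (cpoly f) b = 0 \<Longrightarrow> cmod b \<le> 1 + 1 / (32 * (real (degree f))\<^sup>2)"
    and z: "poly (cpoly f) z = 0" "z \<noteq> 0"
  obtains m where "m > 0" "z ^ m = 1"
proof -
  define d where "d = degree f"
  have f0: "f \<noteq> 0" using f by auto
  have "d \<noteq> 0"
  proof
    assume "d = 0"
    then obtain c where "f = [:c:]" using degree_eq_zeroE d_def by metis
    with f0 z(1) show False by (auto simp: map_poly_pCons)
  qed
  obtain r where r: "4 * d < 2 ^ r" "2 ^ r \<le> 8 * d"
  proof -
    define r where "r = (LEAST r. 4 * d < 2 ^ r)"
    have ex: "4 * d < 2 ^ (4 * d)" by simp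
    have 1: "4 * d < 2 ^ r" unfolding r_def by (rule LeastI[of "\<lambda>r. 4 * d < 2 ^ r", OF ex])
    have "r \<noteq> 0" using 1 \<open>d \<noteq> 0\<close> by (cases r) auto
    then have "\<not> 4 * d < 2 ^ (r - 1)" using not_less_Least[of "r - 1" "\<lambda>r. 4 * d < 2 ^ r"] by (simp add: r_def)
    then have "2 ^ r \<le> 8 * d" using \<open>r \<noteq> 0\<close> by (cases r) auto
    with 1 that show ?thesis by blast
  qed
  have r0: "r > 0" using r \<open>d \<noteq> 0\<close> by (cases r) auto
  have "cmod b ^ j \<le> 2" if b: "poly (cpoly f) b = 0" and j: "j \<le> 2 * d * 2 ^ r" for b j
  proof -
    have "j \<le> 2 * d * (8 * d)" using j r(2) by (meson le_trans mult_le_mono2)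
    then have j': "j \<le> 16 * d\<^sup>2" by (simp add: power2_eq_square)
    let ?e = "1 / (32 * (real d)\<^sup>2)"
    have "cmod b ^ j \<le> (1 + ?e) ^ j" using house[OF b] by (intro power_mono) (auto simp: d_def)
    also have "\<dots> \<le> exp ?e ^ j" by (intro power_mono) (auto intro: exp_ge_add_one_self)
    also have "\<dots> = exp (real j * ?e)" by (simp only: exp_of_nat_mult)
    also have "\<dots> \<le> exp (1 / 2)"
    proof -
      have "real j \<le> real (16 * d\<^sup>2)" using j' by (simp only: of_nat_le_iff)
      then have "real j * ?e \<le> real (16 * d\<^sup>2) * ?e" by (rule mult_right_mono) simp
      also have "\<dots> = 1 / 2" using \<open>d \<noteq> 0\<close> by simp
      finally show ?thesis by simp
    qed
    also have "\<dots> \<le> 2" using exp_bound_half[of "1/2 :: real"] by simp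
    finally show ?thesis .
  qed
  moreover have "2 * real (degree f) * 2 < real (2 ^ r)"
  proof -
    have "real (4 * d) < real (2 ^ r)" using r(1) by (simp only: of_nat_less_iff)
    then show ?thesis by (simp add: d_def)
  qed
  ultimately have img: "(\<lambda>b. b ^ 2 ^ r) ` {b. poly (cpoly f) b = 0} = (\<lambda>b. b ^ 2 ^ (r - 1)) ` {b. poly (cpoly f) b = 0}"
    using prime_power_roots_eq[OF f two_is_prime_nat r0, of 2] by (simp add: d_def)
  \<comment> \<open>Equality of the two images makes \<open>?G\<close> closed under squaring. It is
    finite, so the iterated squares of g repeat; as g is not 0, it is a root of unity.\<close>
  let ?G = "(\<lambda>b. b ^ 2 ^ (r - 1)) ` {b. poly (cpoly f) b = 0}"
  have sq: "g\<^sup>2 \<in> ?G" if "g \<in> ?G" for g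
  proof -
    from that obtain b where b: "poly (cpoly f) b = 0" "g = b ^ 2 ^ (r - 1)" by auto
    have "2 ^ r = 2 ^ (r - 1) * (2::nat)" using r0 by (cases r) auto
    then have "g\<^sup>2 = b ^ 2 ^ r" by (simp add: b(2) power_mult)
    with b(1) img show ?thesis by blast
  qed
  define g where "g = z ^ 2 ^ (r - 1)"
  have mem: "g ^ 2 ^ i \<in> ?G" for i
  proof (induction i)
    case 0
    then show ?case using z by (auto simp: g_def)
  next
    case (Suc i)
    from sq[OF this] show ?case by (simp add: mult.commute flip: power_mult)
  qed
  have "finite ?G" using finite_roots_cpoly[OF f0] by simp
  then have "\<not> inj (\<lambda>i. g ^ 2 ^ i)"
    using mem by (metis finite_imageD finite_subset image_subset_iff infinite_UNIV_nat)
  then obtain i j where ij: "i < j" "g ^ 2 ^ i = g ^ 2 ^ j"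
    unfolding inj_def by (metis linorder_neqE_nat)
  have lt: "(2::nat) ^ i < 2 ^ j" using ij(1) by simp
  have "g \<noteq> 0" using z by (simp add: g_def)
  have "g ^ 2 ^ i * g ^ (2 ^ j - 2 ^ i) = g ^ (2 ^ i + (2 ^ j - 2 ^ i))"
    by (simp only: power_add)
  also have "(2::nat) ^ i + (2 ^ j - 2 ^ i) = 2 ^ j" using lt by simp
  finally have "g ^ 2 ^ i * g ^ (2 ^ j - 2 ^ i) = g ^ 2 ^ i * 1" using ij(2) by simp
  then have "g ^ (2 ^ j - 2 ^ i) = 1" using \<open>g \<noteq> 0\<close> by simp
  then have "z ^ (2 ^ (r - 1) * (2 ^ j - 2 ^ i)) = 1" by (simp add: g_def power_mult)
  moreover have "2 ^ (r - 1) * (2 ^ j - 2 ^ i) > (0::nat)" using lt by simp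
  ultimately show ?thesis using that by blast
qed

lemma power_eq_1_coprime:
  fixes z :: complex
  assumes "z ^ a = 1" "z ^ b = 1" "coprime a b"
  shows "z = 1"
proof (cases "a = 0")
  case True
  then show ?thesis using assms by simp
next
  case False
  obtain x y where "a * x = b * y + gcd a b" using bezout_nat[OF False] by blast
  then have "a * x = b * y + 1" using assms(3) by simp
  then have "z ^ (a * x) = z ^ (b * y) * z" by simp
  then show ?thesis using assms(1,2) by (simp add: power_mult)
qed

text \<open>All roots of \<open>f\<close> are m-th roots of unity, so the power sums are bounded by
  the degree and r may be taken large. This yields a root b with y^(p^r) = b^(p^(r-1)). The quotient
  y^p / b is killed by the coprime exponents p^(r-1) and m, hence y^p = b.\<close>

lemma prime_power_conjugate:
  fixes f :: "int poly"
  assumes f: "lead_coeff f = 1" "prime_elem f" "poly (cpoly f) z = 0"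
    and m: "m > 0" "z ^ m = 1" and p: "prime p" "\<not> p dvd m"
    and y: "poly (cpoly f) y = 0"
  shows "poly (cpoly f) (y ^ p) = 0"
proof -
  have "poly (cpoly (monom 1 m - 1)) z = 0"
    using m by (simp add: cpoly_diff map_poly_monom poly_monom)
  from prime_elem_dvd_of_common_root[OF f(2,3) this] obtain h where h: "monom 1 m - 1 = f * h" by auto
  have unity: "b ^ m = 1" if "poly (cpoly f) b = 0" for b
  proof -
    have "poly (cpoly (monom 1 m - 1)) b = 0" using that by (simp add: h cpoly_mult)
    then show ?thesis by (simp add: cpoly_diff map_poly_monom poly_monom)
  qed
  have norm1: "cmod b = 1" if "poly (cpoly f) b = 0" for b
    using unity[OF that] m(1) by (metis norm_one norm_power power_eq_1_iff norm_ge_zero less_numeral_extra(3))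
  define r where "r = Suc (2 * degree f)"
  have "2 * degree f < p ^ r"
  proof -
    have "2 * degree f < 2 ^ r" unfolding r_def by (meson less_SucI less_exp less_trans lessI)
    also have "\<dots> \<le> p ^ r" using prime_ge_2_nat[OF p(1)] by (rule power_mono) simp
    finally show ?thesis .
  qed
  then have "real (2 * degree f) < real (p ^ r)" by (simp only: of_nat_less_iff)
  then have "2 * real (degree f) * 1 < real (p ^ r)" by simp
  then have img: "(\<lambda>b. b ^ p ^ r) ` {b. poly (cpoly f) b = 0} = (\<lambda>b. b ^ p ^ (r - 1)) ` {b. poly (cpoly f) b = 0}"
    by (intro prime_power_roots_eq[OF f(1) p(1), of r 1]) (auto simp: norm1 r_def)
  then obtain b where b: "poly (cpoly f) b = 0" "y ^ p ^ r = b ^ p ^ (r - 1)" using y by blast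
  have "b \<noteq> 0" using norm1[OF b(1)] by auto
  have "(y ^ p / b) ^ p ^ (r - 1) = 1"
    using b(2) \<open>b \<noteq> 0\<close> by (simp add: power_divide r_def flip: power_mult)
  moreover have "(y ^ p / b) ^ m = 1"
    using unity[OF y] unity[OF b(1)] by (simp add: power_divide mult.commute flip: power_mult)
      (simp add: mult.commute power_mult)
  moreover have "coprime (p ^ (r - 1)) m" using p by (simp add: prime_imp_coprime)
  ultimately have "y ^ p / b = 1" by (rule power_eq_1_coprime)
  then show ?thesis using b(1) \<open>b \<noteq> 0\<close> by simp
qed

text \<open>Applying \<open>prime_power_conjugate\<close> along the prime factors of j shows that
  z^j is a root of \<open>f\<close> for every j coprime to m. Since \<open>z\<close> has exact order
  m, these roots are distinct.\<close>

lemma totient_le_degree: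
  fixes f :: "int poly"
  assumes f: "lead_coeff f = 1" "prime_elem f" "poly (cpoly f) z = 0"
    and m: "m > 0" "z ^ m = 1" "\<And>j. 0 < j \<Longrightarrow> j < m \<Longrightarrow> z ^ j \<noteq> 1"
  shows "totient m \<le> degree f"
proof -
  have conj: "poly (cpoly f) (y ^ j) = 0" if "j > 0" "coprime j m" "poly (cpoly f) y = 0" for y j
    using that
  proof (induction j arbitrary: y rule: prime_divisors_induct)
    case (unit x)
    then show ?case by simp
  next
    case (factor p j)
    have "\<not> p dvd m" using factor.prems(2) factor.hyps
      by (metis coprime_common_divisor dvd_triv_left not_prime_unit)
    from prime_power_conjugate[OF f m(1,2) factor.hyps this factor.prems(3)]
    have "poly (cpoly f) (y ^ p) = 0" .
    then have "poly (cpoly f) ((y ^ p) ^ j) = 0" using factor.prems by (intro factor.IH) auto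
    then show ?case by (simp add: power_mult)
  qed simp
  have f0: "f \<noteq> 0" using f by auto
  have inj: "inj_on (\<lambda>j. z ^ j) {0<..m}"
  proof (rule inj_onI)
    have "z \<noteq> 0" using m(1,2) by (auto simp: power_0_left)
    have *: False if "i \<in> {0<..m}" "j \<in> {0<..m}" "i < j" "z ^ i = z ^ j" for i j
    proof -
      have "z ^ i * z ^ (j - i) = z ^ (i + (j - i))" by (simp only: power_add)
      also have "i + (j - i) = j" using that by simp
      finally have "z ^ i * z ^ (j - i) = z ^ i * 1" using that by simp
      then have "z ^ (j - i) = 1" using \<open>z \<noteq> 0\<close> by simp
      moreover have "0 < j - i" "j - i < m" using that by auto
      ultimately show False using m(3) by blast
    qed
    fix i j assume "i \<in> {0<..m}" "j \<in> {0<..m}" "z ^ i = z ^ j"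
    then show "i = j" using *[of i j] *[of j i] by (metis linorder_neqE_nat)
  qed
  have "totient m = card (totatives m)" by (simp add: totient_def)
  also have "\<dots> = card ((\<lambda>j. z ^ j) ` totatives m)"
    by (rule card_image[symmetric]) (rule inj_on_subset[OF inj], auto simp: totatives_def)
  also have "\<dots> \<le> card {b. poly (cpoly f) b = 0}"
    by (rule card_mono[OF finite_roots_cpoly[OF f0]]) (auto simp: totatives_def intro!: conj f(3))
  also have "\<dots> \<le> degree (cpoly f)" by (rule card_poly_roots_bound) (simp add: f0)
  finally show ?thesis by simp
qed

subsection \<open>Double roots of ternary polynomials\<close>

lemma square_linear_dvd_iff:
  fixes P :: "complex poly"
  shows "[:-z, 1:]\<^sup>2 dvd P \<longleftrightarrow> poly P z = 0 \<and> poly (pderiv P) z = 0"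
proof
  assume "[:-z, 1:]\<^sup>2 dvd P"
  then obtain Q where Q: "P = [:-z, 1:]\<^sup>2 * Q" unfolding dvd_def by blast
  show "poly P z = 0 \<and> poly (pderiv P) z = 0"
    unfolding Q power2_eq_square pderiv_mult by (simp add: pderiv_pCons)
next
  assume h: "poly P z = 0 \<and> poly (pderiv P) z = 0"
  then obtain Q where Q: "P = [:-z, 1:] * Q" using poly_eq_0_iff_dvd by blast
  have "poly Q z = 0" using h unfolding Q pderiv_mult by (simp add: pderiv_pCons)
  then have "[:-z, 1:] dvd Q" by (simp add: poly_eq_0_iff_dvd)
  then show "[:-z, 1:]\<^sup>2 dvd P" unfolding Q power2_eq_square by (intro mult_dvd_mono) auto
qed

lemma dominant_sum_less:
  fixes x :: real
  assumes x: "x \<ge> 2"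
  shows "(\<Sum>j<n. x ^ j) < x ^ n"
  using x
proof (induction n)
  case (Suc n)
  have "(\<Sum>j<Suc n. x ^ j) < x ^ n + x ^ n" using Suc by simp
  also have "\<dots> \<le> x ^ Suc n" using x by (simp add: mult_right_mono)
  finally show ?case .
qed simp

text \<open>Beyond modulus 2 the leading term outweighs the sum of all others, since the
  coefficients have modulus at most 1.\<close>

lemma root_of_ternary_poly_bound:
  fixes P :: "int poly"
  assumes P: "P \<noteq> 0" "\<And>j. coeff P j \<in> {-1, 0, 1}" and z: "poly (cpoly P) z = 0"
  shows "cmod z \<le> 2"
proof (rule ccontr)
  assume "\<not> cmod z \<le> 2"
  then have z2: "cmod z \<ge> 2" by simp
  define n where "n = degree P"
  have lead: "\<bar>coeff P n\<bar> = 1" using P(1) P(2)[of n] by (auto simp: n_def)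
  have "0 = (\<Sum>j\<le>n. of_int (coeff P j) * z ^ j)"
    using z by (simp add: poly_altdef coeff_map_poly n_def)
  also have "\<dots> = (\<Sum>j<n. of_int (coeff P j) * z ^ j) + of_int (coeff P n) * z ^ n"
    by (simp add: lessThan_Suc_atMost[symmetric])
  finally have "of_int (coeff P n) * z ^ n = - (\<Sum>j<n. of_int (coeff P j) * z ^ j)"
    by (simp add: eq_neg_iff_add_eq_0 add.commute)
  then have "cmod (of_int (coeff P n) * z ^ n) = cmod (\<Sum>j<n. of_int (coeff P j) * z ^ j)" by simp
  also have "\<dots> \<le> (\<Sum>j<n. cmod z ^ j)"
  proof (rule sum_norm_le)
    fix j
    have "\<bar>real_of_int (coeff P j)\<bar> \<le> 1" using P(2)[of j] by auto
    then show "cmod (of_int (coeff P j) * z ^ j) \<le> cmod z ^ j"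
      by (simp add: norm_mult norm_power mult_left_le_one_le)
  qed
  also have "\<dots> < cmod z ^ n" by (rule dominant_sum_less[OF z2])
  finally show False using lead by (simp add: norm_mult norm_power flip: of_int_abs)
qed

text \<open>A factor x - b enlarges the largest coefficient at most by 1 + 2, hence the base
  3.\<close>

lemma coeff_prod_linear_bound:
  assumes "\<And>b. b \<in># A \<Longrightarrow> cmod b \<le> 2"
  shows "cmod (coeff (\<Prod>b\<in>#A. [:-b, 1:]) i) \<le> 3 ^ size A"
  using assms
proof (induction A arbitrary: i)
  case empty
  then show ?case by (simp add: coeff_1)
next
  case (add b A)
  let ?Q = "\<Prod>b\<in>#A. [:-b, 1:]"
  have IH: "cmod (coeff ?Q i) \<le> 3 ^ size A" for i using add by simp
  have b: "cmod b \<le> 2" using add by simp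
  have e: "coeff (\<Prod>b\<in>#add_mset b A. [:-b, 1:]) i = - b * coeff ?Q i + (case i of 0 \<Rightarrow> 0 | Suc j \<Rightarrow> coeff ?Q j)"
    by (simp add: coeff_pCons split: nat.split)
  have "cmod (b * coeff ?Q i) \<le> 2 * 3 ^ size A" unfolding norm_mult by (intro mult_mono b IH) auto
  moreover have "cmod (case i of 0 \<Rightarrow> 0 | Suc j \<Rightarrow> coeff ?Q j) \<le> 3 ^ size A"
    using IH by (auto split: nat.split)
  ultimately show ?case unfolding e
    using norm_triangle_ineq[of "- b * coeff ?Q i" "case i of 0 \<Rightarrow> 0 | Suc j \<Rightarrow> coeff ?Q j"] by simp
qed

text \<open>A union bound needs a list fixed before the random coefficients are seen. This finite
  family depends on D alone and contains every monic factor of degree at most D of a nonzero ternary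
  polynomial: roots of modulus at most 2 keep the coefficients below 3^D.\<close>

definition small_polys :: "nat \<Rightarrow> int poly set" where
  "small_polys D = {f. lead_coeff f = 1 \<and> degree f \<le> D \<and> (\<forall>i. \<bar>coeff f i\<bar> \<le> 3 ^ D)}"

text \<open>The margin 1 / (32 D^2) is the one tolerated by
  \<open>root_of_unity_of_small_house\<close> in degree D.\<close>

definition large_roots :: "nat \<Rightarrow> complex set" where
  "large_roots D = {b. cmod b > 1 + 1 / (32 * (real D)\<^sup>2) \<and> (\<exists>f\<in>small_polys D. poly (cpoly f) b = 0)}"

lemma small_polys_finite_card:
  "finite (small_polys D)" "card (small_polys D) \<le> (2 * 3 ^ D + 1) ^ (D + 1)"
proof -
  define F where "F = (\<lambda>c :: nat \<Rightarrow> int. \<Sum>i\<le>D. monom (c i) i)"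
  define X where "X = PiE {..D} (\<lambda>_. {- (3 ^ D)..3 ^ D :: int})"
  have X: "finite X" "card X = (2 * 3 ^ D + 1) ^ (D + 1)"
    unfolding X_def by (auto intro!: finite_PiE simp: card_PiE nat_add_distrib nat_mult_distrib nat_power_eq)
  have sub: "small_polys D \<subseteq> F ` X"
  proof
    fix f assume f: "f \<in> small_polys D"
    have "f = F (restrict (coeff f) {..D})"
    proof (rule poly_eqI)
      fix j
      have "j > D \<Longrightarrow> coeff f j = 0" using f by (auto simp: small_polys_def intro: coeff_eq_0)
      then show "coeff f j = coeff (F (restrict (coeff f) {..D})) j"
        by (auto simp: F_def coeff_sum sum.delta)
    qed
    moreover have "restrict (coeff f) {..D} \<in> X"
      using f by (auto simp: X_def small_polys_def abs_le_iff minus_le_iff)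
    ultimately show "f \<in> F ` X" by blast
  qed
  show "finite (small_polys D)" using sub X(1) finite_surj by blast
  have "card (small_polys D) \<le> card (F ` X)" using sub X(1) by (intro card_mono) auto
  also have "\<dots> \<le> card X" by (rule card_image_le[OF X(1)])
  finally show "card (small_polys D) \<le> (2 * 3 ^ D + 1) ^ (D + 1)" by (simp add: X(2))
qed

lemma large_roots_finite_card:
  "finite (large_roots D)" "card (large_roots D) \<le> D * (2 * 3 ^ D + 1) ^ (D + 1)"
proof -
  let ?U = "\<Union>f\<in>small_polys D. {b. poly (cpoly f) b = 0}"
  have sub: "large_roots D \<subseteq> ?U" by (auto simp: large_roots_def)
  have nz: "f \<noteq> 0" if "f \<in> small_polys D" for f using that by (auto simp: small_polys_def)
  have fin: "finite ?U" using small_polys_finite_card(1) nz finite_roots_cpoly by blast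
  show "finite (large_roots D)" using sub fin by (rule finite_subset)
  have "card (large_roots D) \<le> card ?U" by (rule card_mono[OF fin sub])
  also have "\<dots> \<le> (\<Sum>f\<in>small_polys D. card {b. poly (cpoly f) b = 0})"
    by (rule card_UN_le[OF small_polys_finite_card(1)])
  also have "\<dots> \<le> (\<Sum>f\<in>small_polys D. D)"
  proof (rule sum_mono)
    fix f assume f: "f \<in> small_polys D"
    have "card {b. poly (cpoly f) b = 0} \<le> degree (cpoly f)"
      by (rule card_poly_roots_bound) (simp add: nz[OF f])
    also have "\<dots> \<le> D" using f by (simp add: small_polys_def)
    finally show "card {b. poly (cpoly f) b = 0} \<le> D" .
  qed
  also have "\<dots> \<le> D * (2 * 3 ^ D + 1) ^ (D + 1)" using small_polys_finite_card(2) by simp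
  finally show "card (large_roots D) \<le> D * (2 * 3 ^ D + 1) ^ (D + 1)" .
qed

text \<open>Everything is read off the prime factor \<open>f\<close> with root \<open>z\<close> and
  \<open>f\<^sup>2\<close> dividing \<open>P\<close>. If its degree is low and all its roots are
  within the margin, \<open>z\<close> is 0 or a root of unity, whose order the totient bounds
  control. Otherwise some conjugate of \<open>z\<close> lies outside; it is this conjugate, not
  \<open>z\<close>, that the second case records.\<close>

lemma double_root_cases:
  fixes P :: "int poly"
  assumes P: "P \<noteq> 0" "\<And>j. coeff P j \<in> {-1, 0, 1}"
    and z: "poly (cpoly P) z = 0" "poly (pderiv (cpoly P)) z = 0" and D: "D > 0"
  shows "(\<exists>f. lead_coeff f = 1 \<and> degree f \<ge> D \<and> f\<^sup>2 dvd P) \<or>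
    (\<exists>b\<in>large_roots D. poly (cpoly P) b = 0) \<or> z = 0 \<or> (\<exists>m. 0 < m \<and> m \<le> 2 * D\<^sup>2 \<and> z ^ m = 1)"
proof -
  obtain f0 where f0: "prime_elem f0" "f0\<^sup>2 dvd P" "poly (cpoly f0) z = 0"
    using prime_square_dvd_of_double_root[OF P(1) z] .
  \<comment> \<open>\<open>P\<close> has leading coefficient 1 or -1, hence so has its factor, and a
    change of sign makes the factor monic.\<close>
  have "lead_coeff f0 dvd lead_coeff P"
  proof -
    have "f0 dvd P" using f0(2) by (meson dvd_power dvd_trans pos2)
    then obtain g where "P = f0 * g" by auto
    then show ?thesis by (simp add: lead_coeff_mult)
  qed
  moreover have "\<bar>lead_coeff P\<bar> = 1" using P(1) P(2)[of "degree P"] by auto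
  ultimately have "\<bar>lead_coeff f0\<bar> = 1" by (metis dvd_abs_iff abs_dvd_iff zdvd1_eq abs_idempotent)
  then have "lead_coeff f0 = 1 \<or> lead_coeff (- f0) = 1" by auto
  then obtain f where f: "lead_coeff f = 1" "prime_elem f" "f\<^sup>2 dvd P" "poly (cpoly f) z = 0"
  proof
    assume "lead_coeff (- f0) = 1"
    moreover have "prime_elem (- f0)" using f0(1) by (simp add: prime_elem_def)
    moreover have "poly (cpoly (- f0)) z = 0" using cpoly_diff[of 0 f0] f0(3) by simp
    ultimately show ?thesis using that[of "- f0"] f0 by simp
  qed (use that f0 in blast)
  have "f dvd P" using f(3) by (meson dvd_power dvd_trans pos2)
  then obtain g where g: "P = f * g" by auto
  have rootP: "poly (cpoly P) b = 0" if "poly (cpoly f) b = 0" for b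
    using that by (simp add: g cpoly_mult)
  have fn0: "f \<noteq> 0" using f(1) by auto
  show ?thesis
  proof (cases "degree f \<ge> D")
    case True
    then show ?thesis using f by blast
  next
    case False
    then have dD: "degree f \<le> D" by simp
    have "degree f > 0"
    proof (rule ccontr)
      assume "\<not> degree f > 0"
      then obtain c where "f = [:c:]" using degree_eq_zeroE by blast
      with fn0 f(4) show False by (auto simp: map_poly_pCons)
    qed
    have small: "f \<in> small_polys D"
    proof -
      have lc: "lead_coeff (cpoly f) = 1" using f(1) by (simp add: coeff_map_poly)
      have "\<bar>coeff f i\<bar> \<le> 3 ^ D" for i
      proof -
        have "cmod (coeff (\<Prod>b\<in>#proots (cpoly f). [:-b, 1:]) i) \<le> 3 ^ size (proots (cpoly f))"
          by (rule coeff_prod_linear_bound) (use root_of_ternary_poly_bound[OF P] rootP fn0 in auto)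
        then have "\<bar>real_of_int (coeff f i)\<bar> \<le> 3 ^ degree f"
          using complex_poly_decompose_multiset[of "cpoly f"] lc
          by (simp add: size_proots_complex coeff_map_poly)
        also have "\<dots> \<le> 3 ^ D" using dD by (intro power_increasing) auto
        finally have "real_of_int \<bar>coeff f i\<bar> \<le> real_of_int (3 ^ D)" by simp
        then show ?thesis by (simp only: of_int_le_iff)
      qed
      then show ?thesis using f(1) dD by (simp add: small_polys_def)
    qed
    show ?thesis
    proof (cases "\<forall>b. poly (cpoly f) b = 0 \<longrightarrow> cmod b \<le> 1 + 1 / (32 * (real (degree f))\<^sup>2)")
      case True
      show ?thesis
      proof (cases "z = 0")
        case False
        obtain k where k: "k > 0" "z ^ k = 1"
          using root_of_unity_of_small_house[OF f(1) _ f(4) False] True by blast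
        define m where "m = (LEAST k. k > 0 \<and> z ^ k = 1)"
        have m: "m > 0 \<and> z ^ m = 1" unfolding m_def by (rule LeastI[of _ k]) (use k in auto)
        have mm: "z ^ j \<noteq> 1" if "0 < j" "j < m" for j
          using not_less_Least[of j "\<lambda>k. k > 0 \<and> z ^ k = 1"] that by (auto simp: m_def)
        have "totient m \<le> degree f" using totient_le_degree[OF f(1,2,4)] m mm by blast
        then have "(totient m)\<^sup>2 \<le> D\<^sup>2" using dD by (intro power_mono) auto
        then have "m \<le> 2 * D\<^sup>2" using le_double_totient_square[of m] by linarith
        then show ?thesis using m by blast
      qed simp
    next
      case False
      then obtain b where b: "poly (cpoly f) b = 0" "cmod b > 1 + 1 / (32 * (real (degree f))\<^sup>2)"
        by (auto simp: not_le)
      \<comment> \<open>The margin shrinks with the degree, so exceeding the one for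
        \<open>degree f\<close> implies exceeding the one for D.\<close>
      have "1 / (32 * (real D)\<^sup>2) \<le> 1 / (32 * (real (degree f))\<^sup>2)"
        using dD \<open>degree f > 0\<close> by (intro divide_left_mono mult_left_mono power_mono mult_pos_pos) auto
      then have "b \<in> large_roots D" using b small by (auto simp: large_roots_def)
      then show ?thesis using rootP[OF b(1)] by blast
    qed
  qed
qed

subsection \<open>Anticoncentration by conditioning\<close>

abbreviation iid :: "int pmf \<Rightarrow> nat set \<Rightarrow> (nat \<Rightarrow> int) pmf" where
  "iid d I \<equiv> Pi_pmf I 0 (\<lambda>_. d)"

abbreviation iid_prob :: "int pmf \<Rightarrow> nat set \<Rightarrow> (nat \<Rightarrow> int) set \<Rightarrow> real" where
  "iid_prob d I \<equiv> measure_pmf.prob (iid d I)"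

lemma iid_value_in_support:
  assumes "finite I" "a \<in> set_pmf (iid d I)" "j \<in> I"
  shows "a j \<in> set_pmf d"
  using assms by (auto simp: set_Pi_pmf PiE_dflt_def)

lemma prob_iid_le_conditional:
  assumes I: "finite I" "J \<subseteq> I" and c: "c \<ge> 0"
    and bnd: "\<And>b. b \<in> set_pmf (iid d (I - J)) \<Longrightarrow>
      iid_prob d J {a. (\<lambda>x. if x \<in> I - J then b x else a x) \<in> E} \<le> c"
  shows "iid_prob d I E \<le> c"
proof -
  have fin: "finite J" "finite (I - J)" using I finite_subset by auto
  have "I = (I - J) \<union> J" using I by auto
  then have "iid d I = map_pmf (\<lambda>(f, g) x. if x \<in> I - J then f x else g x) (pair_pmf (iid d (I - J)) (iid d J))"
    using Pi_pmf_union[OF fin(2,1), of 0 "\<lambda>_. d"] by auto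
  also have "\<dots> = bind_pmf (iid d (I - J)) (\<lambda>f. map_pmf (\<lambda>g x. if x \<in> I - J then f x else g x) (iid d J))"
    by (simp add: pair_pmf_def map_bind_pmf map_pmf_def bind_assoc_pmf bind_return_pmf)
  finally have e: "iid d I = \<dots>" .
  have "emeasure (iid d I) E = (\<integral>\<^sup>+f. emeasure (map_pmf (\<lambda>g x. if x \<in> I - J then f x else g x) (iid d J)) E \<partial>measure_pmf (iid d (I - J)))"
    unfolding e by (rule emeasure_bind_pmf)
  also have "\<dots> \<le> (\<integral>\<^sup>+f. ennreal c \<partial>measure_pmf (iid d (I - J)))"
  proof (rule nn_integral_mono_AE, rule AE_pmfI)
    fix f assume "f \<in> set_pmf (iid d (I - J))"
    from bnd[OF this] show "emeasure (map_pmf (\<lambda>g x. if x \<in> I - J then f x else g x) (iid d J)) E \<le> ennreal c"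
      by (simp add: emeasure_map_pmf vimage_def measure_pmf.emeasure_eq_measure ennreal_leI)
  qed
  also have "\<dots> = ennreal c" by (simp add: measure_pmf.emeasure_space_1)
  finally show ?thesis using c by (simp add: measure_pmf.emeasure_eq_measure)
qed

lemma prob_pmf_cong_support:
  "measure_pmf.prob p A = measure_pmf.prob p (A \<inter> set_pmf p)"
  by (rule measure_pmf.finite_measure_eq_AE) (auto simp: AE_measure_pmf_iff)

text \<open>Once the coordinates outside \<open>J\<close> are fixed, at most one choice on
  \<open>J\<close> lies in the event, and a single choice has probability at most
  \<open>M ^ card J\<close>. This converts rigidity into probability, both for divisibility modulo 3
  and for roots off the unit circle.\<close>

lemma prob_iid_determined:
  assumes I: "finite I" "J \<subseteq> I" and M: "\<And>x. pmf d x \<le> M"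
    and det: "\<And>a a'. a \<in> E \<Longrightarrow> a' \<in> E \<Longrightarrow> (\<And>j. j \<in> I \<Longrightarrow> a j \<in> set_pmf d) \<Longrightarrow> (\<And>j. j \<in> I \<Longrightarrow> a' j \<in> set_pmf d) \<Longrightarrow>
      (\<And>j. j \<in> I - J \<Longrightarrow> a j = a' j) \<Longrightarrow> (\<And>j. j \<in> J \<Longrightarrow> a j = a' j)"
  shows "iid_prob d I E \<le> M ^ card J"
proof (rule prob_iid_le_conditional[OF I])
  have M0: "M \<ge> 0" using M[of 0] pmf_nonneg[of d 0] by linarith
  then show "M ^ card J \<ge> 0" by simp
  have fin: "finite J" "finite (I - J)" using I finite_subset by auto
  fix b assume b: "b \<in> set_pmf (iid d (I - J))"
  let ?m = "\<lambda>a x. if x \<in> I - J then b x else a x"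
  let ?S = "{a. ?m a \<in> E} \<inter> set_pmf (iid d J)"
  have "iid_prob d J {a. ?m a \<in> E} = iid_prob d J ?S"
    by (rule prob_pmf_cong_support)
  also have "\<dots> \<le> M ^ card J"
  proof (cases "?S = {}")
    case True
    then show ?thesis using M0 by (metis measure_empty zero_le_power)
  next
    case False
    then obtain a0 where a0: "a0 \<in> ?S" by blast
    have val: "?m a j \<in> set_pmf d" if "a \<in> ?S" "j \<in> I" for a j
      using iid_value_in_support[OF fin(1), of a d j] iid_value_in_support[OF fin(2) b, of j] that by auto
    have "a = a0" if a: "a \<in> ?S" for a
    proof
      fix j
      show "a j = a0 j"
      proof (cases "j \<in> J")
        case True
        have "?m a j = ?m a0 j"
          by (rule det[of "?m a" "?m a0"]) (use a a0 True val[OF a] val[OF a0] in auto)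
        then show ?thesis using True by auto
      next
        case False
        \<comment> \<open>Off \<open>J\<close> a sample has the default value 0 of
          \<open>Pi_pmf\<close>, so agreement on \<open>J\<close> is equality of functions.\<close>
        have z: "f j = 0" if "f \<in> set_pmf (iid d J)" for f
          using subsetD[OF set_Pi_pmf_subset[OF fin(1)] that] False by simp
        from z[of a] z[of a0] show ?thesis using IntD2[OF a] IntD2[OF a0] by simp
      qed
    qed
    then have "?S = {a0}" using a0 by blast
    then have "iid_prob d J ?S = pmf (iid d J) a0" by (simp add: measure_pmf_single)
    also have "\<dots> \<le> (\<Prod>x\<in>J. pmf d (a0 x))" by (simp add: pmf_Pi[OF fin(1)] prod_nonneg)
    also have "\<dots> \<le> (\<Prod>x\<in>J. M)" by (intro prod_mono) (auto simp: M)
    finally show ?thesis by simp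
  qed
  finally show "iid_prob d J {a. ?m a \<in> E} \<le> M ^ card J" .
qed

definition int_poly :: "nat \<Rightarrow> (nat \<Rightarrow> int) \<Rightarrow> int poly" where
  "int_poly n a = (\<Sum>j\<le>n. monom (a j) j)"

lemma coeff_int_poly: "coeff (int_poly n a) j = (if j \<le> n then a j else 0)"
  by (simp add: int_poly_def coeff_sum sum.delta)

lemma rand_poly_eq_cpoly: "rand_poly n a = cpoly (int_poly n a)"
  by (rule poly_eqI) (simp add: rand_poly_def coeff_int_poly coeff_map_poly coeff_sum sum.delta)

lemma degree_int_poly_le: "degree (int_poly n a) \<le> n"
  by (rule degree_le) (simp add: coeff_int_poly)

lemma poly_int_poly: "poly (cpoly (int_poly n a)) z = (\<Sum>j\<le>n. of_int (a j) * z ^ j)"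
  unfolding rand_poly_eq_cpoly[symmetric] rand_poly_def by (simp add: poly_sum poly_monom)

section \<open>Square factors of large degree, seen modulo 3\<close>

lemma ternary_mod_3_inject:
  assumes "x \<in> {-1, 0, 1 :: int}" "y \<in> {-1, 0, 1}" "(of_int x :: 3) = of_int y"
  shows "x = y"
proof -
  have "(1 :: 3) \<noteq> 0" "(-1 :: 3) \<noteq> 0" "(1 :: 3) \<noteq> -1" by simp_all
  with assms show ?thesis by auto
qed

text \<open>Type \<open>3\<close> is used merely as a commutative ring; additivity of degrees comes
  from the leading coefficient 1 instead of the absence of zero divisors.\<close>

lemma degree_monic_mult:
  fixes p q :: "'a :: comm_ring_1 poly"
  assumes "lead_coeff p = 1" "q \<noteq> 0"
  shows "degree (p * q) = degree p + degree q" "lead_coeff (p * q) = lead_coeff q"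
proof -
  have c: "coeff (p * q) (degree p + degree q) = lead_coeff q"
    using assms by (simp add: coeff_mult_degree_sum)
  moreover have "lead_coeff q \<noteq> 0" using assms by simp
  ultimately have "degree p + degree q \<le> degree (p * q)" by (intro le_degree) simp
  then show 1: "degree (p * q) = degree p + degree q" using degree_mult_le[of p q] by simp
  show "lead_coeff (p * q) = lead_coeff q" using c by (simp add: 1)
qed

lemma map_poly_of_int_mult:
  "map_poly of_int (p * q) = (map_poly of_int p * map_poly of_int q :: 'a :: comm_ring_1 poly)"
  by (rule poly_eqI) (simp add: coeff_mult coeff_map_poly of_int_sum)

text \<open>The numeral type \<^typ>\<open>3\<close> is the ring of integers modulo 3.\<close>
definition monics_mod_3 :: "nat \<Rightarrow> 3 poly set" where
  "monics_mod_3 k = {g. degree g = k \<and> lead_coeff g = 1}"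

lemma monics_mod_3_finite_card: "finite (monics_mod_3 k)" "card (monics_mod_3 k) \<le> 3 ^ k"
proof -
  define X where "X = PiE {..<k} (\<lambda>_. UNIV :: 3 set)"
  have X: "finite X" "card X = 3 ^ k" unfolding X_def by (auto intro!: finite_PiE simp: card_PiE)
  define F where "F = (\<lambda>g :: 3 poly. restrict (coeff g) {..<k})"
  have im: "F ` monics_mod_3 k \<subseteq> X" by (auto simp: F_def X_def split: if_splits)
  have inj: "inj_on F (monics_mod_3 k)"
  proof (rule inj_onI, rule poly_eqI)
    fix g h i assume g: "g \<in> monics_mod_3 k" and h: "h \<in> monics_mod_3 k" and e: "F g = F h"
    consider "i < k" | "i = k" | "i > k" by linarith
    then show "coeff g i = coeff h i"
    proof cases
      case 1
      then show ?thesis using fun_cong[OF e, of i] by (simp add: F_def)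
    next
      case 2
      then show ?thesis using g h by (auto simp: monics_mod_3_def)
    next
      case 3
      then show ?thesis using g h by (auto simp: monics_mod_3_def coeff_eq_0)
    qed
  qed
  show "finite (monics_mod_3 k)" using inj im X(1) by (metis finite_imageD finite_subset)
  show "card (monics_mod_3 k) \<le> 3 ^ k" using card_inj_on_le[OF inj im X(1)] X(2) by simp
qed

text \<open>Two multiples of \<open>g\<^sup>2\<close> that agree from index 2 k on differ by a
  multiple of a monic polynomial of degree 2 k which itself has degree below 2 k, hence by 0. Modulo
  3 the values -1, 0, 1 remain distinct, so the low coefficients agree as integers.\<close>

lemma prob_square_dvd_mod_3:
  fixes g :: "3 poly"
  assumes supp: "set_pmf d \<subseteq> {-1, 0, 1}" and M: "\<And>x. pmf d x \<le> M"
    and g: "g \<in> monics_mod_3 k" and k: "2 * k \<le> n + 1"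
  shows "iid_prob d {..n} {a. g\<^sup>2 dvd map_poly of_int (int_poly n a)} \<le> M ^ (2 * k)"
proof -
  have gg: "lead_coeff (g\<^sup>2) = 1" "degree (g\<^sup>2) = 2 * k"
  proof -
    have "lead_coeff g = 1" "g \<noteq> 0" "degree g = k" using g by (auto simp: monics_mod_3_def)
    with degree_monic_mult[of g g] show "lead_coeff (g\<^sup>2) = 1" "degree (g\<^sup>2) = 2 * k"
      by (simp_all add: power2_eq_square)
  qed
  have "iid_prob d {..n} {a. g\<^sup>2 dvd map_poly of_int (int_poly n a)} \<le> M ^ card {..<2 * k}"
  proof (rule prob_iid_determined[OF _ _ M])
    show "{..<2 * k} \<subseteq> {..n}" using k by auto
    fix a a' j
    assume a: "a \<in> {a. g\<^sup>2 dvd map_poly of_int (int_poly n a)}" "a' \<in> {a. g\<^sup>2 dvd map_poly of_int (int_poly n a)}"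
      and v: "\<And>j. j \<in> {..n} \<Longrightarrow> a j \<in> set_pmf d" "\<And>j. j \<in> {..n} \<Longrightarrow> a' j \<in> set_pmf d"
      and eq: "\<And>j. j \<in> {..n} - {..<2 * k} \<Longrightarrow> a j = a' j" and j: "j \<in> {..<2 * k}"
    let ?D = "map_poly of_int (int_poly n a) - map_poly of_int (int_poly n a') :: 3 poly"
    have cD: "coeff ?D i = (if i \<le> n then of_int (a i) - of_int (a' i) else 0)" for i
      by (simp add: coeff_map_poly coeff_int_poly)
    obtain h where h: "?D = g\<^sup>2 * h" using a by (metis (no_types, lifting) dvdE dvd_diff mem_Collect_eq)
    have "?D = 0"
    proof (rule ccontr)
      assume D0: "?D \<noteq> 0"
      then have "h \<noteq> 0" using h by auto
      from degree_monic_mult(1)[OF gg(1) this] have "2 * k \<le> degree ?D" by (simp add: h gg(2))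
      then have "coeff ?D (degree ?D) = 0" unfolding cD using eq[of "degree ?D"] by auto
      then show False using D0 leading_coeff_0_iff[of ?D] by blast
    qed
    then have "coeff ?D j = 0" by simp
    moreover have "j \<le> n" using j k by auto
    ultimately have "(of_int (a j) :: 3) = of_int (a' j)" unfolding cD by simp
    then show "a j = a' j" using v \<open>j \<le> n\<close> supp by (intro ternary_mod_3_inject) auto
  qed simp
  then show ?thesis by simp
qed

text \<open>The zero polynomial is excluded because every square divides it; otherwise
  \<open>degree f\<close> is at most n / 2, within the reach of
  \<open>prob_square_dvd_mod_3\<close>.\<close>

abbreviation square_factor_event :: "nat \<Rightarrow> nat \<Rightarrow> (nat \<Rightarrow> int) set" where
  "square_factor_event n D \<equiv> {a. int_poly n a \<noteq> 0 \<and> (\<exists>f. lead_coeff f = 1 \<and> degree f \<ge> D \<and> f\<^sup>2 dvd int_poly n a)}"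

lemma prob_large_square_factor:
  assumes supp: "set_pmf d \<subseteq> {-1, 0, 1}" and M: "\<And>x. pmf d x \<le> M" and th: "3 * M\<^sup>2 < 1"
  shows "iid_prob d {..n} (square_factor_event n D)
    \<le> (3 * M\<^sup>2) ^ D / (1 - 3 * M\<^sup>2)"
proof -
  let ?p = "iid_prob d {..n}"
  let ?G = "\<lambda>k (g :: 3 poly). {a. g\<^sup>2 dvd map_poly of_int (int_poly n a)}"
  have nrm: "norm (3 * M\<^sup>2) < 1" using th by simp
  have sm: "summable (\<lambda>k. (3 * M\<^sup>2) ^ k)" by (rule summable_geometric[OF nrm])
  define K where "K = {k. D \<le> k \<and> 2 * k \<le> n}"
  have finK: "finite K" unfolding K_def by (rule finite_subset[of _ "{..n}"]) auto
  have "square_factor_event n D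
     \<subseteq> (\<Union>k\<in>K. \<Union>g\<in>monics_mod_3 k. ?G k g)"
  proof
    fix a assume "a \<in> square_factor_event n D"
    then obtain f where f: "int_poly n a \<noteq> 0" "lead_coeff f = 1" "degree f \<ge> D" "f\<^sup>2 dvd int_poly n a" by auto
    have "degree (f\<^sup>2) \<le> n" using dvd_imp_degree_le[OF f(4,1)] degree_int_poly_le[of n a] by linarith
    moreover have "f \<noteq> 0" using f by auto
    ultimately have "2 * degree f \<le> n" by (simp add: degree_power_eq)
    then have "degree f \<in> K" using f by (simp add: K_def)
    \<comment> \<open>Being monic, \<open>f\<close> keeps its degree modulo 3 and is thus counted
      among at most 3^k residues.\<close>
    moreover have "map_poly of_int f \<in> monics_mod_3 (degree f)"
    proof -
      have "degree (map_poly of_int f :: 3 poly) = degree f"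
        by (rule map_poly_degree_eq) (simp add: f(2))
      then show ?thesis using f(2) by (simp add: monics_mod_3_def coeff_map_poly)
    qed
    moreover have "a \<in> ?G (degree f) (map_poly of_int f)"
    proof -
      obtain h where "int_poly n a = f * f * h" using f(4) by (auto simp: power2_eq_square elim: dvdE)
      then show ?thesis unfolding power2_eq_square mem_Collect_eq by (simp only: map_poly_of_int_mult dvd_triv_left)
    qed
    ultimately show "a \<in> (\<Union>k\<in>K. \<Union>g\<in>monics_mod_3 k. ?G k g)" by blast
  qed
  then have "?p (square_factor_event n D)
     \<le> ?p (\<Union>k\<in>K. \<Union>g\<in>monics_mod_3 k. ?G k g)"
    by (intro measure_pmf.finite_measure_mono) auto
  also have "\<dots> \<le> (\<Sum>k\<in>K. ?p (\<Union>g\<in>monics_mod_3 k. ?G k g))"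
    using finK by (intro measure_pmf.finite_measure_subadditive_finite) auto
  also have "\<dots> \<le> (\<Sum>k\<in>K. (3 * M\<^sup>2) ^ k)"
  proof (rule sum_mono)
    fix k assume k: "k \<in> K"
    have "?p (\<Union>g\<in>monics_mod_3 k. ?G k g) \<le> (\<Sum>g\<in>monics_mod_3 k. ?p (?G k g))"
      using monics_mod_3_finite_card(1) by (intro measure_pmf.finite_measure_subadditive_finite) auto
    also have "\<dots> \<le> (\<Sum>g\<in>monics_mod_3 k. M ^ (2 * k))"
      using k by (intro sum_mono prob_square_dvd_mod_3[OF supp M]) (auto simp: K_def)
    also have "\<dots> = real (card (monics_mod_3 k)) * M ^ (2 * k)" by simp
    also have "\<dots> \<le> 3 ^ k * M ^ (2 * k)"
    proof (rule mult_right_mono)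
      have "real (card (monics_mod_3 k)) \<le> real (3 ^ k)"
        using monics_mod_3_finite_card(2) by (simp only: of_nat_le_iff)
      then show "real (card (monics_mod_3 k)) \<le> 3 ^ k" by simp
    qed simp
    also have "\<dots> = (3 * M\<^sup>2) ^ k" by (simp add: power_mult power_mult_distrib)
    finally show "?p (\<Union>g\<in>monics_mod_3 k. ?G k g) \<le> (3 * M\<^sup>2) ^ k" .
  qed
  also have "\<dots> \<le> (\<Sum>k. (3 * M\<^sup>2) ^ (k + D))"
  proof -
    have "(\<Sum>k\<in>K. (3 * M\<^sup>2) ^ k) \<le> (\<Sum>k\<in>{D..<n + D + 1}. (3 * M\<^sup>2) ^ k)"
      by (rule sum_mono2) (auto simp: K_def)
    also have "\<dots> = (\<Sum>k<n + 1. (3 * M\<^sup>2) ^ (k + D))"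
      using sum.shift_bounds_nat_ivl[of "\<lambda>k. (3 * M\<^sup>2) ^ k" 0 D "n + 1"] by (simp add: atLeast0LessThan add_ac)
    also have "\<dots> \<le> (\<Sum>k. (3 * M\<^sup>2) ^ (k + D))"
      using sm by (intro sum_le_suminf summable_ignore_initial_segment) auto
    finally show ?thesis .
  qed
  also have "\<dots> = (3 * M\<^sup>2) ^ D / (1 - 3 * M\<^sup>2)"
    unfolding power_add using suminf_mult2[OF sm, of "(3 * M\<^sup>2) ^ D"] suminf_geometric[OF nrm]
    by (simp only:) simp
  finally show ?thesis .
qed

text \<open>The digits are differences of two values in {-1, 0, 1}, hence the bound 2. For a base of
  modulus at least 3 the top nonzero term outweighs twice the geometric sum below it.\<close>

lemma separated_expansion_unique:
  fixes \<beta> :: complex and e :: "nat \<Rightarrow> int"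
  assumes \<beta>: "cmod \<beta> \<ge> 3" and e: "\<And>l. \<bar>e l\<bar> \<le> 2" and s: "(\<Sum>l<L. of_int (e l) * \<beta> ^ l) = 0" and l: "l < L"
  shows "e l = 0"
  using s l
proof (induction L)
  case (Suc L)
  have geo: "2 * (\<Sum>l<k. cmod \<beta> ^ l) < cmod \<beta> ^ k" for k
  proof (induction k)
    case (Suc k)
    have "2 * (\<Sum>l<Suc k. cmod \<beta> ^ l) < 3 * cmod \<beta> ^ k" using Suc by simp
    also have "\<dots> \<le> cmod \<beta> ^ Suc k" using \<beta> by (simp add: mult_right_mono)
    finally show ?case .
  qed simp
  have "e L = 0"
  proof (rule ccontr)
    assume "e L \<noteq> 0"
    then have "1 \<le> \<bar>real_of_int (e L)\<bar>" by linarith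
    then have "cmod \<beta> ^ L \<le> cmod (of_int (e L) * \<beta> ^ L)"
      using mult_right_mono[of 1 "\<bar>real_of_int (e L)\<bar>" "cmod \<beta> ^ L"] by (simp add: norm_mult norm_power)
    also have "of_int (e L) * \<beta> ^ L = - (\<Sum>l<L. of_int (e l) * \<beta> ^ l)"
      using Suc.prems(1) by (simp add: eq_neg_iff_add_eq_0 add.commute)
    also have "cmod \<dots> \<le> (\<Sum>l<L. 2 * cmod \<beta> ^ l)"
      unfolding norm_minus_cancel
    proof (rule sum_norm_le)
      fix l
      have "\<bar>real_of_int (e l)\<bar> \<le> 2" using e[of l] by linarith
      then show "cmod (of_int (e l) * \<beta> ^ l) \<le> 2 * cmod \<beta> ^ l"
        by (simp add: norm_mult norm_power mult_right_mono)
    qed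
    also have "\<dots> < cmod \<beta> ^ L" using geo[of L] by (simp add: sum_distrib_left)
    finally show False by simp
  qed
  then show ?case using Suc by (cases "l = L") auto
qed simp

text \<open>With the coefficients off the multiples of k fixed, the equation is an expansion in
  powers of \<open>b ^ k\<close>, and modulus at least 3 makes its digits unique. There are
  \<open>n div k + 1\<close> multiples of k up to n, 0 included.\<close>

lemma prob_root_determined:
  assumes supp: "set_pmf d \<subseteq> {-1, 0, 1}" and M: "\<And>x. pmf d x \<le> M"
    and k: "k > 0" "cmod b ^ k \<ge> 3"
  shows "iid_prob d {..n} {a. poly (cpoly (int_poly n a)) b = 0} \<le> M ^ (n div k + 1)"
proof -
  define J where "J = (\<lambda>l. k * l) ` {..<n div k + 1}"
  have inj: "inj_on (\<lambda>l. k * l) A" for A using k by (auto simp: inj_on_def)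
  have cardJ: "card J = n div k + 1" unfolding J_def by (subst card_image[OF inj]) simp
  have Jn: "J \<subseteq> {..n}"
  proof
    fix j assume "j \<in> J"
    then obtain l where "j = k * l" "l < n div k + 1" unfolding J_def by blast
    then have "j = k * l" "l \<le> n div k" by simp_all
    moreover have "k * (n div k) \<le> n" by simp
    ultimately show "j \<in> {..n}" using mult_le_mono2[of l "n div k" k] by (metis atMost_iff le_trans)
  qed
  have "iid_prob d {..n} {a. poly (cpoly (int_poly n a)) b = 0} \<le> M ^ card J"
  proof (rule prob_iid_determined[OF _ Jn M])
    fix a a' j
    assume a: "a \<in> {a. poly (cpoly (int_poly n a)) b = 0}" "a' \<in> {a. poly (cpoly (int_poly n a)) b = 0}"
      and v: "\<And>j. j \<in> {..n} \<Longrightarrow> a j \<in> set_pmf d" "\<And>j. j \<in> {..n} \<Longrightarrow> a' j \<in> set_pmf d"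
      and eq: "\<And>j. j \<in> {..n} - J \<Longrightarrow> a j = a' j" and j: "j \<in> J"
    have ab: "\<bar>a i - a' i\<bar> \<le> 2" if "i \<le> n" for i
    proof -
      have "a i \<in> {-1, 0, 1}" "a' i \<in> {-1, 0, 1}" using v(1)[of i] v(2)[of i] supp that by auto
      then show ?thesis by auto
    qed
    have "(\<Sum>j\<le>n. of_int (a j - a' j) * b ^ j) = 0"
      using a by (simp add: poly_int_poly algebra_simps sum_subtractf)
    also have "(\<Sum>j\<le>n. of_int (a j - a' j) * b ^ j) = (\<Sum>j\<in>J. of_int (a j - a' j) * b ^ j)"
      using Jn eq by (intro sum.mono_neutral_right) auto
    also have "\<dots> = (\<Sum>l<n div k + 1. of_int (a (k * l) - a' (k * l)) * (b ^ k) ^ l)"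
      unfolding J_def by (subst sum.reindex[OF inj]) (simp add: power_mult)
    also have "\<dots> = (\<Sum>l<n div k + 1. of_int (if k * l \<le> n then a (k * l) - a' (k * l) else 0) * (b ^ k) ^ l)"
      using Jn by (intro sum.cong) (auto simp: J_def)
    finally have s: "(\<Sum>l<n div k + 1. of_int (if k * l \<le> n then a (k * l) - a' (k * l) else 0) * (b ^ k) ^ l) = 0" .
    obtain l where l: "j = k * l" "l < n div k + 1" using j unfolding J_def by blast
    have "(if k * l \<le> n then a (k * l) - a' (k * l) else 0) = 0"
      by (rule separated_expansion_unique[OF _ _ s l(2)]) (use k ab in \<open>auto simp: norm_power\<close>)
    then show "a j = a' j" using l j Jn by auto
  qed simp
  then show ?thesis by (simp add: cardJ)
qed

abbreviation large_root_event :: "nat \<Rightarrow> nat \<Rightarrow> (nat \<Rightarrow> int) set" where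
  "large_root_event n D \<equiv> {a. \<exists>b\<in>large_roots D. poly (cpoly (int_poly n a)) b = 0}"

lemma prob_large_root:
  assumes supp: "set_pmf d \<subseteq> {-1, 0, 1}" and M: "\<And>x. pmf d x \<le> M" and D: "D > 0"
  shows "iid_prob d {..n} (large_root_event n D)
    \<le> real (D * (2 * 3 ^ D + 1) ^ (D + 1)) * M ^ (n div (64 * D\<^sup>2) + 1)"
proof -
  let ?p = "iid_prob d {..n}"
  have M0: "M \<ge> 0" using M[of 0] pmf_nonneg[of d 0] by linarith
  have "large_root_event n D = (\<Union>b\<in>large_roots D. {a. poly (cpoly (int_poly n a)) b = 0})"
    by auto
  then have "?p (large_root_event n D) \<le> (\<Sum>b\<in>large_roots D. ?p {a. poly (cpoly (int_poly n a)) b = 0})"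
    using measure_pmf.finite_measure_subadditive_finite[OF large_roots_finite_card(1)[of D],
        of "\<lambda>b. {a. poly (cpoly (int_poly n a)) b = 0}" "iid d {..n}"] by simp
  also have "\<dots> \<le> (\<Sum>b\<in>large_roots D. M ^ (n div (64 * D\<^sup>2) + 1))"
  proof (intro sum_mono prob_root_determined[OF supp M])
    fix b assume b: "b \<in> large_roots D"
    let ?e = "1 / (32 * (real D)\<^sup>2)"
    \<comment> \<open>The spacing 64 D^2 is twice the inverse margin 32 D^2, so Bernoulli's
      inequality gives 1 + 2 = 3.\<close>
    have "3 \<le> 1 + real (64 * D\<^sup>2) * ?e" using D by simp
    also have "\<dots> \<le> (1 + ?e) ^ (64 * D\<^sup>2)" by (rule Bernoulli_inequality) (rule order_trans[of _ 0], auto)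
    also have "\<dots> \<le> cmod b ^ (64 * D\<^sup>2)" using b by (intro power_mono) (auto simp: large_roots_def)
    finally show "3 \<le> cmod b ^ (64 * D\<^sup>2)" .
  qed (use D in simp)
  also have "\<dots> = real (card (large_roots D)) * M ^ (n div (64 * D\<^sup>2) + 1)" by simp
  also have "\<dots> \<le> real (D * (2 * 3 ^ D + 1) ^ (D + 1)) * M ^ (n div (64 * D\<^sup>2) + 1)"
    using large_roots_finite_card(2)[of D] M0 by (intro mult_right_mono) (simp_all only: of_nat_le_iff zero_le_power)
  finally show ?thesis .
qed

subsection \<open>Fourier bounds for weighted sums\<close>

lemma pi_bounds: "31 / 10 \<le> pi" "pi \<le> 32 / 10"
  using pi_approx by simp_all

lemma sin_ge_half: 
  assumes "0 \<le> x" "x \<le> pi / 2"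
  shows "x / 2 \<le> sin (x::real)"
proof (cases "x \<le> pi / 3")
  case True
  have "sin x - x / 2 \<ge> sin 0 - 0 / 2"
  proof (rule DERIV_nonneg_imp_nondecreasing[where f = "\<lambda>x. sin x - x / 2"])
    fix y assume y: "0 \<le> y" "y \<le> x"
    have "cos (pi / 3) \<le> cos y" using y True pi_gt_zero by (subst cos_mono_le_eq) auto
    then show "\<exists>D. ((\<lambda>x. sin x - x / 2) has_real_derivative D) (at y) \<and> 0 \<le> D"
      by (intro exI[of _ "cos y - 1 / 2"]) (auto intro!: derivative_eq_intros simp: cos_60)
  qed (use assms in simp)
  then show ?thesis by simp
next
  case False
  have "sin (pi / 3) \<le> sin x" using False assms pi_gt_zero by (subst sin_mono_le_eq) auto
  moreover have "(17 / 10) \<le> sqrt (3::real)" by (rule real_le_rsqrt) (simp add: power2_eq_square)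
  ultimately have "17 / 20 \<le> sin x" by (simp add: sin_60)
  moreover have "x \<le> 16 / 10" using assms pi_bounds by linarith
  ultimately show ?thesis by linarith
qed

text \<open>The range exceeds pi because the later arguments are s + j t with |s| <= pi and |j t| <=
  pi / 2. Up to pi the half-angle formula works; beyond it the cosine is not positive, so the right
  side is at least 1, while v^2 <= 4.8^2 < 24.\<close>

lemma one_minus_cos_ge:
  fixes v :: real
  assumes v: "\<bar>v\<bar> \<le> 3 * pi / 2"
  shows "v\<^sup>2 / 24 \<le> 1 - cos v"
proof -
  define u where "u = \<bar>v\<bar>"
  have u: "0 \<le> u" "u \<le> 3 * pi / 2" "cos v = cos u" "v\<^sup>2 = u\<^sup>2" using v by (auto simp: u_def)
  show ?thesis
  proof (cases "u \<le> pi")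
    case True
    have "(u / 2) / 2 \<le> sin (u / 2)" using True u by (intro sin_ge_half) auto
    then have "(u / 4)\<^sup>2 \<le> (sin (u / 2))\<^sup>2" using u by (intro power_mono) auto
    moreover have "1 - cos u = 2 * (sin (u / 2))\<^sup>2" using cos_double_sin[of "u / 2"] by simp
    moreover have "u\<^sup>2 / 24 \<le> 2 * Q" if "(u / 4)\<^sup>2 \<le> Q" "0 \<le> Q" for Q
      using that by (simp add: power_divide)
    ultimately show ?thesis using u by simp
  next
    case False
    have "cos u = - cos (u - pi)" by (simp add: cos_diff)
    moreover have "cos (u - pi) \<ge> 0" using False u by (intro cos_ge_zero) auto
    moreover have "u \<le> 48 / 10" using u pi_bounds by linarith
    then have "u\<^sup>2 \<le> (48 / 10)\<^sup>2" using u by (intro power_mono) auto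
    ultimately show ?thesis using u by (simp add: power2_eq_square)
  qed
qed

text \<open>A characteristic function at phase v will be bounded by exp(-q (1 - cos v)), so a
  product along an arithmetic progression of phases is at most the exponential of -q times this
  sum.\<close>

definition phase_defect :: "nat \<Rightarrow> real \<Rightarrow> real \<Rightarrow> real" where
  "phase_defect N s t = (\<Sum>j<N. 1 - cos (s + real j * t))"

lemma sum_square_affine:
  fixes s t :: real
  shows "(\<Sum>j<m. (s + real j * t)\<^sup>2) = real m * (s + (real m - 1) * t / 2)\<^sup>2 + t\<^sup>2 * real m * ((real m)\<^sup>2 - 1) / 12"
  by (induction m) (simp_all add: field_simps power2_eq_square)

lemma sum_square_affine_ge:
  fixes s t :: real
  assumes m: "m \<ge> 2"
  shows "real m * s\<^sup>2 + real m ^ 3 * t\<^sup>2 \<le> 22 * (\<Sum>j<m. (s + real j * t)\<^sup>2)"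
proof -
  define M where "M = real m"
  have M: "M \<ge> 2" using m by (simp add: M_def)
  define w where "w = s + (M - 1) * t / 2"
  have "0 \<le> (w + (M - 1) * t / 2)\<^sup>2" by simp
  then have "s\<^sup>2 \<le> 2 * w\<^sup>2 + (M - 1)\<^sup>2 * t\<^sup>2 / 2"
    by (simp add: w_def power2_eq_square field_simps)
  then have 1: "M * s\<^sup>2 \<le> M * (2 * w\<^sup>2 + (M - 1)\<^sup>2 * t\<^sup>2 / 2)" using M by (intro mult_left_mono) auto
  have "(M - 1)\<^sup>2 = M\<^sup>2 - 2 * M + 1" by (simp add: power2_eq_square algebra_simps)
  moreover have "(M\<^sup>2 - 2 * M + 1) / 2 \<le> (M\<^sup>2 - 1) / 2" using M by simp
  ultimately have "(M - 1)\<^sup>2 / 2 \<le> (M\<^sup>2 - 1) / 2" by (simp only:)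
  then have 2: "M * t\<^sup>2 * ((M - 1)\<^sup>2 / 2) \<le> M * t\<^sup>2 * ((M\<^sup>2 - 1) / 2)" using M by (intro mult_left_mono) auto
  have "4 \<le> M\<^sup>2" using M power_mono[of 2 M 2] by simp
  then have "M\<^sup>2 \<le> (4 / 3) * (M\<^sup>2 - 1)" by simp
  then have 3: "M * t\<^sup>2 * M\<^sup>2 \<le> M * t\<^sup>2 * ((4 / 3) * (M\<^sup>2 - 1))" using M by (intro mult_left_mono) auto
  have w0: "0 \<le> M * w\<^sup>2" using M by simp
  have e: "(\<Sum>j<m. (s + real j * t)\<^sup>2) = M * w\<^sup>2 + M * t\<^sup>2 * (M\<^sup>2 - 1) / 12"
    using sum_square_affine[of s t m] by (simp add: M_def w_def mult_ac)
  have "M * s\<^sup>2 + M ^ 3 * t\<^sup>2 \<le> 22 * (M * w\<^sup>2 + M * t\<^sup>2 * (M\<^sup>2 - 1) / 12)"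
  proof -
    \<comment> \<open>The s part costs V / 2 and the t part 4 V / 3, together 11 V / 6 = 22 V / 12;
      hence the constant 22.\<close>
    have gen: "A + Y \<le> 22 * (W + V / 12)" if "A \<le> 2 * W + K" "K \<le> V / 2" "Y \<le> 4 / 3 * V" "0 \<le> W" for A Y W V K :: real
      using that by (simp add: field_simps)
    show ?thesis
      by (rule gen[of _ _ "M * t\<^sup>2 * ((M - 1)\<^sup>2 / 2)"])
        (use 1 2 3 w0 in \<open>simp_all add: power3_eq_cube power2_eq_square distrib_left mult_ac\<close>)
  qed
  then show ?thesis unfolding e by (simp add: M_def)
qed

text \<open>
  Only the first sixth of the terms is used, so that every argument stays in the range where
  $1 - \cos v$ is bounded below by a multiple of $v^2$.
\<close>
lemma phase_defect_ge_quadratic: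
  assumes N: "N \<ge> 6" and s: "\<bar>s\<bar> \<le> pi" and t: "\<bar>t\<bar> \<le> 8 / real N"
  shows "(real N * s\<^sup>2 + real N ^ 3 * t\<^sup>2) / 120000 \<le> phase_defect N s t"
proof -
  \<comment> \<open>For j < m one has j <= N / 6, so |j t| <= 8 / 6 < pi / 2.\<close>
  define m where "m = N div 6 + 1"
  have m: "m \<ge> 2" "m \<le> N" "N \<le> 6 * m" using N by (auto simp: m_def)
  have mN: "real N / 6 \<le> real m" using m(3) by linarith
  have "(\<Sum>j<m. (s + real j * t)\<^sup>2 / 24) \<le> (\<Sum>j<m. 1 - cos (s + real j * t))"
  proof (intro sum_mono one_minus_cos_ge)
    fix j assume "j \<in> {..<m}"
    then have "6 * j \<le> N" by (auto simp: m_def)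
    then have "real j \<le> real N / 6" by linarith
    then have "\<bar>real j * t\<bar> \<le> (real N / 6) * (8 / real N)"
      unfolding abs_mult using t by (intro mult_mono) auto
    also have "\<dots> = 4 / 3" using N by simp
    also have "\<dots> \<le> pi / 2" using pi_bounds by linarith
    finally show "\<bar>s + real j * t\<bar> \<le> 3 * pi / 2" using s by linarith
  qed
  also have "\<dots> \<le> phase_defect N s t"
    unfolding phase_defect_def using m(2) by (intro sum_mono2) auto
  finally have 1: "(\<Sum>j<m. (s + real j * t)\<^sup>2) / 24 \<le> phase_defect N s t" by (simp add: sum_divide_distrib)
  have "real N / 216 * s\<^sup>2 \<le> real m * s\<^sup>2" using mN by (intro mult_right_mono) auto
  moreover have "(real N / 6) ^ 3 * t\<^sup>2 \<le> real m ^ 3 * t\<^sup>2" using mN by (intro mult_right_mono power_mono) auto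
  ultimately have "(real N * s\<^sup>2 + real N ^ 3 * t\<^sup>2) / 216 \<le> 22 * (\<Sum>j<m. (s + real j * t)\<^sup>2)"
    using sum_square_affine_ge[OF m(1), of s t] by (simp add: power_divide add_divide_distrib)
  moreover have "0 \<le> real N * s\<^sup>2 + real N ^ 3 * t\<^sup>2" by simp
  \<comment> \<open>The factors are 216 = 6^3 from m >= N / 6, 22 from the sum of squares and 24
    from the cosine bound; their product 114048 is rounded up.\<close>
  moreover have "A / 120000 \<le> P" if "A / 216 \<le> 22 * S" "0 \<le> A" "S / 24 \<le> P" for A S P :: real
    using that by (simp add: field_simps)
  ultimately show ?thesis using 1 by blast
qed

text \<open>Dirichlet kernel: multiplication by 2 sin(t/2) telescopes the sum of cosines, so it is
  at most 1 / |sin(t/2)| <= 4 / |t| <= N / 2, whatever s is. The cut 8 / N is made for the last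
  inequality.\<close>

lemma phase_defect_ge_linear:
  assumes N: "N \<ge> 1" and t: "8 / real N \<le> \<bar>t\<bar>" "\<bar>t\<bar> \<le> pi"
  shows "real N / 2 \<le> phase_defect N s t"
proof -
  have t0: "\<bar>t\<bar> > 0" using t N by (meson divide_pos_pos less_le_trans of_nat_0_less_iff zero_less_numeral less_one linorder_not_less order_less_le_trans)
  have tel: "2 * sin (t / 2) * (\<Sum>j<N. cos (s + real j * t)) = sin (s + (real N - 1 / 2) * t) - sin (s - t / 2)" for N
  proof (induction N)
    case (Suc N)
    have "2 * sin (t / 2) * cos (s + real N * t) = sin (s + (real (Suc N) - 1 / 2) * t) - sin (s + (real N - 1 / 2) * t)"
    proof -
      have "sin (s + real N * t + t / 2) - sin (s + real N * t - t / 2) = 2 * sin (t / 2) * cos (s + real N * t)"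
        by (simp add: sin_add sin_diff)
      then show ?thesis by (simp add: algebra_simps)
    qed
    with Suc show ?case by (simp add: algebra_simps)
  qed simp
  have sh: "\<bar>t\<bar> / 4 \<le> \<bar>sin (t / 2)\<bar>"
    using sin_ge_half[of "\<bar>t\<bar> / 2"] t by (cases "t \<ge> 0") auto
  have "2 * \<bar>sin (t / 2)\<bar> * \<bar>\<Sum>j<N. cos (s + real j * t)\<bar> \<le> 2"
  proof -
    have "\<bar>2 * sin (t / 2) * (\<Sum>j<N. cos (s + real j * t))\<bar> \<le> 2"
      unfolding tel using abs_sin_le_one[of "s + (real N - 1 / 2) * t"] abs_sin_le_one[of "s - t / 2"] by linarith
    then show ?thesis by (simp add: abs_mult)
  qed
  moreover have "\<bar>t\<bar> / 4 * \<bar>\<Sum>j<N. cos (s + real j * t)\<bar> \<le> \<bar>sin (t / 2)\<bar> * \<bar>\<Sum>j<N. cos (s + real j * t)\<bar>"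
    using sh by (rule mult_right_mono) simp
  ultimately have "\<bar>t\<bar> * \<bar>\<Sum>j<N. cos (s + real j * t)\<bar> \<le> 4" by linarith
  moreover have "8 / real N * \<bar>\<Sum>j<N. cos (s + real j * t)\<bar> \<le> \<bar>t\<bar> * \<bar>\<Sum>j<N. cos (s + real j * t)\<bar>"
    using t(1) by (rule mult_right_mono) simp
  ultimately have "8 / real N * \<bar>\<Sum>j<N. cos (s + real j * t)\<bar> \<le> 4" by linarith
  then have "\<bar>\<Sum>j<N. cos (s + real j * t)\<bar> \<le> real N / 2" using N by (simp add: field_simps)
  then show ?thesis unfolding phase_defect_def by (simp add: sum_subtractf)
qed

lemma integrable_cis_interval: "set_integrable lborel {a..b::real} (\<lambda>\<theta>. cis (k * \<theta>))"
  by (rule borel_integrable_atLeastAtMost') (auto intro!: continuous_intros)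

lemma integral_cis_int:
  fixes k :: int
  shows "(LINT \<theta>:{-pi..pi}|lborel. cis (of_int k * \<theta>)) = (if k = 0 then 2 * pi else 0)"
proof (cases "k = 0")
  case True
  then show ?thesis by (simp add: set_lebesgue_integral_def scaleR_conv_of_real)
next
  case False
  let ?F = "\<lambda>\<theta>. cis (of_int k * \<theta>) / (\<i> * of_int k)"
  have "(LBINT \<theta>=-pi..pi. cis (of_int k * \<theta>)) = ?F pi - ?F (-pi)"
  proof (rule interval_integral_FTC_finite)
    show "continuous_on {min (-pi) pi..max (-pi) pi} (\<lambda>\<theta>. cis (of_int k * \<theta>))"
      by (intro continuous_intros)
    show "(?F has_vector_derivative cis (of_int k * x)) (at x within {min (-pi) pi..max (-pi) pi})" for x
    proof -
      have "((\<lambda>z. exp (\<i> * of_int k * z) / (\<i> * of_int k)) has_field_derivative exp (\<i> * of_int k * of_real x)) (at (of_real x))"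
        using False by (auto intro!: derivative_eq_intros)
      from has_vector_derivative_real_field[OF this] show ?thesis
        by (simp add: cis_conv_exp mult_ac)
    qed
  qed
  also have "?F pi = ?F (-pi)"
  proof -
    have "cis (of_int k * pi) = cis (of_int k * (-pi))"
      using sin_int_times_real[of k] by (simp add: complex_eq_iff mult.commute sin_zero_iff_int2)
    then show ?thesis by simp
  qed
  finally show ?thesis using False by (simp add: interval_integral_Icc)
qed

lemma gaussian_integral:
  fixes \<kappa> m :: real
  assumes k: "\<kappa> > 0"
  shows "integrable lborel (\<lambda>x. exp (- (\<kappa> * (x - m)\<^sup>2)))"
    "(\<integral>x. exp (- (\<kappa> * (x - m)\<^sup>2)) \<partial>lborel) = sqrt (pi / \<kappa>)"
proof -
  define s where "s = 1 / sqrt (2 * \<kappa>)"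
  have s: "s > 0" "2 * s\<^sup>2 = 1 / \<kappa>" using k by (auto simp: s_def power_divide)
  have e: "exp (- (\<kappa> * (x - m)\<^sup>2)) = sqrt (pi / \<kappa>) * normal_density m s x" for x
  proof -
    have "2 * pi * s\<^sup>2 = pi / \<kappa>" using s(2) by (metis mult.assoc mult.commute times_divide_eq_right mult.right_neutral)
    moreover have "(x - m)\<^sup>2 / (2 * s\<^sup>2) = \<kappa> * (x - m)\<^sup>2" using k by (simp add: s(2))
    ultimately show ?thesis using k by (simp add: normal_density_def)
  qed
  show "integrable lborel (\<lambda>x. exp (- (\<kappa> * (x - m)\<^sup>2)))"
    unfolding e using s(1) by (intro integrable_mult_right integrable_normal_density)
  show "(\<integral>x. exp (- (\<kappa> * (x - m)\<^sup>2)) \<partial>lborel) = sqrt (pi / \<kappa>)"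
    unfolding e using s(1) by simp
qed

lemma cis_sum: "cis (\<Sum>x\<in>A. f x) = (\<Prod>x\<in>A. cis (f x))"
  by (induction A rule: infinite_finite_induct) (simp_all add: cis_mult[symmetric])

lemma finite_set_iid:
  assumes "finite J" "finite (set_pmf d)"
  shows "finite (set_pmf (iid d J))"
  using assms by (auto simp: set_Pi_pmf)

lemma expectation_pair_prod:
  fixes f :: "'a \<Rightarrow> complex" and g :: "'b \<Rightarrow> complex"
  assumes "finite (set_pmf p)" "finite (set_pmf q)"
  shows "measure_pmf.expectation (pair_pmf p q) (\<lambda>(x, y). f x * g y)
    = measure_pmf.expectation p f * measure_pmf.expectation q g"
proof -
  have "measure_pmf.expectation (pair_pmf p q) (\<lambda>(x, y). f x * g y) =
    (\<Sum>z\<in>set_pmf p \<times> set_pmf q. pmf (pair_pmf p q) z *\<^sub>R (case z of (x, y) \<Rightarrow> f x * g y))"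
    by (rule integral_measure_pmf) (use assms in auto)
  also have "\<dots> = (\<Sum>(x, y)\<in>set_pmf p \<times> set_pmf q. (pmf p x *\<^sub>R f x) * (pmf q y *\<^sub>R g y))"
    by (intro sum.cong) (auto simp: pmf_pair)
  also have "\<dots> = (\<Sum>x\<in>set_pmf p. pmf p x *\<^sub>R f x) * (\<Sum>y\<in>set_pmf q. pmf q y *\<^sub>R g y)"
    by (simp add: sum_product sum.cartesian_product)
  also have "(\<Sum>x\<in>set_pmf p. pmf p x *\<^sub>R f x) = measure_pmf.expectation p f"
    by (rule integral_measure_pmf[symmetric]) (use assms in auto)
  also have "(\<Sum>y\<in>set_pmf q. pmf q y *\<^sub>R g y) = measure_pmf.expectation q g"
    by (rule integral_measure_pmf[symmetric]) (use assms in auto)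
  finally show ?thesis .
qed

lemma expectation_iid_prod:
  fixes F :: "nat \<Rightarrow> int \<Rightarrow> complex"
  assumes J: "finite J" and d: "finite (set_pmf d)"
  shows "measure_pmf.expectation (iid d J) (\<lambda>a. \<Prod>j\<in>J. F j (a j)) = (\<Prod>j\<in>J. measure_pmf.expectation d (F j))"
  using J
proof (induction J)
  case (insert j J)
  have e: "(\<Prod>i\<in>insert j J. F i ((f(j := y)) i)) = F j y * (\<Prod>i\<in>J. F i (f i))" for f y
    using insert.hyps by (subst prod.insert) (auto intro!: prod.cong)
  have "measure_pmf.expectation (iid d (insert j J)) (\<lambda>a. \<Prod>j\<in>insert j J. F j (a j)) =
    measure_pmf.expectation (pair_pmf d (iid d J)) (\<lambda>(y, f). F j y * (\<Prod>i\<in>J. F i (f i)))"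
    unfolding Pi_pmf_insert[OF insert.hyps] integral_map_pmf
    by (rule Bochner_Integration.integral_cong) (auto simp only: case_prod_unfold e)
  also have "\<dots> = measure_pmf.expectation d (F j) * measure_pmf.expectation (iid d J) (\<lambda>f. \<Prod>i\<in>J. F i (f i))"
    by (rule expectation_pair_prod[OF d finite_set_iid[OF insert.hyps(1) d]])
  finally show ?case using insert by simp
qed simp

lemma prob_eq_sum_support:
  assumes "finite (set_pmf p)"
  shows "measure_pmf.prob p {a. Q a} = (\<Sum>a\<in>set_pmf p. pmf p a * (if Q a then 1 else 0))"
proof -
  have "measure_pmf.prob p {a. Q a} = measure_pmf.prob p ({a. Q a} \<inter> set_pmf p)"
    by (rule prob_pmf_cong_support)
  also have "\<dots> = (\<Sum>a\<in>{a. Q a} \<inter> set_pmf p. pmf p a)"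
    using assms by (intro measure_measure_pmf_finite) auto
  also have "\<dots> = (\<Sum>a\<in>set_pmf p. pmf p a * (if Q a then 1 else 0))"
    using assms by (intro sum.mono_neutral_cong_left) auto
  finally show ?thesis .
qed

lemma prob_eq_fourier_integral:
  fixes S :: "'a \<Rightarrow> int"
  assumes p: "finite (set_pmf p)"
  shows "complex_of_real (2 * pi * measure_pmf.prob p {a. S a = 0}) =
    (LINT \<theta>:{-pi..pi}|lborel. measure_pmf.expectation p (\<lambda>a. cis (of_int (S a) * \<theta>)))"
proof -
  have E: "measure_pmf.expectation p (\<lambda>a. cis (of_int (S a) * \<theta>)) = (\<Sum>a\<in>set_pmf p. pmf p a *\<^sub>R cis (of_int (S a) * \<theta>))" for \<theta>
    by (rule integral_measure_pmf) (use p in auto)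
  have "(LINT \<theta>:{-pi..pi}|lborel. measure_pmf.expectation p (\<lambda>a. cis (of_int (S a) * \<theta>))) =
    (LINT \<theta>|lborel. (\<Sum>a\<in>set_pmf p. pmf p a *\<^sub>R (indicator {-pi..pi} \<theta> *\<^sub>R cis (of_int (S a) * \<theta>))))"
    unfolding E set_lebesgue_integral_def by (simp add: scaleR_sum_right mult.commute)
  also have "\<dots> = (\<Sum>a\<in>set_pmf p. (LINT \<theta>|lborel. pmf p a *\<^sub>R (indicator {-pi..pi} \<theta> *\<^sub>R cis (of_int (S a) * \<theta>))))"
    using integrable_cis_interval[unfolded set_integrable_def]
    by (intro Bochner_Integration.integral_sum integrable_scaleR_right) auto
  also have "\<dots> = (\<Sum>a\<in>set_pmf p. pmf p a *\<^sub>R (if S a = 0 then 2 * pi else 0))"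
    using integral_cis_int unfolding set_lebesgue_integral_def by (simp add: scaleR_conv_of_real)
  also have "\<dots> = complex_of_real (2 * pi * (\<Sum>a\<in>set_pmf p. pmf p a * (if S a = 0 then 1 else 0)))"
    by (simp add: sum_distrib_left scaleR_conv_of_real of_real_sum[symmetric] if_distrib cong: if_cong)
      (intro sum.cong, auto)
  finally show ?thesis by (simp add: prob_eq_sum_support[OF p])
qed

section \<open>Characteristic functions and anticoncentration of one weighted sum\<close>

definition cf :: "int pmf \<Rightarrow> real \<Rightarrow> complex" where
  "cf d v = measure_pmf.expectation d (\<lambda>x. cis (v * of_int x))"

lemma cf_ternary:
  assumes "set_pmf d \<subseteq> {-1, 0, 1}"
  shows "cf d v = Complex (pmf d 0 + (pmf d 1 + pmf d (-1)) * cos v) ((pmf d 1 - pmf d (-1)) * sin v)"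
proof -
  have "cf d v = (\<Sum>x\<in>{-1, 0, 1}. pmf d x *\<^sub>R cis (v * of_int x))"
    unfolding cf_def by (rule integral_measure_pmf) (use assms in auto)
  then show ?thesis by (simp add: complex_eq_iff algebra_simps)
qed

lemma pmf_ternary_sum:
  assumes "set_pmf d \<subseteq> {-1, 0, 1 :: int}"
  shows "pmf d (-1) + pmf d 0 + pmf d 1 = 1"
  using sum_pmf_eq_1[OF _ assms] by simp

text \<open>Without an atom at 0 all values are odd and the modulus of \<open>cf\<close> returns to
  1 at pi; halving the frequency (g = 2) removes this second maximum. Both cases come from an exact
  formula for the squared modulus, and atoms below 1 make q positive.\<close>

lemma cmod_cf_le:
  assumes supp: "set_pmf d \<subseteq> {-1, 0, 1}" and small: "\<And>x. pmf d x < 1"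
  defines "g \<equiv> if pmf d 0 = 0 then 2 else 1 :: real"
  obtains q where "q > 0" "\<And>\<theta>. cmod (cf d (\<theta> / g)) \<le> exp (- (q * (1 - cos \<theta>)))"
proof -
  define p0 p1 p2 where "p0 = pmf d 0" and "p1 = pmf d 1" and "p2 = pmf d (-1)"
  have sum1: "p0 = 1 - p1 - p2" using pmf_ternary_sum[OF supp] by (simp add: p0_def p1_def p2_def)
  have nn: "p0 \<ge> 0" "p1 \<ge> 0" "p2 \<ge> 0" by (auto simp: p0_def p1_def p2_def)
  have lt: "p0 < 1" "p1 < 1" "p2 < 1" using small by (auto simp: p0_def p1_def p2_def)
  have sq: "(cmod (cf d v))\<^sup>2 = 1 - 2 * (p0 * (p1 + p2) * (1 - cos v)) - 4 * (p1 * p2) * (sin v)\<^sup>2" for v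
  proof -
    have s: "(sin v)\<^sup>2 = 1 - (cos v)\<^sup>2" by (simp add: sin_squared_eq)
    have "(cmod (cf d v))\<^sup>2 = (p0 + (p1 + p2) * cos v)\<^sup>2 + (p1 - p2)\<^sup>2 * (sin v)\<^sup>2"
      by (simp add: cf_ternary[OF supp] cmod_def p0_def p1_def p2_def power_mult_distrib)
    then show ?thesis unfolding s sum1 by algebra
  qed
  have exp_bound: "cmod z \<le> exp (- y)" if "(cmod z)\<^sup>2 \<le> 1 - 2 * y" for z :: complex and y :: real
  proof -
    have "(cmod z)\<^sup>2 \<le> exp (- (2 * y))" using that exp_ge_add_one_self[of "- (2 * y)"] by linarith
    also have "\<dots> = (exp (- y))\<^sup>2" by (simp add: power2_eq_square flip: exp_add)
    finally show ?thesis by (rule power2_le_imp_le) simp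
  qed
  show ?thesis
  proof (cases "p0 = 0")
    case True
    then have g: "g = 2" by (simp add: g_def p0_def)
    show ?thesis
    proof (rule that[of "p1 * p2"])
      show "p1 * p2 > 0" using sum1 True lt nn by (intro mult_pos_pos) auto
      fix \<theta> :: real
      have "1 - cos \<theta> = 2 * (sin (\<theta> / 2))\<^sup>2" using cos_double_sin[of "\<theta> / 2"] by simp
      then have "(cmod (cf d (\<theta> / 2)))\<^sup>2 = 1 - 2 * (p1 * p2 * (1 - cos \<theta>))"
        unfolding sq using True by simp
      then show "cmod (cf d (\<theta> / g)) \<le> exp (- (p1 * p2 * (1 - cos \<theta>)))"
        unfolding g by (intro exp_bound) simp
    qed
  next
    case False
    then have g: "g = 1" by (simp add: g_def p0_def)
    show ?thesis
    proof (rule that[of "p0 * (p1 + p2)"])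
      show "p0 * (p1 + p2) > 0" using sum1 False lt nn by (intro mult_pos_pos) auto
      fix \<theta> :: real
      have "4 * (p1 * p2) * (sin \<theta>)\<^sup>2 \<ge> 0" using nn by simp
      then have "(cmod (cf d \<theta>))\<^sup>2 \<le> 1 - 2 * (p0 * (p1 + p2) * (1 - cos \<theta>))"
        unfolding sq by linarith
      then show "cmod (cf d (\<theta> / g)) \<le> exp (- (p0 * (p1 + p2) * (1 - cos \<theta>)))"
        unfolding g by (intro exp_bound) simp
    qed
  qed
qed

lemma exp_minus_le_inverse_square:
  fixes x :: real
  assumes "x > 0"
  shows "exp (- x) \<le> 2 / x\<^sup>2"
proof -
  have "x\<^sup>2 / 2 \<le> exp x" using exp_lower_Taylor_quadratic[of x] assms by (simp add: power2_eq_square)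
  then have "exp (- x) * (x\<^sup>2 / 2) \<le> exp (- x) * exp x" by (intro mult_left_mono) auto
  then have "exp (- x) * x\<^sup>2 \<le> 2" by (simp flip: exp_add)
  then show ?thesis using assms by (simp add: field_simps)
qed

text \<open>Below 8 / N the integrand is dominated by a Gaussian of curvature of order N^3, with
  integral of order N^(-3/2). The rest is exponentially small, and N^(-2) is already a good enough
  bound for it.\<close>

lemma integral_exp_phase_defect_le:
  assumes N: "N \<ge> 6" and q: "q > 0"
  shows "(LINT \<theta>:{-pi..pi}|lborel. exp (- (q * phase_defect N 0 \<theta>)))
    \<le> (sqrt (120000 * pi / q) + 16 * pi / q\<^sup>2) * real N powr (-3/2)"
proof -
  define \<kappa> where "\<kappa> = q * real N ^ 3 / 120000"
  have \<kappa>: "\<kappa> > 0" using N q by (simp add: \<kappa>_def)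
  let ?g = "\<lambda>\<theta>::real. exp (- (\<kappa> * (\<theta> - 0)\<^sup>2)) + exp (- (q * real N / 2))"
  have int1: "set_integrable lborel {-pi..pi} (\<lambda>\<theta>. exp (- (\<kappa> * (\<theta> - 0)\<^sup>2)))"
    using gaussian_integral(1)[OF \<kappa>, of 0] unfolding set_integrable_def
    by (intro integrable_mult_indicator) auto
  have int2: "set_integrable lborel {-pi..pi} (\<lambda>\<theta>::real. exp (- (q * real N / 2)))"
    by (rule borel_integrable_atLeastAtMost') (intro continuous_intros)
  have "(LINT \<theta>:{-pi..pi}|lborel. exp (- (q * phase_defect N 0 \<theta>))) \<le> (LINT \<theta>:{-pi..pi}|lborel. ?g \<theta>)"
  proof (rule set_integral_mono)
    show "set_integrable lborel {-pi..pi} (\<lambda>\<theta>. exp (- (q * phase_defect N 0 \<theta>)))"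
      unfolding phase_defect_def by (rule borel_integrable_atLeastAtMost') (intro continuous_intros)
    show "set_integrable lborel {-pi..pi} ?g" by (rule set_integral_add(1)[OF int1 int2])
    fix \<theta> :: real assume t: "\<theta> \<in> {-pi..pi}"
    show "exp (- (q * phase_defect N 0 \<theta>)) \<le> ?g \<theta>"
    proof (cases "\<bar>\<theta>\<bar> \<le> 8 / real N")
      case True
      have "(real N * 0\<^sup>2 + real N ^ 3 * \<theta>\<^sup>2) / 120000 \<le> phase_defect N 0 \<theta>"
        by (rule phase_defect_ge_quadratic[OF N _ True]) simp
      then have "q * (real N ^ 3 * \<theta>\<^sup>2 / 120000) \<le> q * phase_defect N 0 \<theta>" using q by (intro mult_left_mono) auto
      then have "exp (- (q * phase_defect N 0 \<theta>)) \<le> exp (- (\<kappa> * (\<theta> - 0)\<^sup>2))" by (simp add: \<kappa>_def)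
      then show ?thesis by (rule order_trans) simp
    next
      case False
      have "real N / 2 \<le> phase_defect N 0 \<theta>"
        using False t N by (intro phase_defect_ge_linear) auto
      then have "q * (real N / 2) \<le> q * phase_defect N 0 \<theta>" using q by (intro mult_left_mono) auto
      then have "exp (- (q * phase_defect N 0 \<theta>)) \<le> exp (- (q * real N / 2))" by simp
      then show ?thesis by (rule order_trans) simp
    qed
  qed
  also have "\<dots> = (LINT \<theta>:{-pi..pi}|lborel. exp (- (\<kappa> * (\<theta> - 0)\<^sup>2))) + (LINT \<theta>:{-pi..pi}|lborel. exp (- (q * real N / 2)))"
    by (rule set_integral_add(2)[OF int1 int2])
  also have "(LINT \<theta>:{-pi..pi}|lborel. exp (- (\<kappa> * (\<theta> - 0)\<^sup>2))) \<le> sqrt (pi / \<kappa>)"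
  proof -
    have "(LINT \<theta>:{-pi..pi}|lborel. exp (- (\<kappa> * (\<theta> - 0)\<^sup>2))) \<le> (LINT \<theta>|lborel. exp (- (\<kappa> * (\<theta> - 0)\<^sup>2)))"
      unfolding set_lebesgue_integral_def
      by (rule integral_mono[OF int1[unfolded set_integrable_def] gaussian_integral(1)[OF \<kappa>]])
        (simp add: indicator_def)
    then show ?thesis using gaussian_integral(2)[OF \<kappa>, of 0] by simp
  qed
  also have "(LINT \<theta>:{-pi..pi}|lborel. exp (- (q * real N / 2))) = 2 * pi * exp (- (q * real N / 2))"
    by (simp add: set_lebesgue_integral_def)
  also have "sqrt (pi / \<kappa>) = sqrt (120000 * pi / q) * real N powr (-3/2)"
  proof -
    have "pi / \<kappa> = (120000 * pi / q) * real N powr (-3)" using N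
      by (simp add: \<kappa>_def powr_minus powr_numeral field_simps)
    moreover have "sqrt (real N powr (-3)) = real N powr (-3/2)" by (simp add: powr_half_sqrt[symmetric] powr_powr)
    ultimately show ?thesis by (simp only: real_sqrt_mult)
  qed
  also have "2 * pi * exp (- (q * real N / 2)) \<le> 16 * pi / q\<^sup>2 * real N powr (-3/2)"
  proof -
    have "exp (- (q * real N / 2)) \<le> 2 / (q * real N / 2)\<^sup>2"
      using q N by (intro exp_minus_le_inverse_square) auto
    also have "\<dots> = 8 / q\<^sup>2 * real N powr (-2)"
      using N by (simp add: powr_minus powr_numeral power_divide power_mult_distrib field_simps)
    also have "\<dots> \<le> 8 / q\<^sup>2 * real N powr (-3/2)"
      using N by (intro mult_left_mono powr_mono) auto
    finally have "2 * pi * exp (- (q * real N / 2)) \<le> 2 * pi * (8 / q\<^sup>2 * real N powr (-3/2))"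
      by (intro mult_left_mono) auto
    then show ?thesis by simp
  qed
  finally show ?thesis by (simp add: algebra_simps)
qed

text \<open>The squares of the weights 0, ..., N - 1 sum to order N^3, which explains the rate
  N^(-3/2). The constant is uniform in everything else because \<open>h\<close> will be an
  arithmetic progression or the identity, the signs will be powers of 1 or -1, and the target is set
  by conditioning.\<close>

lemma prob_weighted_sum_le:
  assumes supp: "set_pmf d \<subseteq> {-1, 0, 1}" and small: "\<And>x. pmf d x < 1"
  obtains C where "C > 0"
    "\<And>(N :: nat) (h :: nat \<Rightarrow> nat) (\<epsilon> :: nat \<Rightarrow> int) (b :: int). N \<ge> 1 \<Longrightarrow> inj_on h {..<N} \<Longrightarrow> (\<And>l. \<epsilon> l \<in> {-1, 1}) \<Longrightarrow>
      iid_prob d (h ` {..<N}) {a. (\<Sum>l<N. \<epsilon> l * int l * a (h l)) = b} \<le> C * real N powr (-3/2)"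
proof -
  define g where "g = (if pmf d 0 = 0 then 2 else 1 :: int)"
  have g0: "g > 0" by (simp add: g_def)
  have gr: "real_of_int g = (if pmf d 0 = 0 then 2 else 1)" by (simp add: g_def)
  obtain q where q: "q > 0" "\<And>\<theta>. cmod (cf d (\<theta> / g)) \<le> exp (- (q * (1 - cos \<theta>)))"
    unfolding gr using cmod_cf_le[OF supp small] by metis
  \<comment> \<open>The first entry makes the bound trivial for N < 6, where the quadratic phase
    estimate does not apply.\<close>
  define C where "C = max (6 powr (3/2)) (sqrt (120000 * pi / q) + 16 * pi / q\<^sup>2)"
  have C0: "C > 0" by (simp add: C_def less_max_iff_disj)
  have fd: "finite (set_pmf d)" using supp finite_subset by blast
  show ?thesis
  proof (rule that[OF C0])
    fix N :: nat and h :: "nat \<Rightarrow> nat" and b :: int and \<epsilon> :: "nat \<Rightarrow> int"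
    assume N: "N \<ge> 1" and inj: "inj_on h {..<N}" and \<epsilon>: "\<And>l. \<epsilon> l \<in> {-1, 1}"
    define J where "J = h ` {..<N}"
    define S where "S = (\<lambda>a. \<Sum>l<N. \<epsilon> l * int l * a (h l))"
    have fJ: "finite J" by (simp add: J_def)
    have fs: "finite (set_pmf (iid d J))" by (rule finite_set_iid[OF fJ fd])
    let ?P = "iid_prob d J {a. S a = b}"
    have "?P \<le> C * real N powr (-3/2)"
    proof (cases "N < 6 \<or> {a. S a = b} \<inter> set_pmf (iid d J) = {}")
      case True
      then show ?thesis
      proof
        assume "N < 6"
        have "?P \<le> 1" by simp
        also have "1 = real N powr (3/2) * real N powr (-3/2)" using N by (simp flip: powr_add)
        also have "\<dots> \<le> C * real N powr (-3/2)"
        proof (rule mult_right_mono)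
          have "real N powr (3/2) \<le> 6 powr (3/2)" using \<open>N < 6\<close> by (intro powr_mono2) auto
          then show "real N powr (3/2) \<le> C" by (simp add: C_def)
        qed simp
        finally show ?thesis .
      next
        assume "{a. S a = b} \<inter> set_pmf (iid d J) = {}"
        then have "?P = 0" by (subst prob_pmf_cong_support) simp
        then show ?thesis using C0 by simp
      qed
    next
      case False
      then have N6: "N \<ge> 6" by simp
      \<comment> \<open>A reference outcome reaching b. Without an atom at 0 every outcome differs
        from it by an even amount, so (S a - b) / g is an integer on the support.\<close>
      obtain a0 where a0: "S a0 = b" "a0 \<in> set_pmf (iid d J)" using False by auto
      have gdvd: "g dvd S a - b" if "a \<in> set_pmf (iid d J)" for a
      proof (cases "pmf d 0 = 0")
        case True
        have "S a - b = (\<Sum>l<N. \<epsilon> l * int l * (a (h l) - a0 (h l)))"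
          by (simp add: S_def a0(1)[symmetric] sum_subtractf algebra_simps)
        also have "2 dvd \<dots>"
        proof (intro dvd_sum dvd_mult)
          fix l assume "l \<in> {..<N}"
          then have "h l \<in> J" by (simp add: J_def)
          then have "a (h l) \<in> set_pmf d" "a0 (h l) \<in> set_pmf d"
            using iid_value_in_support[OF fJ] that a0(2) by auto
          moreover have "0 \<notin> set_pmf d" using True by (simp add: set_pmf_eq)
          ultimately have "a (h l) \<in> {-1, 1}" "a0 (h l) \<in> {-1, 1}" using supp by auto
          then show "2 dvd a (h l) - a0 (h l)" by auto
        qed
        finally show ?thesis using True by (simp add: g_def)
      qed (simp add: g_def)
      define S' where "S' = (\<lambda>a. (S a - b) div g)"
      have S': "real_of_int (S' a) = (S a - b) / g" if "a \<in> set_pmf (iid d J)" for a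
        using gdvd[OF that] g0 by (simp add: S'_def real_of_int_div)
      have "{a. S a = b} \<inter> set_pmf (iid d J) = {a. S' a = 0} \<inter> set_pmf (iid d J)"
        using S' g0 by (auto simp: S'_def) (metis S' S'_def diff_eq_eq divide_eq_0_iff g0 less_irrefl of_int_0 of_int_eq_iff add_0 eq_iff_diff_eq_0 of_int_eq_0_iff)
      then have P: "?P = iid_prob d J {a. S' a = 0}" by (metis prob_pmf_cong_support)
      define w where "w = (\<lambda>l. of_int (\<epsilon> l) * real l)"
      have norm_E: "cmod (measure_pmf.expectation (iid d J) (\<lambda>a. cis (of_int (S' a) * \<theta>))) \<le> exp (- (q * phase_defect N 0 \<theta>))" for \<theta>
      proof -
        define F where "F = (\<lambda>j (x::int). cis ((w (inv_into {..<N} h j) * \<theta>) / g * of_int x))"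
        have "measure_pmf.expectation (iid d J) (\<lambda>a. cis (of_int (S' a) * \<theta>)) =
          measure_pmf.expectation (iid d J) (\<lambda>a. cis (- (b * \<theta> / g)) * (\<Prod>j\<in>J. F j (a j)))"
        proof (intro integral_cong_AE AE_pmfI)
          fix a assume a: "a \<in> set_pmf (iid d J)"
          have "of_int (S' a) * \<theta> = - (b * \<theta> / g) + (\<Sum>l<N. (w l * \<theta>) / g * of_int (a (h l)))"
          proof -
            have "(\<Sum>l<N. (w l * \<theta>) / g * of_int (a (h l))) = of_int (S a) * \<theta> / g"
              by (simp add: S_def w_def sum_distrib_right sum_distrib_left sum_divide_distrib mult_ac)
            then show ?thesis unfolding S'[OF a] by (simp add: diff_divide_distrib left_diff_distrib)
          qed
          also have "cis \<dots> = cis (- (b * \<theta> / g)) * (\<Prod>l<N. cis ((w l * \<theta>) / g * of_int (a (h l))))"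
            by (simp only: cis_mult[symmetric] cis_sum)
          also have "(\<Prod>l<N. cis ((w l * \<theta>) / g * of_int (a (h l)))) = (\<Prod>j\<in>J. F j (a j))"
            unfolding J_def F_def by (simp add: prod.reindex[OF inj] inv_into_f_f[OF inj])
          finally show "cis (of_int (S' a) * \<theta>) = cis (- (b * \<theta> / g)) * (\<Prod>j\<in>J. F j (a j))" .
        qed simp_all
        also have "\<dots> = cis (- (b * \<theta> / g)) * (\<Prod>j\<in>J. measure_pmf.expectation d (F j))"
          using expectation_iid_prod[OF fJ fd, of F] by simp
        also have "(\<Prod>j\<in>J. measure_pmf.expectation d (F j)) = (\<Prod>l<N. cf d ((w l * \<theta>) / g))"
          unfolding J_def F_def cf_def by (simp add: prod.reindex[OF inj] inv_into_f_f[OF inj])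
        finally have "cmod (measure_pmf.expectation (iid d J) (\<lambda>a. cis (of_int (S' a) * \<theta>))) = (\<Prod>l<N. cmod (cf d ((w l * \<theta>) / g)))"
          by (simp add: norm_mult prod_norm)
        also have "\<dots> \<le> (\<Prod>l<N. exp (- (q * (1 - cos (w l * \<theta>)))))"
          by (intro prod_mono conjI q(2)) auto
        also have "\<dots> = exp (\<Sum>l<N. - (q * (1 - cos (w l * \<theta>))))" by (simp add: exp_sum)
        \<comment> \<open>The signs occur only inside the even function cos, so one phase defect
          serves all of them.\<close>
        also have "(\<Sum>l<N. - (q * (1 - cos (w l * \<theta>)))) = - (q * phase_defect N 0 \<theta>)"
        proof -
          have "cos (w l * \<theta>) = cos (real l * \<theta>)" for l using \<epsilon>[of l] by (auto simp: w_def)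
          then show ?thesis by (simp add: phase_defect_def sum_distrib_left sum_negf)
        qed
        finally show ?thesis .
      qed
      have Ef: "measure_pmf.expectation (iid d J) (\<lambda>a. cis (of_int (S' a) * \<theta>)) = (\<Sum>a\<in>set_pmf (iid d J). pmf (iid d J) a *\<^sub>R cis (of_int (S' a) * \<theta>))" for \<theta>
        by (rule integral_measure_pmf) (use fs in auto)
      have int: "set_integrable lborel {-pi..pi} (\<lambda>\<theta>. measure_pmf.expectation (iid d J) (\<lambda>a. cis (of_int (S' a) * \<theta>)))"
        unfolding Ef by (rule borel_integrable_atLeastAtMost') (intro continuous_intros)
      have "?P \<le> 2 * pi * ?P" using pi_bounds by (simp add: mult_left_le_one_le mult_le_cancel_right1)
      also have "2 * pi * ?P = cmod (LINT \<theta>:{-pi..pi}|lborel. measure_pmf.expectation (iid d J) (\<lambda>a. cis (of_int (S' a) * \<theta>)))"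
        unfolding P prob_eq_fourier_integral[OF fs, symmetric] norm_of_real by simp
      also have "\<dots> \<le> (LINT \<theta>:{-pi..pi}|lborel. cmod (measure_pmf.expectation (iid d J) (\<lambda>a. cis (of_int (S' a) * \<theta>))))"
        by (rule set_integral_norm_bound[OF int])
      also have "\<dots> \<le> (LINT \<theta>:{-pi..pi}|lborel. exp (- (q * phase_defect N 0 \<theta>)))"
      proof (rule set_integral_mono[OF set_integrable_norm[OF int]])
        show "set_integrable lborel {-pi..pi} (\<lambda>\<theta>. exp (- (q * phase_defect N 0 \<theta>)))"
          unfolding phase_defect_def by (rule borel_integrable_atLeastAtMost') (intro continuous_intros)
      qed (rule norm_E)
      also have "\<dots> \<le> (sqrt (120000 * pi / q) + 16 * pi / q\<^sup>2) * real N powr (-3/2)"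
        by (rule integral_exp_phase_defect_le[OF N6 q(1)])
      also have "\<dots> \<le> C * real N powr (-3/2)" by (intro mult_right_mono) (auto simp: C_def)
      finally show ?thesis .
    qed
    then show "iid_prob d (h ` {..<N}) {a. (\<Sum>l<N. \<epsilon> l * int l * a (h l)) = b} \<le> C * real N powr (-3/2)"
      by (simp add: S_def J_def)
  qed
qed

subsection \<open>Double roots at roots of unity\<close>

lemma prob_iid_union_product:
  assumes J: "finite J0" "finite J1" "J0 \<inter> J1 = {}" and fd: "finite (set_pmf d)"
    and A: "\<And>a a'. (\<And>j. j \<in> J0 \<Longrightarrow> a j = a' j) \<Longrightarrow> a \<in> A \<longleftrightarrow> a' \<in> A"
    and B: "\<And>a a'. (\<And>j. j \<in> J1 \<Longrightarrow> a j = a' j) \<Longrightarrow> a \<in> B \<longleftrightarrow> a' \<in> B"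
  shows "iid_prob d (J0 \<union> J1) (A \<inter> B) = iid_prob d J0 A * iid_prob d J1 B"
proof -
  let ?M = "iid d J0" and ?N = "iid d J1"
  let ?m = "\<lambda>(f, g) x. if x \<in> J0 then f x else g x :: int"
  have fin: "finite (set_pmf ?M)" "finite (set_pmf ?N)" using finite_set_iid fd J by auto
  have "?m -` (A \<inter> B) = A \<times> B"
  proof -
    have "?m (f, g) \<in> A \<longleftrightarrow> f \<in> A" for f g by (rule A) auto
    moreover have "?m (f, g) \<in> B \<longleftrightarrow> g \<in> B" for f g by (rule B) (use J in auto)
    ultimately show ?thesis by fastforce
  qed
  then have "iid_prob d (J0 \<union> J1) (A \<inter> B) = measure_pmf.prob (pair_pmf ?M ?N) (A \<times> B)"
    unfolding Pi_pmf_union[OF J] by (simp add: measure_map_pmf)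
  also have "\<dots> = measure_pmf.prob (pair_pmf ?M ?N) ((A \<inter> set_pmf ?M) \<times> (B \<inter> set_pmf ?N))"
    by (subst prob_pmf_cong_support) (simp add: Times_Int_Times)
  also have "\<dots> = measure_pmf.prob ?M (A \<inter> set_pmf ?M) * measure_pmf.prob ?N (B \<inter> set_pmf ?N)"
    using fin by (intro measure_pmf_prob_product countable_finite) auto
  also have "\<dots> = measure_pmf.prob ?M A * measure_pmf.prob ?N B"
    by (simp flip: prob_pmf_cong_support)
  finally show ?thesis .
qed

text \<open>
  The indices $j \le n$ with $j = r$ mod $m$ are $r + ml$ for $l$ below the length of the class
  (for $r \le n$).
\<close>
definition class_len :: "nat \<Rightarrow> nat \<Rightarrow> nat \<Rightarrow> nat" where
  "class_len n m r = (n - r) div m + 1"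

definition res_class :: "nat \<Rightarrow> nat \<Rightarrow> nat \<Rightarrow> nat set" where
  "res_class n m r = (\<lambda>l. r + m * l) ` {..<class_len n m r}"

lemma inj_res_class: "m > 0 \<Longrightarrow> inj_on (\<lambda>l. r + m * l) A" for r m :: nat
  by (auto simp: inj_on_def)

lemma res_class_subset:
  assumes "r \<le> n"
  shows "res_class n m r \<subseteq> {..n}"
proof
  fix j assume "j \<in> res_class n m r"
  then obtain l where l: "j = r + m * l" "l < class_len n m r" unfolding res_class_def by blast
  then have "l \<le> (n - r) div m" by (simp add: class_len_def)
  then have "m * l \<le> m * ((n - r) div m)" by simp
  also have "\<dots> \<le> n - r" by simp
  finally show "j \<in> {..n}" using l assms by simp
qed

lemma res_class_disjoint: "m \<ge> 2 \<Longrightarrow> res_class n m 0 \<inter> res_class n m 1 = {}"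
proof (rule ccontr)
  assume m: "m \<ge> 2" and "res_class n m 0 \<inter> res_class n m 1 \<noteq> {}"
  then obtain k l where "m * k = 1 + m * l" by (auto simp: res_class_def)
  then have "m dvd 1 + m * l" by (metis dvd_triv_left)
  then have "m dvd 1" using dvd_add_left_iff[of m "m * l" 1] by simp
  then show False using m by simp
qed

lemma class_len_ge:
  assumes "n \<ge> 1" "r \<le> 1" "m > 0"
  shows "real n / real m \<le> real (class_len n m r)"
proof -
  have "n - r < m * ((n - r) div m) + m" 
    using dividend_less_div_times[of m "n - r"] assms(3) by (simp add: mult.commute add.commute)
  then have "n \<le> m * class_len n m r" using assms by (simp add: class_len_def)
  then have "real n \<le> real m * real (class_len n m r)" by (metis of_nat_le_iff of_nat_mult)
  then show ?thesis using assms by (simp add: field_simps)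
qed

text \<open>\<open>G\<close> need only fix the weighted sum of each class once all coefficients
  outside the two classes are given. The classes are disjoint, so two bounds of exponent 3/2
  multiply to a cube.\<close>

lemma prob_two_classes:
  assumes supp: "set_pmf d \<subseteq> {-1, 0, 1}" and small: "\<And>x. pmf d x < 1"
  obtains C where "C > 0"
    "\<And>n m G. n \<ge> 1 \<Longrightarrow> m \<ge> 2 \<Longrightarrow>
      (\<And>a a' r. a \<in> G \<Longrightarrow> a' \<in> G \<Longrightarrow> r \<in> {0, 1} \<Longrightarrow>
        (\<And>j. j \<in> {..n} - (res_class n m 0 \<union> res_class n m 1) \<Longrightarrow> a j = a' j) \<Longrightarrow>
        (\<Sum>l<class_len n m r. int l * a (r + m * l)) = (\<Sum>l<class_len n m r. int l * a' (r + m * l))) \<Longrightarrow>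
      iid_prob d {..n} G \<le> C * (real m / real n) ^ 3"
proof -
  obtain C where C: "C > 0" and bnd: "\<And>(N :: nat) (h :: nat \<Rightarrow> nat) (\<epsilon> :: nat \<Rightarrow> int) (b :: int). N \<ge> 1 \<Longrightarrow> inj_on h {..<N} \<Longrightarrow> (\<And>l. \<epsilon> l \<in> {-1, 1}) \<Longrightarrow>
      iid_prob d (h ` {..<N}) {a. (\<Sum>l<N. \<epsilon> l * int l * a (h l)) = b} \<le> C * real N powr (-3/2)"
    by (rule prob_weighted_sum_le[OF supp small]; rule that; blast)
  have fd: "finite (set_pmf d)" using supp finite_subset by blast
  show ?thesis
  proof (rule that[of "C\<^sup>2"])
    show "C\<^sup>2 > 0" using C by simp
    fix n m :: nat and G :: "(nat \<Rightarrow> int) set"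
    assume n: "n \<ge> 1" and m: "m \<ge> 2" and det: "\<And>a a' r. a \<in> G \<Longrightarrow> a' \<in> G \<Longrightarrow> r \<in> {0, 1} \<Longrightarrow>
        (\<And>j. j \<in> {..n} - (res_class n m 0 \<union> res_class n m 1) \<Longrightarrow> a j = a' j) \<Longrightarrow>
        (\<Sum>l<class_len n m r. int l * a (r + m * l)) = (\<Sum>l<class_len n m r. int l * a' (r + m * l))"
    define J0 J1 where "J0 = res_class n m 0" and "J1 = res_class n m 1"
    define B where "B = (\<lambda>r (a :: nat \<Rightarrow> int). \<Sum>l<class_len n m r. int l * a (r + m * l))"
    have fin: "finite J0" "finite J1" by (auto simp: J0_def J1_def res_class_def)
    have sub: "J0 \<union> J1 \<subseteq> {..n}" using res_class_subset[of _ n m] n by (auto simp: J0_def J1_def)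
    have dis: "J0 \<inter> J1 = {}" using res_class_disjoint[OF m] by (simp add: J0_def J1_def)
    have B_cong: "B r a = B r a'" if "\<And>j. j \<in> res_class n m r \<Longrightarrow> a j = a' j" for r a a'
      unfolding B_def using that by (intro sum.cong) (auto simp: res_class_def)
    have one: "iid_prob d (res_class n m r) {a. B r a = b} \<le> C * (real n / real m) powr (-3/2)" if "r \<le> 1" for r b
    proof -
      have "iid_prob d (res_class n m r) {a. B r a = b} \<le> C * real (class_len n m r) powr (-3/2)"
        using bnd[of "class_len n m r" "\<lambda>l. r + m * l" "\<lambda>_. 1" b] inj_res_class[of m r] m
        by (simp add: B_def res_class_def class_len_def)
      also have "\<dots> \<le> C * (real n / real m) powr (-3/2)"
        using class_len_ge[OF n that, of m] C m n by (intro mult_left_mono powr_mono2') auto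
      finally show ?thesis .
    qed
    have "iid_prob d {..n} G \<le> (C * (real n / real m) powr (-3/2)) * (C * (real n / real m) powr (-3/2))"
    proof (rule prob_iid_le_conditional[OF _ sub])
      show "0 \<le> (C * (real n / real m) powr (-3/2)) * (C * (real n / real m) powr (-3/2))" using C by simp
      fix b assume "b \<in> set_pmf (iid d ({..n} - (J0 \<union> J1)))"
      let ?m = "\<lambda>a x. if x \<in> {..n} - (J0 \<union> J1) then b x else a x"
      show "iid_prob d (J0 \<union> J1) {a. ?m a \<in> G} \<le> (C * (real n / real m) powr (-3/2)) * (C * (real n / real m) powr (-3/2))"
      proof (cases "{a. ?m a \<in> G} = {}")
        case True
        then show ?thesis unfolding True using C by simp
      next
        case False
        then obtain a0 where a0: "?m a0 \<in> G" by blast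
        have Bm: "B r (?m a) = B r a" if "r \<in> {0, 1}" for r a
          by (rule B_cong) (use that in \<open>auto simp: J0_def J1_def\<close>)
        have "B r a = B r a0" if "?m a \<in> G" "r \<in> {0, 1}" for a r
          using det[OF that(1) a0 that(2)] Bm[OF that(2), of a] Bm[OF that(2), of a0]
          by (simp add: B_def J0_def J1_def)
        then have "{a. ?m a \<in> G} \<subseteq> {a. B 0 a = B 0 a0} \<inter> {a. B 1 a = B 1 a0}" by auto
        then have "iid_prob d (J0 \<union> J1) {a. ?m a \<in> G} \<le> iid_prob d (J0 \<union> J1) ({a. B 0 a = B 0 a0} \<inter> {a. B 1 a = B 1 a0})"
          by (intro measure_pmf.finite_measure_mono) auto
        also have "\<dots> = iid_prob d J0 {a. B 0 a = B 0 a0} * iid_prob d J1 {a. B 1 a = B 1 a0}"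
        proof (rule prob_iid_union_product[OF fin dis fd])
          fix a a' :: "nat \<Rightarrow> int" assume "\<And>j. j \<in> J0 \<Longrightarrow> a j = a' j"
          then have "B 0 a = B 0 a'" by (intro B_cong) (simp add: J0_def)
          then show "(a \<in> {a. B 0 a = B 0 a0}) = (a' \<in> {a. B 0 a = B 0 a0})" by simp
        next
          fix a a' :: "nat \<Rightarrow> int" assume "\<And>j. j \<in> J1 \<Longrightarrow> a j = a' j"
          then have "B 1 a = B 1 a'" by (intro B_cong) (simp add: J1_def)
          then show "(a \<in> {a. B 1 a = B 1 a0}) = (a' \<in> {a. B 1 a = B 1 a0})" by simp
        qed
        also have "\<dots> \<le> (C * (real n / real m) powr (-3/2)) * (C * (real n / real m) powr (-3/2))"
          unfolding J0_def J1_def using C by (intro mult_mono one) auto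
        finally show ?thesis .
      qed
    qed simp
    also have "\<dots> = C\<^sup>2 * (real m / real n) ^ 3"
    proof -
      have "(real n / real m) powr (-3/2) * (real n / real m) powr (-3/2) = (real n / real m) powr (-3)"
        by (simp flip: powr_add)
      also have "\<dots> = (real m / real n) ^ 3"
        using n m by (simp add: powr_minus powr_numeral power_divide field_simps)
      finally show ?thesis by (simp add: power2_eq_square mult_ac)
    qed
    finally show "iid_prob d {..n} G \<le> C\<^sup>2 * (real m / real n) ^ 3" .
  qed
qed

text \<open>On the class of r the power z^j is constantly z^r. The offset in j = 1 + m l is what
  brings \<open>X 1\<close> into the second identity.\<close>

lemma root_of_unity_class_sum:
  fixes e :: "nat \<Rightarrow> int" and z :: complex
  assumes m: "m \<ge> 2" and n: "n \<ge> 1" and z: "z ^ m = 1"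
    and e: "\<And>j. j \<in> {..n} - (res_class n m 0 \<union> res_class n m 1) \<Longrightarrow> e j = 0"
  defines "X \<equiv> \<lambda>r. \<Sum>l<class_len n m r. e (r + m * l)"
    and "Y \<equiv> \<lambda>r. \<Sum>l<class_len n m r. int l * e (r + m * l)"
  shows "(\<Sum>j\<le>n. of_int (e j) * z ^ j) = of_int (X 0) + z * of_int (X 1)"
    "(\<Sum>j\<le>n. of_nat j * of_int (e j) * z ^ j) = of_int (int m * Y 0) + z * of_int (X 1 + int m * Y 1)"
proof -
  have zl: "z ^ (m * l) = 1" "z ^ (l * m) = 1" for l
    using z by (simp_all add: power_mult mult.commute[of l m])
  have split: "(\<Sum>j\<le>n. f j) = (\<Sum>l<class_len n m 0. f (m * l)) + (\<Sum>l<class_len n m 1. f (1 + m * l))"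
    if "\<And>j. e j = 0 \<Longrightarrow> f j = 0" for f :: "nat \<Rightarrow> complex"
  proof -
    have "(\<Sum>j\<le>n. f j) = (\<Sum>j\<in>res_class n m 0 \<union> res_class n m 1. f j)"
      using res_class_subset[of _ n m] n e that by (intro sum.mono_neutral_right) auto
    also have "\<dots> = (\<Sum>j\<in>res_class n m 0. f j) + (\<Sum>j\<in>res_class n m 1. f j)"
      using res_class_disjoint[OF m] by (intro sum.union_disjoint) (auto simp: res_class_def)
    also have "\<dots> = (\<Sum>l<class_len n m 0. f (0 + m * l)) + (\<Sum>l<class_len n m 1. f (1 + m * l))"
      
      unfolding res_class_def using m
      by (subst (1 2) sum.reindex) (auto simp: inj_on_def)
    finally show ?thesis by simp
  qed
  show "(\<Sum>j\<le>n. of_int (e j) * z ^ j) = of_int (X 0) + z * of_int (X 1)"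
    by (subst split) (simp_all add: X_def zl sum_distrib_left mult_ac)
  show "(\<Sum>j\<le>n. of_nat j * of_int (e j) * z ^ j) = of_int (int m * Y 0) + z * of_int (X 1 + int m * Y 1)"
    by (subst split) (simp_all add: X_def Y_def zl sum_distrib_left sum.distrib algebra_simps)
qed

lemma poly_pderiv_int_poly:
  "z * poly (pderiv (cpoly (int_poly n a))) z = (\<Sum>j\<le>n. of_nat j * of_int (a j) * z ^ j)"
proof -
  have "pderiv (cpoly (int_poly n a)) = (\<Sum>j\<le>n. monom (of_nat j * of_int (a j)) (j - 1))"
    unfolding rand_poly_eq_cpoly[symmetric] rand_poly_def 
    by (simp add: higher_pderiv_sum[where n = 1, simplified] pderiv_monom)
  then have "z * poly (pderiv (cpoly (int_poly n a))) z = (\<Sum>j\<le>n. of_nat j * of_int (a j) * (z * z ^ (j - 1)))"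
    by (simp add: poly_sum poly_monom sum_distrib_left mult_ac)
  also have "\<dots> = (\<Sum>j\<le>n. of_nat j * of_int (a j) * z ^ j)"
  proof (rule sum.cong)
    fix j show "of_nat j * of_int (a j) * (z * z ^ (j - 1)) = of_nat j * of_int (a j) * z ^ j"
      by (cases j) simp_all
  qed simp
  finally show ?thesis .
qed

definition double_root_at :: "nat \<Rightarrow> complex \<Rightarrow> (nat \<Rightarrow> int) \<Rightarrow> bool" where
  "double_root_at n z a \<longleftrightarrow> poly (cpoly (int_poly n a)) z = 0 \<and> poly (pderiv (cpoly (int_poly n a))) z = 0"

lemma has_double_root_iff: "has_double_root (rand_poly n a) \<longleftrightarrow> (\<exists>z. double_root_at n z a)"
  by (simp add: has_double_root_def square_linear_dvd_iff rand_poly_eq_cpoly double_root_at_def)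

lemma double_root_at_sums:
  assumes "double_root_at n z a"
  shows "(\<Sum>j\<le>n. of_int (a j) * z ^ j) = 0" "(\<Sum>j\<le>n. of_nat j * of_int (a j) * z ^ j) = 0"
  using assms poly_pderiv_int_poly[of z n a] by (auto simp: double_root_at_def poly_int_poly)

lemma double_root_at_class_relations:
  fixes a a' :: "nat \<Rightarrow> int"
  assumes m: "m \<ge> 2" and n: "n \<ge> 1" and z: "z ^ m = 1"
    and a: "double_root_at n z a" "double_root_at n z a'"
    and eq: "\<And>j. j \<in> {..n} - (res_class n m 0 \<union> res_class n m 1) \<Longrightarrow> a j = a' j"
  defines "X \<equiv> \<lambda>r. \<Sum>l<class_len n m r. a (r + m * l) - a' (r + m * l)"
    and "Y \<equiv> \<lambda>r. \<Sum>l<class_len n m r. int l * (a (r + m * l) - a' (r + m * l))"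
  shows "of_int (X 0) + z * of_int (X 1) = 0"
    "of_int (int m * Y 0) + z * of_int (X 1 + int m * Y 1) = 0"
proof -
  have "(\<Sum>j\<le>n. of_int (a j - a' j) * z ^ j) = 0" "(\<Sum>j\<le>n. of_nat j * of_int (a j - a' j) * z ^ j) = 0"
    using double_root_at_sums[OF a(1)] double_root_at_sums[OF a(2)] by (simp_all add: algebra_simps sum_subtractf)
  with root_of_unity_class_sum[OF m n z, of "\<lambda>j. a j - a' j"] eq
  show "of_int (X 0) + z * of_int (X 1) = 0" "of_int (int m * Y 0) + z * of_int (X 1 + int m * Y 1) = 0"
    by (simp_all add: X_def Y_def)
qed

text \<open>For nonreal \<open>z\<close>, x + z y = 0 with integers x, y forces x = y = 0: the first
  relation kills both X, then the second kills both Y. For double roots at 1 and -1 together the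
  same follows with m = 2 by adding and subtracting; this event is the overlap in a later
  inclusion-exclusion, where n^(-3) is negligible.\<close>

lemma prob_double_root_nonreal_unity:
  assumes supp: "set_pmf d \<subseteq> {-1, 0, 1}" and small: "\<And>x. pmf d x < 1"
  obtains C where "C > 0"
    "\<And>n m z. n \<ge> 1 \<Longrightarrow> m \<ge> 1 \<Longrightarrow> z ^ m = 1 \<Longrightarrow> Im z \<noteq> 0 \<Longrightarrow>
      iid_prob d {..n} {a. double_root_at n z a} \<le> C * (real m / real n) ^ 3"
    "\<And>n. n \<ge> 1 \<Longrightarrow>
      iid_prob d {..n} {a. double_root_at n 1 a \<and> double_root_at n (-1) a} \<le> C * (2 / real n) ^ 3"
proof -
  obtain C where C: "C > 0" and bnd: "\<And>n m G. n \<ge> 1 \<Longrightarrow> m \<ge> 2 \<Longrightarrow>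
      (\<And>a a' r. a \<in> G \<Longrightarrow> a' \<in> G \<Longrightarrow> r \<in> {0, 1} \<Longrightarrow>
        (\<And>j. j \<in> {..n} - (res_class n m 0 \<union> res_class n m 1) \<Longrightarrow> a j = a' j) \<Longrightarrow>
        (\<Sum>l<class_len n m r. int l * a (r + m * l)) = (\<Sum>l<class_len n m r. int l * a' (r + m * l))) \<Longrightarrow>
      iid_prob d {..n} G \<le> C * (real m / real n) ^ 3"
    by (rule prob_two_classes[OF supp small]; rule that; blast)
  show ?thesis
  proof (rule that[OF C])
    fix n m :: nat and z :: complex assume n: "n \<ge> 1" and m1: "m \<ge> 1" and z: "z ^ m = 1" "Im z \<noteq> 0"
    have m: "m \<ge> 2" using m1 z by (cases "m = 1") auto
    show "iid_prob d {..n} {a. double_root_at n z a} \<le> C * (real m / real n) ^ 3"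
    proof (rule bnd[OF n m])
      fix a a' and r :: nat
      assume a: "a \<in> {a. double_root_at n z a}" "a' \<in> {a. double_root_at n z a}" and r: "r \<in> {0, 1}"
        and eq: "\<And>j. j \<in> {..n} - (res_class n m 0 \<union> res_class n m 1) \<Longrightarrow> a j = a' j"
      let ?X = "\<lambda>r. \<Sum>l<class_len n m r. a (r + m * l) - a' (r + m * l)"
      let ?Y = "\<lambda>r. \<Sum>l<class_len n m r. int l * (a (r + m * l) - a' (r + m * l))"
      have rel: "of_int (?X 0) + z * of_int (?X 1) = 0" "of_int (int m * ?Y 0) + z * of_int (?X 1 + int m * ?Y 1) = 0"
        using double_root_at_class_relations[OF m n z(1), of a a'] eq a by blast+
      have zero: "x = 0 \<and> y = 0" if "of_int x + z * of_int y = 0" for x y :: int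
      proof -
        have "Im z * of_int y = 0" using arg_cong[OF that, of Im] by simp
        then have "y = 0" using z(2) by simp
        with that show ?thesis by simp
      qed
      have "?Y r = 0" using zero[OF rel(1)] zero[OF rel(2)] r m by auto
      then show "(\<Sum>l<class_len n m r. int l * a (r + m * l)) = (\<Sum>l<class_len n m r. int l * a' (r + m * l))"
        by (simp add: right_diff_distrib sum_subtractf)
    qed
  next
    fix n :: nat assume n: "n \<ge> 1"
    have "iid_prob d {..n} {a. double_root_at n 1 a \<and> double_root_at n (-1) a} \<le> C * (real 2 / real n) ^ 3"
    proof (rule bnd[OF n])
      fix a a' and r :: nat
      assume a: "a \<in> {a. double_root_at n 1 a \<and> double_root_at n (-1) a}" "a' \<in> {a. double_root_at n 1 a \<and> double_root_at n (-1) a}" and r: "r \<in> {0, 1}"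
        and eq: "\<And>j. j \<in> {..n} - (res_class n 2 0 \<union> res_class n 2 1) \<Longrightarrow> a j = a' j"
      let ?X = "\<lambda>r. \<Sum>l<class_len n 2 r. a (r + 2 * l) - a' (r + 2 * l)"
      let ?Y = "\<lambda>r. \<Sum>l<class_len n 2 r. int l * (a (r + 2 * l) - a' (r + 2 * l))"
      have rel1: "complex_of_int (?X 0) + 1 * of_int (?X 1) = 0" "complex_of_int (int 2 * ?Y 0) + 1 * of_int (?X 1 + int 2 * ?Y 1) = 0"
        using double_root_at_class_relations[OF order_refl n, of 1 a a'] eq a by auto
      have rel2: "complex_of_int (?X 0) + (-1) * of_int (?X 1) = 0" "complex_of_int (int 2 * ?Y 0) + (-1) * of_int (?X 1 + int 2 * ?Y 1) = 0"
        using double_root_at_class_relations[OF order_refl n, of "-1" a a'] eq a by auto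
      have zero: "x = 0 \<and> y = 0" if "complex_of_int x + 1 * of_int y = 0" "complex_of_int x + (-1) * of_int y = 0" for x y :: int
      proof -
        have "complex_of_int (x + y) = 0" "complex_of_int (x - y) = 0" using that by simp_all
        then have "x + y = 0" "x - y = 0" by (simp_all only: of_int_eq_0_iff)
        then show ?thesis by linarith
      qed
      have "?Y r = 0" using zero[OF rel1(1) rel2(1)] zero[OF rel1(2) rel2(2)] r by auto
      then show "(\<Sum>l<class_len n 2 r. int l * a (r + 2 * l)) = (\<Sum>l<class_len n 2 r. int l * a' (r + 2 * l))"
        by (simp add: right_diff_distrib sum_subtractf)
    qed simp
    then show "iid_prob d {..n} {a. double_root_at n 1 a \<and> double_root_at n (-1) a} \<le> C * (2 / real n) ^ 3"
      by simp
  qed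
qed

abbreviation unity_event :: "nat \<Rightarrow> nat \<Rightarrow> (nat \<Rightarrow> int) set" where
  "unity_event n K \<equiv> {a. \<exists>m z. 0 < m \<and> m \<le> K \<and> z ^ m = 1 \<and> Im z \<noteq> 0 \<and> double_root_at n z a}"

text \<open>At most K exponents m, at most K roots for each and C (K / n)^3 per root give the fifth
  power of K.\<close>

lemma prob_double_root_small_unity:
  assumes supp: "set_pmf d \<subseteq> {-1, 0, 1}" and small: "\<And>x. pmf d x < 1"
  obtains C where "C > 0"
    "\<And>n K. n \<ge> 1 \<Longrightarrow>
      iid_prob d {..n} (unity_event n K)
        \<le> C * real K ^ 5 / real n ^ 3"
proof -
  obtain C where C: "C > 0" and bnd: "\<And>n m z. n \<ge> 1 \<Longrightarrow> m \<ge> 1 \<Longrightarrow> z ^ m = 1 \<Longrightarrow> Im z \<noteq> 0 \<Longrightarrow>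
      iid_prob d {..n} {a. double_root_at n z a} \<le> C * (real m / real n) ^ 3"
    by (rule prob_double_root_nonreal_unity[OF supp small]; rule that; blast)
  show ?thesis
  proof (rule that[OF C])
    fix n K :: nat assume n: "n \<ge> 1"
    let ?p = "iid_prob d {..n}"
    let ?Z = "\<lambda>m. {z::complex. z ^ m = 1 \<and> Im z \<noteq> 0}"
    have fin: "finite (?Z m)" "card (?Z m) \<le> m" if "m \<in> {1..K}" for m
    proof -
      have f: "finite {z::complex. z ^ m = 1}" "card {z::complex. z ^ m = 1} = m"
        using that card_roots_unity_eq[of m] by (auto intro!: finite_roots_unity)
      then show "finite (?Z m)" by (rule_tac finite_subset[OF _ f(1)]) auto
      have "card (?Z m) \<le> card {z::complex. z ^ m = 1}" using f(1) by (intro card_mono) auto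
      then show "card (?Z m) \<le> m" using f(2) by simp
    qed
    have "unity_event n K
       = (\<Union>m\<in>{1..K}. \<Union>z\<in>?Z m. {a. double_root_at n z a})" 
      by (fastforce simp: Suc_le_eq)
    then have "?p (unity_event n K)
       \<le> (\<Sum>m\<in>{1..K}. ?p (\<Union>z\<in>?Z m. {a. double_root_at n z a}))"
      using measure_pmf.finite_measure_subadditive_finite[of "{1..K}" "\<lambda>m. \<Union>z\<in>?Z m. {a. double_root_at n z a}" "iid d {..n}"] by simp
    also have "\<dots> \<le> (\<Sum>m\<in>{1..K}. real K * (C * (real K / real n) ^ 3))"
    proof (rule sum_mono)
      fix m assume m: "m \<in> {1..K}"
      have "?p (\<Union>z\<in>?Z m. {a. double_root_at n z a}) \<le> (\<Sum>z\<in>?Z m. ?p {a. double_root_at n z a})"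
        using fin(1)[OF m] by (intro measure_pmf.finite_measure_subadditive_finite) auto
      also have "\<dots> \<le> (\<Sum>z\<in>?Z m. C * (real K / real n) ^ 3)"
      proof (rule sum_mono)
        fix z assume "z \<in> ?Z m"
        then have "?p {a. double_root_at n z a} \<le> C * (real m / real n) ^ 3" using m n by (intro bnd) auto
        also have "\<dots> \<le> C * (real K / real n) ^ 3"
          using m C by (intro mult_left_mono power_mono divide_right_mono) auto
        finally show "?p {a. double_root_at n z a} \<le> C * (real K / real n) ^ 3" .
      qed
      also have "\<dots> = real (card (?Z m)) * (C * (real K / real n) ^ 3)" by simp
      also have "\<dots> \<le> real K * (C * (real K / real n) ^ 3)"
        using fin(2)[OF m] m C by (intro mult_right_mono) auto
      finally show "?p (\<Union>z\<in>?Z m. {a. double_root_at n z a}) \<le> real K * (C * (real K / real n) ^ 3)" .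
    qed
    also have "\<dots> = C * real K ^ 5 / real n ^ 3" by (simp add: power_divide eval_nat_numeral)
    finally show "?p (unity_event n K) \<le> C * real K ^ 5 / real n ^ 3" .
  qed
qed

text \<open>The derivative equation alone is a signed weighted sum. Its rate n^(-3/2) is enough for
  the limit in the first claim, though too weak for the second.\<close>

lemma prob_double_root_pm1_le:
  assumes supp: "set_pmf d \<subseteq> {-1, 0, 1}" and small: "\<And>x. pmf d x < 1"
  obtains C where "C > 0"
    "\<And>n z. z \<in> {1, -1} \<Longrightarrow> iid_prob d {..n} {a. double_root_at n z a} \<le> C * real (n + 1) powr (-3/2)"
proof -
  obtain C where C: "C > 0" and bnd: "\<And>(N :: nat) (h :: nat \<Rightarrow> nat) (\<epsilon> :: nat \<Rightarrow> int) (b :: int). N \<ge> 1 \<Longrightarrow> inj_on h {..<N} \<Longrightarrow> (\<And>l. \<epsilon> l \<in> {-1, 1}) \<Longrightarrow>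
      iid_prob d (h ` {..<N}) {a. (\<Sum>l<N. \<epsilon> l * int l * a (h l)) = b} \<le> C * real N powr (-3/2)"
    by (rule prob_weighted_sum_le[OF supp small]; rule that; blast)
  show ?thesis
  proof (rule that[OF C])
    fix n and z :: complex assume z: "z \<in> {1, -1}"
    obtain w :: int where w: "w \<in> {1, -1}" "z = of_int w" using z by (metis insertE empty_iff insertI1 insertI2 of_int_1 of_int_minus)
    have "{a. double_root_at n z a} \<subseteq> {a. (\<Sum>l<n + 1. w ^ l * int l * a l) = 0}"
    proof
      fix a assume "a \<in> {a. double_root_at n z a}"
      then have "(\<Sum>j\<le>n. of_nat j * of_int (a j) * z ^ j) = 0" using double_root_at_sums by simp
      then have "complex_of_int (\<Sum>l<n + 1. w ^ l * int l * a l) = 0"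
        by (simp add: w(2) mult_ac flip: lessThan_Suc_atMost)
      then show "a \<in> {a. (\<Sum>l<n + 1. w ^ l * int l * a l) = 0}" by (simp only: of_int_eq_0_iff mem_Collect_eq)
    qed
    then have "iid_prob d {..n} {a. double_root_at n z a} \<le> iid_prob d {..n} {a. (\<Sum>l<n + 1. w ^ l * int l * a l) = 0}"
      by (intro measure_pmf.finite_measure_mono) auto
    also have "\<dots> \<le> C * real (n + 1) powr (-3/2)"
    proof -
      have "w ^ l \<in> {-1, 1}" for l using w(1) by (cases "even l") auto
      then show ?thesis
        using bnd[of "n + 1" "\<lambda>x. x" "\<lambda>l. w ^ l" 0] by (simp add: lessThan_Suc_atMost inj_on_def)
    qed
    finally show "iid_prob d {..n} {a. double_root_at n z a} \<le> C * real (n + 1) powr (-3/2)" .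
  qed
qed

subsection \<open>The local limit integral\<close>

text \<open>The characteristic function of a variable with values 1 and -1 and mean \<mu>.\<close>

definition cz :: "real \<Rightarrow> real \<Rightarrow> complex" where
  "cz \<mu> v = of_real (cos v) + \<i> * of_real (\<mu> * sin v)"

text \<open>
  The characteristic function of half of $(\sum_j (-1)^j \xi_j, \sum_j j (-1)^j \xi_j)$ for
  $\xi_j = \pm 1$ of mean $\mu$. Both sums are even when 4 divides $N$; halving them leaves a single
  maximum of the modulus in the square $[-\pi, \pi]^2$.
\<close>
definition Phi :: "real \<Rightarrow> nat \<Rightarrow> real \<Rightarrow> real \<Rightarrow> complex" where
  "Phi \<mu> N s t = (\<Prod>j<N. cz \<mu> ((-1) ^ j * (s + real j * t) / 2))"

lemma cmod_cz_le:
  assumes "\<bar>\<mu>\<bar> \<le> 1"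
  shows "cmod (cz \<mu> (\<theta> / 2)) \<le> exp (- ((1 - \<mu>\<^sup>2) / 4 * (1 - cos \<theta>)))"
proof -
  have c: "cos \<theta> = 1 - 2 * (sin (\<theta> / 2))\<^sup>2" using cos_double_sin[of "\<theta> / 2"] by simp
  have "(cmod (cz \<mu> (\<theta> / 2)))\<^sup>2 = (cos (\<theta> / 2))\<^sup>2 + \<mu>\<^sup>2 * (sin (\<theta> / 2))\<^sup>2"
    by (simp add: cz_def cmod_def power_mult_distrib)
  also have "\<dots> = 1 + - ((1 - \<mu>\<^sup>2) / 2 * (1 - cos \<theta>))"
    unfolding c by (simp add: cos_squared_eq field_simps)
  also have "\<dots> \<le> exp (- ((1 - \<mu>\<^sup>2) / 2 * (1 - cos \<theta>)))" by (rule exp_ge_add_one_self)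
  also have "\<dots> = (exp (- ((1 - \<mu>\<^sup>2) / 4 * (1 - cos \<theta>))))\<^sup>2" by (simp add: power2_eq_square flip: exp_add)
  finally show ?thesis by (rule power2_le_imp_le) simp
qed

lemma cmod_cz_le_1:
  assumes "\<bar>\<mu>\<bar> \<le> 1"
  shows "cmod (cz \<mu> v) \<le> 1"
proof -
  have "cmod (cz \<mu> ((2 * v) / 2)) \<le> exp (- ((1 - \<mu>\<^sup>2) / 4 * (1 - cos (2 * v))))" by (rule cmod_cz_le[OF assms])
  also have "\<dots> \<le> 1" using assms by (simp add: abs_square_le_1)
  finally show ?thesis by simp
qed

lemma cmod_Phi_le:
  assumes "\<bar>\<mu>\<bar> \<le> 1"
  shows "cmod (Phi \<mu> N s t) \<le> exp (- ((1 - \<mu>\<^sup>2) / 4 * phase_defect N s t))"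
proof -
  have "cmod (Phi \<mu> N s t) = (\<Prod>j<N. cmod (cz \<mu> (((-1) ^ j * (s + real j * t)) / 2)))"
    by (simp add: Phi_def prod_norm)
  also have "\<dots> \<le> (\<Prod>j<N. exp (- ((1 - \<mu>\<^sup>2) / 4 * (1 - cos ((-1) ^ j * (s + real j * t))))))"
    by (intro prod_mono conjI cmod_cz_le[OF assms]) auto
  also have "\<dots> = (\<Prod>j<N. exp (- ((1 - \<mu>\<^sup>2) / 4 * (1 - cos (s + real j * t)))))"
  proof (rule prod.cong)
    fix j
    have "cos ((-1) ^ j * (s + real j * t)) = cos (s + real j * t)" 
      using cos_minus[of "s + real j * t"] by (cases "even j") simp_all
    then show "exp (- ((1 - \<mu>\<^sup>2) / 4 * (1 - cos ((-1) ^ j * (s + real j * t))))) = exp (- ((1 - \<mu>\<^sup>2) / 4 * (1 - cos (s + real j * t))))"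
      by simp
  qed simp
  also have "\<dots> = exp (- ((1 - \<mu>\<^sup>2) / 4 * phase_defect N s t))"
    by (simp add: exp_sum[symmetric] phase_defect_def sum_distrib_left sum_negf)
  finally show ?thesis .
qed

lemma exp_minus_le_inverse_linear:
  fixes c u :: real
  assumes "c > 0" "u \<ge> 0"
  shows "exp (- (c * u)) \<le> max 1 (1 / c) * inverse (1 + u)"
proof -
  have "1 + u \<le> max 1 (1 / c) * (1 + c * u)"
  proof (cases "c \<ge> 1")
    case True
    then have "u \<le> c * u" using assms mult_right_mono[of 1 c u] by simp
    then have "1 + u \<le> 1 * (1 + c * u)" by simp
    also have "\<dots> \<le> max 1 (1 / c) * (1 + c * u)" using assms by (intro mult_right_mono) auto
    finally show ?thesis .
  next
    case False
    then have "1 \<le> 1 / c" using assms by simp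
    then have "1 + u \<le> (1 / c) * (1 + c * u)" using assms by (simp add: field_simps)
    also have "\<dots> \<le> max 1 (1 / c) * (1 + c * u)" using assms by (intro mult_right_mono) auto
    finally show ?thesis .
  qed
  also have "\<dots> \<le> max 1 (1 / c) * exp (c * u)" by (intro mult_left_mono exp_ge_add_one_self) auto
  finally have "exp (- (c * u)) * (1 + u) \<le> exp (- (c * u)) * (max 1 (1 / c) * exp (c * u))"
    by (intro mult_left_mono) auto
  also have "\<dots> = max 1 (1 / c)" by (simp add: exp_minus)
  finally show ?thesis using assms by (simp add: field_simps)
qed

lemma exp_minus_le_inverse_power4:
  fixes u :: real
  assumes "u > 0"
  shows "exp (- u) \<le> 256 / u ^ 4"
proof -
  have "u / 4 \<le> exp (u / 4)" using exp_ge_add_one_self[of "u / 4"] by linarith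
  then have "(u / 4) ^ 4 \<le> exp (u / 4) ^ 4" using assms by (intro power_mono) auto
  also have "\<dots> = exp u" using exp_of_nat_mult[of 4 "u / 4"] by simp
  finally have "exp (- u) * (u / 4) ^ 4 \<le> exp (- u) * exp u" by (intro mult_left_mono) auto
  then have "exp (- u) * (u / 4) ^ 4 \<le> 1" by (simp flip: exp_add)
  then show ?thesis using assms by (simp add: field_simps)
qed

text \<open>Under s = x / N^(1/2), t = y / N^(3/2) the majorant becomes K / ((1 + x^2) (1 + y^2)),
  integrable and free of N. For small |t| it comes from the quadratic phase bound; elsewhere the two
  denominators are O(N) and O(N^3), and exponential decay beats N^4.\<close>

lemma cmod_Phi_dominated:
  assumes \<mu>: "\<bar>\<mu>\<bar> < 1"
  obtains K where "K > 0" "\<And>N s t. N \<ge> 6 \<Longrightarrow> \<bar>s\<bar> \<le> pi \<Longrightarrow> \<bar>t\<bar> \<le> pi \<Longrightarrow>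
    cmod (Phi \<mu> N s t) \<le> K * (inverse (1 + real N * s\<^sup>2) * inverse (1 + real N ^ 3 * t\<^sup>2))"
proof -
  define q where "q = (1 - \<mu>\<^sup>2) / 4"
  have q: "q > 0" using \<mu> by (simp add: q_def abs_square_less_1)
  define c where "c = q / 120000"
  have c: "c > 0" using q by (simp add: c_def)
  \<comment> \<open>The number 4096 = 256 2^4 comes from \<open>exp_minus_le_inverse_power4\<close>
    at q N / 2, and 144 = 12^2 from bounding both denominators with pi^2 <= 11.\<close>
  define K where "K = max ((max 1 (1 / c))\<^sup>2) (144 * (4096 / q ^ 4))"
  show ?thesis
  proof (rule that[of K])
    show "K > 0" unfolding K_def by (simp add: less_max_iff_disj q)
    fix N :: nat and s t :: real assume N: "N \<ge> 6" and s: "\<bar>s\<bar> \<le> pi" and t: "\<bar>t\<bar> \<le> pi"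
    define A B where "A = real N * s\<^sup>2" and "B = real N ^ 3 * t\<^sup>2"
    have AB: "A \<ge> 0" "B \<ge> 0" by (auto simp: A_def B_def)
    have le: "cmod (Phi \<mu> N s t) \<le> exp (- (q * phase_defect N s t))"
      unfolding q_def using \<mu> by (intro cmod_Phi_le) auto
    have "exp (- (q * phase_defect N s t)) \<le> K * (inverse (1 + A) * inverse (1 + B))"
    proof (cases "\<bar>t\<bar> \<le> 8 / real N")
      case True
      have "(A + B) / 120000 \<le> phase_defect N s t"
        unfolding A_def B_def by (rule phase_defect_ge_quadratic[OF N s True])
      then have "q * ((A + B) / 120000) \<le> q * phase_defect N s t" using q by (intro mult_left_mono) auto
      then have "exp (- (q * phase_defect N s t)) \<le> exp (- (c * A)) * exp (- (c * B))"
        by (simp add: c_def algebra_simps add_divide_distrib flip: exp_add)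
      also have "\<dots> \<le> (max 1 (1 / c) * inverse (1 + A)) * (max 1 (1 / c) * inverse (1 + B))"
        using c AB by (intro mult_mono exp_minus_le_inverse_linear) auto
      also have "\<dots> = (max 1 (1 / c))\<^sup>2 * (inverse (1 + A) * inverse (1 + B))"
        by (simp add: power2_eq_square)
      also have "\<dots> \<le> K * (inverse (1 + A) * inverse (1 + B))"
        using AB by (intro mult_right_mono) (auto simp: K_def)
      finally show ?thesis .
    next
      case False
      have "real N / 2 \<le> phase_defect N s t"
        using False t N by (intro phase_defect_ge_linear) auto
      then have "q * (real N / 2) \<le> q * phase_defect N s t" using q by (intro mult_left_mono) auto
      then have "exp (- (q * phase_defect N s t)) \<le> exp (- (q * real N / 2))" by simp
      also have "\<dots> \<le> 256 / (q * real N / 2) ^ 4" using q N by (intro exp_minus_le_inverse_power4) auto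
      also have "\<dots> = 4096 / q ^ 4 / real N ^ 4" by (simp add: power_divide power_mult_distrib)
      also have "\<dots> \<le> K * (inverse (1 + A) * inverse (1 + B))"
      proof -
        have N1: "1 \<le> real N" using N by simp
        have sq: "x\<^sup>2 \<le> 11" if "\<bar>x\<bar> \<le> pi" for x :: real
        proof -
          have "\<bar>x\<bar>\<^sup>2 \<le> (32 / 10)\<^sup>2" using that pi_bounds by (intro power_mono) auto
          then show ?thesis by (simp add: power2_eq_square)
        qed
        have "1 + A \<le> 12 * real N"
          using mult_left_mono[OF sq[OF s], of "real N"] N1 unfolding A_def by linarith
        moreover have "1 + B \<le> 12 * real N ^ 3"
          using mult_left_mono[OF sq[OF t], of "real N ^ 3"] one_le_power[OF N1, of 3] unfolding B_def by linarith
        ultimately have "(1 + A) * (1 + B) \<le> (12 * real N) * (12 * real N ^ 3)" using AB by (intro mult_mono) auto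
        also have "\<dots> = 144 * real N ^ 4" by (simp add: eval_nat_numeral)
        finally have "(4096 / q ^ 4) * ((1 + A) * (1 + B)) \<le> (4096 / q ^ 4) * (144 * real N ^ 4)"
          using q by (intro mult_left_mono) auto
        also have "\<dots> = (144 * (4096 / q ^ 4)) * real N ^ 4" by simp
        also have "\<dots> \<le> K * real N ^ 4" by (intro mult_right_mono) (auto simp: K_def)
        finally have "(4096 / q ^ 4) * ((1 + A) * (1 + B)) \<le> K * real N ^ 4" .
        moreover have "real N ^ 4 > 0" "(1 + A) * (1 + B) > 0" using N AB by auto
        moreover have "Q / n \<le> L / x" if "Q * x \<le> L * n" "n > 0" "x > 0" for Q L n x :: real
          using that by (simp add: field_simps)
        ultimately have "4096 / q ^ 4 / real N ^ 4 \<le> K / ((1 + A) * (1 + B))" by blast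
        then show ?thesis by (simp add: divide_inverse)
      qed
      finally show ?thesis .
    qed
    with le show "cmod (Phi \<mu> N s t) \<le> K * (inverse (1 + real N * s\<^sup>2) * inverse (1 + real N ^ 3 * t\<^sup>2))"
      unfolding A_def B_def by linarith
  qed
qed

section \<open>Pointwise Gaussian approximation of the characteristic function\<close>

lemma cos_minus_quadratic_le:
  fixes u :: real
  shows "\<bar>cos u - 1 + u\<^sup>2 / 2\<bar> \<le> u ^ 4 / 24"
proof -
  obtain t where t: "cos u = (\<Sum>m<4. cos_coeff m * u ^ m) + cos (t + 1 / 2 * real 4 * pi) / fact 4 * u ^ 4"
    using Maclaurin_cos_expansion[of u 4] by blast
  have "(\<Sum>m<4. cos_coeff m * u ^ m) = 1 - u\<^sup>2 / 2"
  proof -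
    have "{..<4::nat} = {0, 1, 2, 3}" by auto
    then show ?thesis by (simp add: cos_coeff_def fact_numeral)
  qed
  then have "\<bar>cos u - 1 + u\<^sup>2 / 2\<bar> = \<bar>cos (t + 1 / 2 * real 4 * pi)\<bar> * (u ^ 4 / 24)"
    using t by (simp add: abs_mult fact_numeral)
  also have "\<dots> \<le> 1 * (u ^ 4 / 24)" by (intro mult_right_mono abs_cos_le_one) auto
  finally show ?thesis by simp
qed

lemma exp_minus_quadratic_le:
  fixes w :: real
  assumes "w \<ge> 0"
  shows "\<bar>exp (- w) - (1 - w)\<bar> \<le> w\<^sup>2"
proof -
  have "1 + w \<le> exp w" by (rule exp_ge_add_one_self)
  then have "exp (- w) \<le> inverse (1 + w)" using assms by (simp add: exp_minus le_imp_inverse_le)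
  also have "\<dots> \<le> 1 - w + w\<^sup>2" using assms by (simp add: field_simps power2_eq_square)
  finally show ?thesis using exp_ge_add_one_self[of "- w"] by simp
qed

text \<open>
  Pairing consecutive factors, whose signs alternate, cancels the drift caused by $\mu \ne 0$.
\<close>
lemma cz_pair_approx:
  fixes \<mu> s t :: real
  assumes \<mu>: "\<bar>\<mu>\<bar> \<le> 1"
  defines "u \<equiv> s + t / 2"
  shows "cmod (cz \<mu> (s / 2) * cz \<mu> (- (s + t) / 2) - of_real (exp (- ((1 - \<mu>\<^sup>2) / 4 * u\<^sup>2)))) \<le> \<bar>t\<bar> + t\<^sup>2 + 2 * u ^ 4"
proof -
  define \<delta> where "\<delta> = t / 2"
  define w where "w = (1 - \<mu>\<^sup>2) / 4 * u\<^sup>2"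
  have m2: "0 \<le> \<mu>\<^sup>2" "\<mu>\<^sup>2 \<le> 1" using \<mu> by (auto simp: abs_square_le_1)
  have m3: "(1 + \<mu>\<^sup>2) / 2 \<le> 1" "(1 - \<mu>\<^sup>2) / 2 \<le> 1"
  proof -
    have "(1 + a) / 2 \<le> 1" "(1 - a) / 2 \<le> 1" if "0 \<le> a" "a \<le> 1" for a :: real
      using that by (simp_all add: field_simps)
    then show "(1 + \<mu>\<^sup>2) / 2 \<le> 1" "(1 - \<mu>\<^sup>2) / 2 \<le> 1" using m2 by blast+
  qed
  have w0: "w \<ge> 0" using m2 by (simp add: w_def)
  define a b where "a = (u - \<delta>) / 2" and "b = (u + \<delta>) / 2"
  have ab: "a + b = u" "b - a = \<delta>" by (auto simp: a_def b_def field_simps)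
  define R where "R = cos a * cos b + \<mu>\<^sup>2 * (sin a * sin b)"
  have st: "s / 2 = a" "- (s + t) / 2 = - b"
    unfolding a_def b_def u_def \<delta>_def by (simp_all add: field_simps)
  have "cz \<mu> (s / 2) * cz \<mu> (- (s + t) / 2) = cz \<mu> a * cz \<mu> (- b)"
    unfolding st ..
  \<comment> \<open>The imaginary part sees only the difference \<delta> = t / 2 of the two half
    phases, not their sum u; so the drift of a pair is at most |t|.\<close>
  also have "\<dots> = of_real R + \<i> * of_real (- \<mu> * sin \<delta>)"
    by (simp add: cz_def R_def complex_eq_iff sin_diff ab(2)[symmetric] algebra_simps power2_eq_square)
  finally have e: "cz \<mu> (s / 2) * cz \<mu> (- (s + t) / 2) - of_real (exp (- w)) = of_real (R - exp (- w)) + \<i> * of_real (- \<mu> * sin \<delta>)"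
    by simp
  have R: "R = ((1 + \<mu>\<^sup>2) * cos \<delta> + (1 - \<mu>\<^sup>2) * cos u) / 2"
    unfolding R_def ab(1)[symmetric] ab(2)[symmetric] by (simp add: cos_add cos_diff algebra_simps)
  have R1: "R - (1 - w) = (1 + \<mu>\<^sup>2) / 2 * (cos \<delta> - 1) + (1 - \<mu>\<^sup>2) / 2 * (cos u - 1 + u\<^sup>2 / 2)"
    unfolding R w_def by (simp add: field_simps)
  have c\<delta>: "\<bar>cos \<delta> - 1\<bar> \<le> \<delta>\<^sup>2"
  proof -
    have "1 - cos \<delta> = 2 * (sin (\<delta> / 2))\<^sup>2" using cos_double_sin[of "\<delta> / 2"] by simp
    moreover have "\<bar>sin (\<delta> / 2)\<bar>\<^sup>2 \<le> \<bar>\<delta> / 2\<bar>\<^sup>2" by (intro power_mono abs_sin_x_le_abs_x) auto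
    then have "(sin (\<delta> / 2))\<^sup>2 \<le> (\<delta> / 2)\<^sup>2" by (simp only: power2_abs)
    then have "(sin (\<delta> / 2))\<^sup>2 \<le> \<delta>\<^sup>2 / 4" by (simp add: power_divide)
    moreover have "\<bar>c - 1\<bar> \<le> D" if "1 - c = 2 * S" "S \<le> D / 4" "0 \<le> S" for c S D :: real
      using that by linarith
    ultimately show ?thesis by (metis zero_le_power2)
  qed
  have u4: "0 \<le> u ^ 4" by simp
  have "\<bar>R - (1 - w)\<bar> \<le> (1 + \<mu>\<^sup>2) / 2 * \<bar>cos \<delta> - 1\<bar> + (1 - \<mu>\<^sup>2) / 2 * \<bar>cos u - 1 + u\<^sup>2 / 2\<bar>"
    unfolding R1 using m2 abs_triangle_ineq[of "(1 + \<mu>\<^sup>2) / 2 * (cos \<delta> - 1)" "(1 - \<mu>\<^sup>2) / 2 * (cos u - 1 + u\<^sup>2 / 2)"]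
    by (simp only: abs_mult) simp
  also have "\<dots> \<le> 1 * \<delta>\<^sup>2 + 1 * (u ^ 4 / 24)"
    by (intro add_mono mult_mono m3 c\<delta> cos_minus_quadratic_le) auto
  also have "\<dots> \<le> \<delta>\<^sup>2 + u ^ 4" using u4 by simp
  finally have 1: "\<bar>R - (1 - w)\<bar> \<le> \<delta>\<^sup>2 + u ^ 4" .
  have "(1 - a) / 4 \<le> 1" if "0 \<le> a" for a :: real using that by (simp add: field_simps)
  from mult_right_mono[OF this[OF m2(1)], of "u\<^sup>2"] have "w \<le> 1 * u\<^sup>2" by (simp add: w_def)
  then have "w\<^sup>2 \<le> (u\<^sup>2)\<^sup>2" using w0 by (intro power_mono) auto
  then have 2: "\<bar>exp (- w) - (1 - w)\<bar> \<le> u ^ 4" using exp_minus_quadratic_le[OF w0] by simp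
  have "\<bar>R - exp (- w)\<bar> \<le> \<delta>\<^sup>2 + 2 * u ^ 4" using 1 2 by linarith
  moreover have "\<bar>- \<mu> * sin \<delta>\<bar> \<le> 1 * \<bar>\<delta>\<bar>"
    unfolding abs_mult using \<mu> by (intro mult_mono abs_sin_x_le_abs_x) auto
  ultimately have "cmod (of_real (R - exp (- w)) + \<i> * of_real (- \<mu> * sin \<delta>)) \<le> \<delta>\<^sup>2 + 2 * u ^ 4 + \<bar>\<delta>\<bar>"
    by (intro order_trans[OF norm_triangle_ineq]) (simp add: norm_mult del: of_real_diff of_real_mult of_real_minus)
  also have "\<dots> \<le> \<bar>t\<bar> + t\<^sup>2 + 2 * u ^ 4"
  proof -
    have "t\<^sup>2 / 4 \<le> t\<^sup>2" "\<bar>t\<bar> / 2 \<le> \<bar>t\<bar>" by simp_all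
    then have "t\<^sup>2 / 4 + \<bar>t\<bar> / 2 \<le> t\<^sup>2 + \<bar>t\<bar>" by (rule add_mono)
    then show ?thesis by (simp add: \<delta>_def power_divide)
  qed
  finally show ?thesis unfolding w_def[symmetric] e .
qed

text \<open>Products of factors of modulus at most 1 differ by at most the sum of the factorwise
  differences. With s and t of orders N^(-1/2) and N^(-3/2), a pair contributes O(N^(-3/2)) through
  |t| and O(N^(-2)) through the fourth power, so M pairs still give o(1).\<close>

lemma Phi_approx:
  assumes \<mu>: "\<bar>\<mu>\<bar> \<le> 1"
  shows "cmod (Phi \<mu> (2 * M) s t - of_real (exp (- ((1 - \<mu>\<^sup>2) / 4 * (\<Sum>i<M. ((s + t / 2) + real i * (2 * t))\<^sup>2)))))
    \<le> real M * (\<bar>t\<bar> + t\<^sup>2 + 2 * (\<bar>s\<bar> + 2 * real M * \<bar>t\<bar>) ^ 4)"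
proof -
  define z where "z = (\<lambda>i. cz \<mu> ((s + real (2 * i) * t) / 2) * cz \<mu> (- ((s + real (2 * i) * t) + t) / 2))"
  define w where "w = (\<lambda>i. complex_of_real (exp (- ((1 - \<mu>\<^sup>2) / 4 * ((s + real (2 * i) * t) + t / 2)\<^sup>2))))"
  have "Phi \<mu> (2 * M) s t = (\<Prod>i<M. z i)"
    by (induction M) (simp_all add: Phi_def z_def algebra_simps)
  moreover have "of_real (exp (- ((1 - \<mu>\<^sup>2) / 4 * (\<Sum>i<M. ((s + t / 2) + real i * (2 * t))\<^sup>2)))) = (\<Prod>i<M. w i)"
  proof -
    have "(\<Sum>i<M. ((s + t / 2) + real i * (2 * t))\<^sup>2) = (\<Sum>i<M. ((s + real (2 * i) * t) + t / 2)\<^sup>2)"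
      by (rule sum.cong) (simp_all add: algebra_simps)
    then show ?thesis
      by (simp add: w_def sum_distrib_left sum_negf[symmetric] exp_sum del: of_nat_mult)
  qed
  moreover have "cmod ((\<Prod>i<M. z i) - (\<Prod>i<M. w i)) \<le> (\<Sum>i<M. cmod (z i - w i))"
  proof (rule norm_prod_diff)
    fix i
    show "cmod (z i) \<le> 1" unfolding z_def norm_mult
      using cmod_cz_le_1[OF \<mu>] by (intro mult_le_one) auto
    show "cmod (w i) \<le> 1" using \<mu> by (simp add: w_def abs_square_le_1)
  qed
  moreover have "\<dots> \<le> (\<Sum>i<M. \<bar>t\<bar> + t\<^sup>2 + 2 * (\<bar>s\<bar> + 2 * real M * \<bar>t\<bar>) ^ 4)"
  proof (rule sum_mono)
    fix i assume i: "i \<in> {..<M}"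
    let ?u = "(s + real (2 * i) * t) + t / 2"
    have "cmod (z i - w i) \<le> \<bar>t\<bar> + t\<^sup>2 + 2 * ?u ^ 4" unfolding z_def w_def by (rule cz_pair_approx[OF \<mu>])
    moreover have "?u ^ 4 \<le> (\<bar>s\<bar> + 2 * real M * \<bar>t\<bar>) ^ 4"
    proof -
      have "?u = s + (2 * real i + 1 / 2) * t" by (simp add: algebra_simps)
      then have "\<bar>?u\<bar> \<le> \<bar>s\<bar> + \<bar>(2 * real i + 1 / 2) * t\<bar>" by (simp add: abs_triangle_ineq)
      also have "\<dots> \<le> \<bar>s\<bar> + 2 * real M * \<bar>t\<bar>"
        unfolding abs_mult using i by (intro add_left_mono mult_right_mono) auto
      finally have "\<bar>?u\<bar> ^ 4 \<le> (\<bar>s\<bar> + 2 * real M * \<bar>t\<bar>) ^ 4" by (rule power_mono) simp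
      then show ?thesis by simp
    qed
    ultimately show "cmod (z i - w i) \<le> \<bar>t\<bar> + t\<^sup>2 + 2 * (\<bar>s\<bar> + 2 * real M * \<bar>t\<bar>) ^ 4" by linarith
  qed
  ultimately show ?thesis by simp
qed

lemma integrable_inverse_1_plus_square_UNIV: "integrable lborel (\<lambda>x::real. inverse (1 + x\<^sup>2))"
  using integrable_inverse_1_plus_square by (simp add: set_integrable_def)

text \<open>The substitution s = x / N^(1/2), t = y / N^(3/2), of Jacobian N^2, with indicators that
  extend the shrinking or growing square to one fixed domain for dominated convergence.\<close>

definition scaled_Phi :: "real \<Rightarrow> nat \<Rightarrow> real \<Rightarrow> real \<Rightarrow> complex" where
  "scaled_Phi \<mu> N y x = indicator {-pi..pi} (y / sqrt N ^ 3) *\<^sub>R indicator {-pi..pi} (x / sqrt N) *\<^sub>R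
     Phi \<mu> N (x / sqrt N) (y / sqrt N ^ 3)"

lemma measurable_scaled_Phi [measurable]:
  "case_prod (scaled_Phi \<mu> N) \<in> borel_measurable (borel \<Otimes>\<^sub>M borel)"
  unfolding scaled_Phi_def Phi_def cz_def by measurable

lemma measurable_scaled_Phi_snd [measurable]: "scaled_Phi \<mu> N y \<in> borel_measurable borel"
  unfolding scaled_Phi_def Phi_def cz_def by measurable

lemma scaled_Phi_integral:
  assumes N: "N > 0"
  shows "(\<integral>y. (\<integral>x. scaled_Phi \<mu> N y x \<partial>lborel) \<partial>lborel) =
    of_real ((real N)\<^sup>2) * (LINT t:{-pi..pi}|lborel. (LINT s:{-pi..pi}|lborel. Phi \<mu> N s t))"
proof -
  define r where "r = sqrt N"
  have r: "r > 0" using N by (simp add: r_def)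
  have r4: "r ^ 4 = (real N)\<^sup>2" by (simp add: r_def eval_nat_numeral)
  define F where "F = (\<lambda>t. LINT s:{-pi..pi}|lborel. Phi \<mu> N s t)"
  have inner: "(\<integral>x. indicator {-pi..pi} (x / r) *\<^sub>R Phi \<mu> N (x / r) t \<partial>lborel) = r *\<^sub>R F t" for t
    using lborel_integral_real_affine[of "1 / r" "\<lambda>s. indicator {-pi..pi} s *\<^sub>R Phi \<mu> N s t" 0] r
    by (simp add: F_def set_lebesgue_integral_def)
  have outer: "(\<integral>y. indicator {-pi..pi} (y / r ^ 3) *\<^sub>R F (y / r ^ 3) \<partial>lborel) = r ^ 3 *\<^sub>R (LINT t:{-pi..pi}|lborel. F t)"
    using lborel_integral_real_affine[of "1 / r ^ 3" "\<lambda>s. indicator {-pi..pi} s *\<^sub>R F s" 0] r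
    by (simp add: set_lebesgue_integral_def)
  have "(\<integral>y. (\<integral>x. scaled_Phi \<mu> N y x \<partial>lborel) \<partial>lborel) = (\<integral>y. r *\<^sub>R (indicator {-pi..pi} (y / r ^ 3) *\<^sub>R F (y / r ^ 3)) \<partial>lborel)"
  proof (rule Bochner_Integration.integral_cong[OF refl])
    fix y
    have "(\<integral>x. scaled_Phi \<mu> N y x \<partial>lborel) = indicator {-pi..pi} (y / r ^ 3) *\<^sub>R (r *\<^sub>R F (y / r ^ 3))"
      unfolding scaled_Phi_def r_def[symmetric] integral_scaleR_right inner ..
    then show "(\<integral>x. scaled_Phi \<mu> N y x \<partial>lborel) = r *\<^sub>R (indicator {-pi..pi} (y / r ^ 3) *\<^sub>R F (y / r ^ 3))"
      by (simp only: scaleR_left_commute)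
  qed
  also have "\<dots> = of_real (r ^ 4) * (LINT t:{-pi..pi}|lborel. F t)"
    unfolding integral_scaleR_right outer by (simp add: scaleR_conv_of_real eval_nat_numeral)
  finally show ?thesis by (simp add: r4 F_def)
qed

text \<open>There are N / 2 pairs, with phases of step 2 t, so the sum of squares tends to half of
  (x + y/2)^2 + y^2/12, the squared mean plus the variance of x + y U for U uniform on [0, 1]. This
  half turns the 4 in the exponent into 8.\<close>

lemma scaled_Phi_limit:
  fixes \<mu> x y :: real
  assumes \<mu>: "\<bar>\<mu>\<bar> < 1"
  shows "(\<lambda>k. scaled_Phi \<mu> (4 * k + 8) y x) \<longlonglongrightarrow>
    of_real (exp (- ((1 - \<mu>\<^sup>2) / 8 * ((x + y / 2)\<^sup>2 + y\<^sup>2 / 12))))"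
proof -
  define r where "r = (\<lambda>k::nat. sqrt (real (4 * k + 8)))"
  define s where "s = (\<lambda>k. x / r k)"
  define t where "t = (\<lambda>k. y / r k ^ 3)"
  \<comment> \<open>The number of pairs for N = 4 k + 8; the offset 8 keeps N at least 6, as the
    domination requires.\<close>
  define M where "M = (\<lambda>k::nat. 2 * k + 4)"
  define Q where "Q = (\<lambda>k. \<Sum>i<M k. ((s k + t k / 2) + real i * (2 * t k))\<^sup>2)"
  have r0: "r k > 0" "r k ^ 2 = real (4 * k + 8)" for k by (auto simp: r_def)
  have rinf: "filterlim r at_top sequentially" unfolding r_def by real_asymp
  have s0: "s \<longlonglongrightarrow> 0" unfolding s_def using rinf by (intro tendsto_divide_0[OF tendsto_const] filterlim_at_top_imp_at_infinity)
  have t0: "t \<longlonglongrightarrow> 0" unfolding t_def r_def by real_asymp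
  have "eventually (\<lambda>k. \<bar>s k\<bar> < pi) sequentially" using tendsto_rabs[OF s0] by (intro order_tendstoD) auto
  moreover have "eventually (\<lambda>k. \<bar>t k\<bar> < pi) sequentially" using tendsto_rabs[OF t0] by (intro order_tendstoD) auto
  ultimately have ev: "eventually (\<lambda>k. Phi \<mu> (2 * M k) (s k) (t k) = scaled_Phi \<mu> (4 * k + 8) y x) sequentially"
  proof eventually_elim
    case (elim k)
    have e: "4 * k + 8 = 2 * M k" "sqrt (real (2 * M k)) = r k" by (simp_all add: M_def r_def)
    have "s k \<in> {-pi..pi}" "t k \<in> {-pi..pi}" using elim by (auto simp: abs_less_iff)
    then have "x / r k \<in> {-pi..pi}" "y / r k ^ 3 \<in> {-pi..pi}" by (simp_all only: s_def t_def)
    then show ?case unfolding scaled_Phi_def e(1) e(2) s_def t_def by (simp only: indicator_simps) simp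
  qed
  have Qlim: "Q \<longlonglongrightarrow> ((x + y / 2)\<^sup>2 + y\<^sup>2 / 12) / 2"
  proof -
    have "Q = (\<lambda>k. (x + (1 / 2 - 1 / (2 * real (4 * k + 8))) * y)\<^sup>2 / 2 + y\<^sup>2 / 6 * (1 / 4 - 1 / (real (4 * k + 8))\<^sup>2))"
    proof
      fix k
      define R where "R = r k"
      have R: "R > 0" "R\<^sup>2 = real (4 * k + 8)" using r0 by (auto simp: R_def)
      have MR: "real (M k) = R\<^sup>2 / 2" unfolding R(2) by (simp add: M_def)
      have "Q k = real (M k) * ((s k + t k / 2) + (real (M k) - 1) * (2 * t k) / 2)\<^sup>2
        + (2 * t k)\<^sup>2 * real (M k) * ((real (M k))\<^sup>2 - 1) / 12"
        unfolding Q_def by (rule sum_square_affine)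
      also have "\<dots> = R\<^sup>2 / 2 * ((x / R + y / R ^ 3 / 2) + (R\<^sup>2 / 2 - 1) * (2 * (y / R ^ 3)) / 2)\<^sup>2
        + (2 * (y / R ^ 3))\<^sup>2 * (R\<^sup>2 / 2) * ((R\<^sup>2 / 2)\<^sup>2 - 1) / 12"
        unfolding MR by (simp add: s_def t_def R_def)
      also have "(x / R + y / R ^ 3 / 2) + (R\<^sup>2 / 2 - 1) * (2 * (y / R ^ 3)) / 2 = (x + (1 / 2 - 1 / (2 * R\<^sup>2)) * y) / R"
        using R(1) by (simp add: field_simps eval_nat_numeral)
      also have "R\<^sup>2 / 2 * ((x + (1 / 2 - 1 / (2 * R\<^sup>2)) * y) / R)\<^sup>2 = (x + (1 / 2 - 1 / (2 * R\<^sup>2)) * y)\<^sup>2 / 2"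
        using R(1) by (simp add: power_divide)
      also have "(2 * (y / R ^ 3))\<^sup>2 * (R\<^sup>2 / 2) * ((R\<^sup>2 / 2)\<^sup>2 - 1) / 12 = y\<^sup>2 / 6 * (1 / 4 - 1 / (R\<^sup>2)\<^sup>2)"
        using R(1) by (simp add: field_simps eval_nat_numeral)
      finally show "Q k = (x + (1 / 2 - 1 / (2 * real (4 * k + 8))) * y)\<^sup>2 / 2 + y\<^sup>2 / 6 * (1 / 4 - 1 / (real (4 * k + 8))\<^sup>2)"
        unfolding R(2) .
    qed
    moreover have "(\<lambda>k. (x + (1 / 2 - 1 / (2 * real (4 * k + 8))) * y)\<^sup>2 / 2 + y\<^sup>2 / 6 * (1 / 4 - 1 / (real (4 * k + 8))\<^sup>2))
      \<longlonglongrightarrow> (x + (1 / 2 - 0) * y)\<^sup>2 / 2 + y\<^sup>2 / 6 * (1 / 4 - 0)"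
    proof (intro tendsto_intros)
      show "(\<lambda>k. 1 / (2 * real (4 * k + 8))) \<longlonglongrightarrow> 0" by real_asymp
      show "(\<lambda>k. 1 / (real (4 * k + 8))\<^sup>2) \<longlonglongrightarrow> 0" by real_asymp
    qed auto
    ultimately show ?thesis by (simp add: add_divide_distrib)
  qed
  have err: "(\<lambda>k. real (M k) * (\<bar>t k\<bar> + (t k)\<^sup>2 + 2 * (\<bar>s k\<bar> + 2 * real (M k) * \<bar>t k\<bar>) ^ 4)) \<longlonglongrightarrow> 0"
  proof -
    have "(\<lambda>k. real (M k) * (\<bar>t k\<bar> + (t k)\<^sup>2 + 2 * (\<bar>s k\<bar> + 2 * real (M k) * \<bar>t k\<bar>) ^ 4)) =
      (\<lambda>k. \<bar>y\<bar> / 2 * (1 / r k) + y\<^sup>2 / 2 * (1 / r k ^ 4) + (\<bar>x\<bar> + \<bar>y\<bar>) ^ 4 * (1 / (r k)\<^sup>2))"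
    proof
      fix k
      define R where "R = r k"
      have R: "R > 0" "R\<^sup>2 = real (4 * k + 8)" using r0 by (auto simp: R_def)
      have MR: "real (M k) = R\<^sup>2 / 2" unfolding R(2) by (simp add: M_def)
      have "\<bar>s k\<bar> + 2 * real (M k) * \<bar>t k\<bar> = (\<bar>x\<bar> + \<bar>y\<bar>) / R"
        unfolding MR s_def t_def R_def[symmetric] using R(1) by (simp add: abs_divide field_simps eval_nat_numeral)
      moreover have "\<bar>t k\<bar> = \<bar>y\<bar> / R ^ 3" "(t k)\<^sup>2 = y\<^sup>2 / R ^ 6"
        unfolding t_def R_def[symmetric] using R(1) by (simp_all add: abs_divide power_divide)
      ultimately show "real (M k) * (\<bar>t k\<bar> + (t k)\<^sup>2 + 2 * (\<bar>s k\<bar> + 2 * real (M k) * \<bar>t k\<bar>) ^ 4) =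
        \<bar>y\<bar> / 2 * (1 / r k) + y\<^sup>2 / 2 * (1 / r k ^ 4) + (\<bar>x\<bar> + \<bar>y\<bar>) ^ 4 * (1 / (r k)\<^sup>2)"
        unfolding MR R_def[symmetric] using R(1) by (simp add: power_divide distrib_left) (simp add: field_simps eval_nat_numeral)
    qed
    moreover have "(\<lambda>k. \<bar>y\<bar> / 2 * (1 / r k) + y\<^sup>2 / 2 * (1 / r k ^ 4) + (\<bar>x\<bar> + \<bar>y\<bar>) ^ 4 * (1 / (r k)\<^sup>2)) \<longlonglongrightarrow>
      \<bar>y\<bar> / 2 * 0 + y\<^sup>2 / 2 * 0 + (\<bar>x\<bar> + \<bar>y\<bar>) ^ 4 * 0"
    proof (intro tendsto_intros)
      show "(\<lambda>k. 1 / r k) \<longlonglongrightarrow> 0" unfolding r_def by real_asymp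
      show "(\<lambda>k. 1 / r k ^ 4) \<longlonglongrightarrow> 0" unfolding r_def by real_asymp
      show "(\<lambda>k. 1 / (r k)\<^sup>2) \<longlonglongrightarrow> 0" unfolding r_def by real_asymp
    qed
    ultimately show ?thesis by simp
  qed
  have "(\<lambda>k. Phi \<mu> (2 * M k) (s k) (t k) - of_real (exp (- ((1 - \<mu>\<^sup>2) / 4 * Q k)))) \<longlonglongrightarrow> 0"
  proof (rule Lim_null_comparison[OF _ err])
    show "eventually (\<lambda>k. cmod (Phi \<mu> (2 * M k) (s k) (t k) - of_real (exp (- ((1 - \<mu>\<^sup>2) / 4 * Q k))))
      \<le> real (M k) * (\<bar>t k\<bar> + (t k)\<^sup>2 + 2 * (\<bar>s k\<bar> + 2 * real (M k) * \<bar>t k\<bar>) ^ 4)) sequentially"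
      unfolding Q_def using \<mu> by (intro always_eventually allI Phi_approx) auto
  qed
  moreover have "(\<lambda>k. complex_of_real (exp (- ((1 - \<mu>\<^sup>2) / 4 * Q k)))) \<longlonglongrightarrow>
    of_real (exp (- ((1 - \<mu>\<^sup>2) / 4 * (((x + y / 2)\<^sup>2 + y\<^sup>2 / 12) / 2))))"
    by (intro tendsto_intros Qlim)
  ultimately have "(\<lambda>k. (Phi \<mu> (2 * M k) (s k) (t k) - of_real (exp (- ((1 - \<mu>\<^sup>2) / 4 * Q k)))) + of_real (exp (- ((1 - \<mu>\<^sup>2) / 4 * Q k))))
    \<longlonglongrightarrow> 0 + of_real (exp (- ((1 - \<mu>\<^sup>2) / 4 * (((x + y / 2)\<^sup>2 + y\<^sup>2 / 12) / 2))))"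
    by (rule tendsto_add)
  then have "(\<lambda>k. Phi \<mu> (2 * M k) (s k) (t k)) \<longlonglongrightarrow> of_real (exp (- ((1 - \<mu>\<^sup>2) / 8 * ((x + y / 2)\<^sup>2 + y\<^sup>2 / 12))))"
    by simp
  then show ?thesis by (rule Lim_transform_eventually[OF _ ev])
qed

text \<open>Dominated convergence, first in x and then in y. With \<kappa> = (1 - \<mu>^2) / 8 the
  limit is a Gaussian in x of curvature \<kappa> centred at -y/2 times one in y of curvature
  \<kappa> / 12, which integrate to pi sqrt 12 / \<kappa>.\<close>

lemma Phi_integral_limit:
  assumes \<mu>: "\<bar>\<mu>\<bar> < 1"
  shows "(\<lambda>k. of_real ((real (4 * k + 8))\<^sup>2) * (LINT t:{-pi..pi}|lborel. (LINT s:{-pi..pi}|lborel. Phi \<mu> (4 * k + 8) s t)))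
    \<longlonglongrightarrow> complex_of_real (16 * sqrt 3 * pi / (1 - \<mu>\<^sup>2))"
proof -
  define \<kappa> where "\<kappa> = (1 - \<mu>\<^sup>2) / 8"
  have \<kappa>: "\<kappa> > 0" using \<mu> by (simp add: \<kappa>_def abs_square_less_1)
  obtain K where K: "K > 0" and dom: "\<And>N s t. N \<ge> 6 \<Longrightarrow> \<bar>s\<bar> \<le> pi \<Longrightarrow> \<bar>t\<bar> \<le> pi \<Longrightarrow>
    cmod (Phi \<mu> N s t) \<le> K * (inverse (1 + real N * s\<^sup>2) * inverse (1 + real N ^ 3 * t\<^sup>2))"
    by (rule cmod_Phi_dominated[OF \<mu>]; rule that; blast)
  have bound: "cmod (scaled_Phi \<mu> N y x) \<le> K * inverse (1 + y\<^sup>2) * inverse (1 + x\<^sup>2)" if N: "N \<ge> 6" for N y x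
  proof (cases "\<bar>x / sqrt N\<bar> \<le> pi \<and> \<bar>y / sqrt N ^ 3\<bar> \<le> pi")
    case True
    have e: "real N * (x / sqrt N)\<^sup>2 = x\<^sup>2" using N by (simp add: power_divide)
    have "(sqrt N ^ 3)\<^sup>2 = real N ^ 3" by (simp add: eval_nat_numeral)
    then have e': "real N ^ 3 * (y / sqrt N ^ 3)\<^sup>2 = y\<^sup>2" using N by (simp add: power_divide)
    have "cmod (scaled_Phi \<mu> N y x) \<le> cmod (Phi \<mu> N (x / sqrt N) (y / sqrt N ^ 3))"
      by (simp add: scaled_Phi_def indicator_def)
    also have "\<dots> \<le> K * (inverse (1 + x\<^sup>2) * inverse (1 + y\<^sup>2))"
      using dom[OF N, of "x / sqrt N" "y / sqrt N ^ 3"] True unfolding e e' by blast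
    finally show ?thesis by (simp add: mult_ac)
  next
    case False
    then have "scaled_Phi \<mu> N y x = 0" by (auto simp: scaled_Phi_def indicator_def abs_le_iff)
    then show ?thesis using K by simp
  qed
  have K1: "K * inverse (1 + y\<^sup>2) \<ge> 0" for y :: real using K by simp
  define H where "H = (\<lambda>y. complex_of_real (exp (- (\<kappa> / 12 * (y - 0)\<^sup>2)) * sqrt (pi / \<kappa>)))"
  have inner: "(\<lambda>k. \<integral>x. scaled_Phi \<mu> (4 * k + 8) y x \<partial>lborel) \<longlonglongrightarrow> H y" for y
  proof -
    have "(\<lambda>k. \<integral>x. scaled_Phi \<mu> (4 * k + 8) y x \<partial>lborel) \<longlonglongrightarrow>
      (\<integral>x. complex_of_real (exp (- (\<kappa> * ((x + y / 2)\<^sup>2 + y\<^sup>2 / 12)))) \<partial>lborel)"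
    proof (rule integral_dominated_convergence[where w = "\<lambda>x. K * inverse (1 + y\<^sup>2) * inverse (1 + x\<^sup>2)"])
      show "integrable lborel (\<lambda>x. K * inverse (1 + y\<^sup>2) * inverse (1 + x\<^sup>2))"
        by (intro integrable_mult_right integrable_inverse_1_plus_square_UNIV)
      show "AE x in lborel. (\<lambda>k. scaled_Phi \<mu> (4 * k + 8) y x) \<longlonglongrightarrow> complex_of_real (exp (- (\<kappa> * ((x + y / 2)\<^sup>2 + y\<^sup>2 / 12))))"
        unfolding \<kappa>_def using scaled_Phi_limit[OF \<mu>] by (intro AE_I2) blast
      show "AE x in lborel. cmod (scaled_Phi \<mu> (4 * k + 8) y x) \<le> K * inverse (1 + y\<^sup>2) * inverse (1 + x\<^sup>2)" for k
        by (intro AE_I2 bound) simp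
    qed simp_all
    also have "(\<integral>x. complex_of_real (exp (- (\<kappa> * ((x + y / 2)\<^sup>2 + y\<^sup>2 / 12)))) \<partial>lborel) = H y"
    proof -
      have "exp (- (\<kappa> * ((x + y / 2)\<^sup>2 + y\<^sup>2 / 12))) = exp (- (\<kappa> / 12 * (y - 0)\<^sup>2)) * exp (- (\<kappa> * (x - (- y / 2))\<^sup>2))" for x
        by (simp add: algebra_simps flip: exp_add)
      then have "(\<integral>x. exp (- (\<kappa> * ((x + y / 2)\<^sup>2 + y\<^sup>2 / 12))) \<partial>lborel) = exp (- (\<kappa> / 12 * (y - 0)\<^sup>2)) * sqrt (pi / \<kappa>)"
        using gaussian_integral(2)[OF \<kappa>, of "- y / 2"] by simp
      then show ?thesis unfolding H_def integral_complex_of_real by simp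
    qed
    finally show ?thesis .
  qed
  have "(\<lambda>k. \<integral>y. (\<integral>x. scaled_Phi \<mu> (4 * k + 8) y x \<partial>lborel) \<partial>lborel) \<longlonglongrightarrow> (\<integral>y. H y \<partial>lborel)"
  proof (rule integral_dominated_convergence[where w = "\<lambda>y. (K * inverse (1 + y\<^sup>2)) * (\<integral>x. inverse (1 + x\<^sup>2) \<partial>lborel)"])
    show "integrable lborel (\<lambda>y. (K * inverse (1 + y\<^sup>2)) * (\<integral>x. inverse (1 + x\<^sup>2) \<partial>lborel))"
      by (intro integrable_mult_left integrable_mult_right integrable_inverse_1_plus_square_UNIV)
    show "AE y in lborel. (\<lambda>k. \<integral>x. scaled_Phi \<mu> (4 * k + 8) y x \<partial>lborel) \<longlonglongrightarrow> H y"
      using inner by (intro AE_I2) blast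
    show "AE y in lborel. cmod (\<integral>x. scaled_Phi \<mu> (4 * k + 8) y x \<partial>lborel) \<le> (K * inverse (1 + y\<^sup>2)) * (\<integral>x. inverse (1 + x\<^sup>2) \<partial>lborel)" for k
    proof (rule AE_I2)
      fix y :: real
      have int: "integrable lborel (\<lambda>x. K * inverse (1 + y\<^sup>2) * inverse (1 + x\<^sup>2))"
        by (intro integrable_mult_right integrable_inverse_1_plus_square_UNIV)
      have "cmod (\<integral>x. scaled_Phi \<mu> (4 * k + 8) y x \<partial>lborel) \<le> (\<integral>x. K * inverse (1 + y\<^sup>2) * inverse (1 + x\<^sup>2) \<partial>lborel)"
      proof (rule Bochner_Integration.integral_norm_bound_integral[OF Bochner_Integration.integrable_bound[OF int] int])
        show b: "cmod (scaled_Phi \<mu> (4 * k + 8) y x) \<le> K * inverse (1 + y\<^sup>2) * inverse (1 + x\<^sup>2)" for x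
          by (rule bound) simp
        show "AE x in lborel. cmod (scaled_Phi \<mu> (4 * k + 8) y x) \<le> norm (K * inverse (1 + y\<^sup>2) * inverse (1 + x\<^sup>2))"
          by (intro AE_I2 order_trans[OF b]) simp
      qed simp
      then show "cmod (\<integral>x. scaled_Phi \<mu> (4 * k + 8) y x \<partial>lborel) \<le> (K * inverse (1 + y\<^sup>2)) * (\<integral>x. inverse (1 + x\<^sup>2) \<partial>lborel)"
        by simp
    qed
  qed (simp_all add: H_def)
  also have "(\<integral>y. H y \<partial>lborel) = complex_of_real (16 * sqrt 3 * pi / (1 - \<mu>\<^sup>2))"
  proof -
    have k12: "\<kappa> / 12 > 0" using \<kappa> by simp
    have "(\<integral>y. H y \<partial>lborel) = of_real (sqrt (pi / (\<kappa> / 12)) * sqrt (pi / \<kappa>))"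
      unfolding H_def integral_complex_of_real using gaussian_integral(2)[OF k12, of 0] by simp
    also have "sqrt (pi / (\<kappa> / 12)) * sqrt (pi / \<kappa>) = 16 * sqrt 3 * pi / (1 - \<mu>\<^sup>2)"
    proof -
      have "sqrt (pi / (\<kappa> / 12)) * sqrt (pi / \<kappa>) = sqrt (12 * (pi / \<kappa>)\<^sup>2)"
        by (simp add: real_sqrt_mult[symmetric] power2_eq_square)
      also have "\<dots> = sqrt (2\<^sup>2 * 3) * (pi / \<kappa>)" using \<kappa> by (simp add: real_sqrt_mult)
      also have "\<dots> = 2 * sqrt 3 * (pi / \<kappa>)" by (simp only: real_sqrt_mult real_sqrt_abs abs_numeral)
      finally show ?thesis by (simp add: \<kappa>_def)
    qed
    finally show ?thesis .
  qed
  finally show ?thesis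
    using scaled_Phi_integral[of "4 * _ + 8" \<mu>] by simp
qed

subsection \<open>Double roots at 1 and -1\<close>

lemma integral_fourier_sum:
  fixes k :: "'a \<Rightarrow> int"
  assumes "finite A"
  shows "(LINT s:{-pi..pi}|lborel. (\<Sum>a\<in>A. c a * cis (of_int (k a) * s))) = (\<Sum>a\<in>A. c a * (if k a = 0 then 2 * pi else 0))"
proof -
  have "(LINT s:{-pi..pi}|lborel. (\<Sum>a\<in>A. c a * cis (of_int (k a) * s))) =
    (LINT s|lborel. (\<Sum>a\<in>A. c a * (indicator {-pi..pi} s *\<^sub>R cis (of_int (k a) * s))))"
    unfolding set_lebesgue_integral_def by (simp add: scaleR_sum_right)
  also have "\<dots> = (\<Sum>a\<in>A. (LINT s|lborel. c a * (indicator {-pi..pi} s *\<^sub>R cis (of_int (k a) * s))))"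
    using integrable_cis_interval[unfolded set_integrable_def]
    by (intro Bochner_Integration.integral_sum integrable_mult_right) auto
  also have "\<dots> = (\<Sum>a\<in>A. c a * (if k a = 0 then 2 * pi else 0))"
    by (simp only: integral_mult_right_zero integral_cis_int[unfolded set_lebesgue_integral_def])
  finally show ?thesis .
qed

lemma prob_eq_double_fourier_integral:
  fixes X Y :: "'a \<Rightarrow> int"
  assumes p: "finite (set_pmf p)"
  shows "complex_of_real ((2 * pi)\<^sup>2 * measure_pmf.prob p {a. X a = 0 \<and> Y a = 0}) =
    (LINT t:{-pi..pi}|lborel. (LINT s:{-pi..pi}|lborel.
      measure_pmf.expectation p (\<lambda>a. cis (of_int (X a) * s + of_int (Y a) * t))))"
proof -
  have E: "measure_pmf.expectation p (\<lambda>a. cis (of_int (X a) * s + of_int (Y a) * t)) =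
    (\<Sum>a\<in>set_pmf p. (of_real (pmf p a) * cis (of_int (Y a) * t)) * cis (of_int (X a) * s))" for s t
  proof -
    have "measure_pmf.expectation p (\<lambda>a. cis (of_int (X a) * s + of_int (Y a) * t)) =
      (\<Sum>a\<in>set_pmf p. pmf p a *\<^sub>R cis (of_int (X a) * s + of_int (Y a) * t))"
      by (rule integral_measure_pmf) (use p in auto)
    then show ?thesis by (simp add: scaleR_conv_of_real cis_mult mult.assoc add.commute)
  qed
  define c where "c = (\<lambda>a. complex_of_real (pmf p a * (if X a = 0 then 2 * pi else 0)))"
  have inner: "(LINT s:{-pi..pi}|lborel. measure_pmf.expectation p (\<lambda>a. cis (of_int (X a) * s + of_int (Y a) * t))) =
      (\<Sum>a\<in>set_pmf p. c a * cis (of_int (Y a) * t))" for t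
    unfolding E integral_fourier_sum[OF p] c_def by (intro sum.cong) (auto simp: mult_ac)
  have "(LINT t:{-pi..pi}|lborel. (LINT s:{-pi..pi}|lborel.
      measure_pmf.expectation p (\<lambda>a. cis (of_int (X a) * s + of_int (Y a) * t)))) =
    (\<Sum>a\<in>set_pmf p. c a * (if Y a = 0 then 2 * pi else 0))"
    unfolding inner by (rule integral_fourier_sum[OF p])
  also have "\<dots> = complex_of_real ((2 * pi)\<^sup>2 * (\<Sum>a\<in>set_pmf p. pmf p a * (if X a = 0 \<and> Y a = 0 then 1 else 0)))"
    unfolding sum_distrib_left of_real_sum c_def by (intro sum.cong) (auto simp: power2_eq_square)
  finally show ?thesis by (simp add: prob_eq_sum_support[OF p])
qed

lemma sum_int_lessThan_double: "(\<Sum>j<2 * m. int j) = int m * (2 * int m - 1)"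
  by (induction m) (simp_all add: algebra_simps)

lemma signed_sums_parity:
  fixes \<epsilon> a :: "nat \<Rightarrow> int"
  assumes "\<And>j. j < N \<Longrightarrow> a j \<in> {-1, 1}" "\<And>j. \<epsilon> j \<in> {-1, 1}"
  shows "even ((\<Sum>j<N. \<epsilon> j * a j) - int N)" "even ((\<Sum>j<N. int j * \<epsilon> j * a j) - (\<Sum>j<N. int j))"
proof -
  have e: "even (\<epsilon> j * a j - 1)" if "j < N" for j
  proof -
    have "\<epsilon> j = 1 \<or> \<epsilon> j = -1" "a j = 1 \<or> a j = -1" using assms(1)[OF that] assms(2)[of j] by auto
    then show ?thesis by auto
  qed
  have "(\<Sum>j<N. \<epsilon> j * a j) - int N = (\<Sum>j<N. \<epsilon> j * a j - 1)" by (simp add: sum_subtractf)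
  then show "even ((\<Sum>j<N. \<epsilon> j * a j) - int N)" by (simp only:) (rule dvd_sum, rule e, simp)
  have "(\<Sum>j<N. int j * \<epsilon> j * a j) - (\<Sum>j<N. int j) = (\<Sum>j<N. int j * (\<epsilon> j * a j - 1))"
    by (simp add: sum_subtractf algebra_simps)
  then show "even ((\<Sum>j<N. int j * \<epsilon> j * a j) - (\<Sum>j<N. int j))"
    by (simp only:) (rule dvd_sum, rule dvd_mult, rule e, simp)
qed

text \<open>All signed terms are odd, so the two sums have the parities of N and of 0 + ... + (N -
  1). With N = 2 m the latter is m (2 m - 1), which is even only if m is.\<close>

lemma signed_sums_zero_imp_4_dvd:
  fixes \<epsilon> a :: "nat \<Rightarrow> int"
  assumes "\<And>j. j < N \<Longrightarrow> a j \<in> {-1, 1}" "\<And>j. \<epsilon> j \<in> {-1, 1}"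
    and z: "(\<Sum>j<N. \<epsilon> j * a j) = 0" "(\<Sum>j<N. int j * \<epsilon> j * a j) = 0"
  shows "4 dvd N"
proof -
  note par = signed_sums_parity[of N a \<epsilon>, OF assms(1,2), unfolded z]
  have "even N" using par(1) by simp
  then obtain m where m: "N = 2 * m" by auto
  have "even (int m * (2 * int m - 1))" using par(2) unfolding m sum_int_lessThan_double by simp
  then have "even m" by simp
  then show ?thesis using m by auto
qed

text \<open>When 4 divides N both sums are even on the support, so Fourier inversion is applied to
  their halves; hence the division by 2 in the phases.\<close>

lemma prob_signed_sums_zero:
  fixes \<epsilon> :: "nat \<Rightarrow> int"
  assumes supp: "set_pmf d \<subseteq> {-1, 1}" and N: "4 dvd N" and \<epsilon>: "\<And>j. \<epsilon> j \<in> {-1, 1}"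
  shows "complex_of_real ((2 * pi)\<^sup>2 * iid_prob d {..<N} {a. (\<Sum>j<N. \<epsilon> j * a j) = 0 \<and> (\<Sum>j<N. int j * \<epsilon> j * a j) = 0}) =
    (LINT t:{-pi..pi}|lborel. (LINT s:{-pi..pi}|lborel. (\<Prod>j<N. cf d (of_int (\<epsilon> j) * (s + real j * t) / 2))))"
proof -
  have fd: "finite (set_pmf d)" using supp finite_subset by blast
  have fs: "finite (set_pmf (iid d {..<N}))" by (rule finite_set_iid) (use fd in auto)
  define X where "X = (\<lambda>a :: nat \<Rightarrow> int. (\<Sum>j<N. \<epsilon> j * a j))"
  define Y where "Y = (\<lambda>a :: nat \<Rightarrow> int. (\<Sum>j<N. int j * \<epsilon> j * a j))"
  obtain k where k: "N = 4 * k" using N by auto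
  have ev: "even (X a) \<and> even (Y a)" if a: "a \<in> set_pmf (iid d {..<N})" for a
  proof -
    have "a j \<in> {-1, 1}" if "j < N" for j using iid_value_in_support[OF _ a, of j] that supp by auto
    note par = signed_sums_parity[of N a \<epsilon>, OF this \<epsilon>]
    have "even (\<Sum>j<N. int j)" using sum_int_lessThan_double[of "2 * k"] by (simp add: k mult.assoc[symmetric])
    moreover have "even (int N)" by (simp add: k)
    ultimately show ?thesis using par unfolding X_def Y_def by simp
  qed
  have half: "real_of_int (X a div 2) = X a / 2" "real_of_int (Y a div 2) = Y a / 2" if a: "a \<in> set_pmf (iid d {..<N})" for a
    using ev[OF a] by (auto simp: real_of_int_div)
  have "{a. X a = 0 \<and> Y a = 0} \<inter> set_pmf (iid d {..<N}) = {a. X a div 2 = 0 \<and> Y a div 2 = 0} \<inter> set_pmf (iid d {..<N})"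
  proof -
    have "X a = 0 \<longleftrightarrow> X a div 2 = 0" "Y a = 0 \<longleftrightarrow> Y a div 2 = 0" if "a \<in> set_pmf (iid d {..<N})" for a
    proof -
      have "2 * (X a div 2) = X a" "2 * (Y a div 2) = Y a" using ev[OF that] by (simp_all only: dvd_mult_div_cancel)
      then show "X a = 0 \<longleftrightarrow> X a div 2 = 0" "Y a = 0 \<longleftrightarrow> Y a div 2 = 0"
        by (metis mult_zero_right div_0)+
    qed
    then show ?thesis by fast
  qed
  then have "iid_prob d {..<N} {a. X a = 0 \<and> Y a = 0} = iid_prob d {..<N} {a. X a div 2 = 0 \<and> Y a div 2 = 0}"
    using prob_pmf_cong_support[of "iid d {..<N}" "{a. X a = 0 \<and> Y a = 0}"]
      prob_pmf_cong_support[of "iid d {..<N}" "{a. X a div 2 = 0 \<and> Y a div 2 = 0}"] by (simp only:)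
  moreover have "measure_pmf.expectation (iid d {..<N}) (\<lambda>a. cis (of_int (X a div 2) * s + of_int (Y a div 2) * t)) =
      (\<Prod>j<N. cf d (of_int (\<epsilon> j) * (s + real j * t) / 2))" for s t
  proof -
    have "measure_pmf.expectation (iid d {..<N}) (\<lambda>a. cis (of_int (X a div 2) * s + of_int (Y a div 2) * t)) =
      measure_pmf.expectation (iid d {..<N}) (\<lambda>a. \<Prod>j<N. cis (of_int (\<epsilon> j) * (s + real j * t) / 2 * of_int (a j)))"
    proof (intro integral_cong_AE AE_pmfI)
      fix a assume a: "a \<in> set_pmf (iid d {..<N})"
      have "of_int (X a div 2) * s + of_int (Y a div 2) * t = (\<Sum>j<N. of_int (\<epsilon> j) * (s + real j * t) / 2 * of_int (a j))"
        unfolding half[OF a] unfolding X_def Y_def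
        by (simp add: sum_distrib_right sum_divide_distrib flip: sum.distrib) (intro sum.cong, auto simp: field_simps)
      then show "cis (of_int (X a div 2) * s + of_int (Y a div 2) * t) = (\<Prod>j<N. cis (of_int (\<epsilon> j) * (s + real j * t) / 2 * of_int (a j)))"
        by (simp only: cis_sum)
    qed simp_all
    also have "\<dots> = (\<Prod>j<N. cf d (of_int (\<epsilon> j) * (s + real j * t) / 2))"
      unfolding cf_def by (rule expectation_iid_prod[OF _ fd]) simp
    finally show ?thesis .
  qed
  ultimately show ?thesis
    using prob_eq_double_fourier_integral[OF fs, of "\<lambda>a. X a div 2" "\<lambda>a. Y a div 2"] by (simp add: X_def Y_def)
qed

lemma double_root_at_sign_iff:
  assumes w: "w \<in> {1, -1 :: int}"
  shows "double_root_at n (of_int w) a \<longleftrightarrow> (\<Sum>j<n + 1. w ^ j * a j) = 0 \<and> (\<Sum>j<n + 1. int j * w ^ j * a j) = 0"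
proof -
  have w0: "complex_of_int w \<noteq> 0" using w by auto
  have "poly (pderiv (cpoly (int_poly n a))) (of_int w) = 0 \<longleftrightarrow> (\<Sum>j\<le>n. of_nat j * of_int (a j) * complex_of_int w ^ j) = 0"
    using w0 unfolding poly_pderiv_int_poly[symmetric] by simp
  also have "(\<Sum>j\<le>n. of_nat j * of_int (a j) * complex_of_int w ^ j) = of_int (\<Sum>j<n + 1. int j * w ^ j * a j)"
    by (simp add: mult_ac flip: lessThan_Suc_atMost)
  finally have 1: "poly (pderiv (cpoly (int_poly n a))) (of_int w) = 0 \<longleftrightarrow> (\<Sum>j<n + 1. int j * w ^ j * a j) = 0"
    by (simp only: of_int_eq_0_iff)
  have "poly (cpoly (int_poly n a)) (of_int w) = of_int (\<Sum>j<n + 1. w ^ j * a j)"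
    by (simp add: poly_int_poly mult_ac flip: lessThan_Suc_atMost)
  then have "poly (cpoly (int_poly n a)) (of_int w) = 0 \<longleftrightarrow> (\<Sum>j<n + 1. w ^ j * a j) = 0"
    by (simp only: of_int_eq_0_iff)
  with 1 show ?thesis by (simp only: double_root_at_def)
qed

definition mean :: "int pmf \<Rightarrow> real" where
  "mean d = pmf d 1 - pmf d (-1)"

lemma expectation_variance_sign:
  assumes supp: "set_pmf d \<subseteq> {-1, 0, 1}" and p0: "pmf d 0 = 0"
  shows "measure_pmf.expectation d real_of_int = mean d" "measure_pmf.variance d real_of_int = 1 - (mean d)\<^sup>2"
proof -
  have E: "measure_pmf.expectation d f = f (-1) * pmf d (-1) + f 1 * pmf d 1" for f :: "int \<Rightarrow> real"
  proof -
    have "measure_pmf.expectation d f = (\<Sum>x\<in>{-1, 0, 1}. f x * pmf d x)"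
      by (rule integral_measure_pmf_real) (use supp in auto)
    then show ?thesis by (simp add: p0)
  qed
  show e: "measure_pmf.expectation d real_of_int = mean d" by (simp add: E mean_def)
  have s: "pmf d (-1) = 1 - pmf d 1" using pmf_ternary_sum[OF supp] p0 by simp
  show "measure_pmf.variance d real_of_int = 1 - (mean d)\<^sup>2"
    unfolding e unfolding E mean_def s by (simp add: power2_eq_square algebra_simps)
qed

section \<open>Distributions carried by 1 and -1\<close>

context
  fixes d :: "int pmf"
  assumes supp: "set_pmf d \<subseteq> {-1, 0, 1}" and lt1: "\<And>x. pmf d x < 1" and p0: "pmf d 0 = 0"
begin

lemma supp_sign: "set_pmf d \<subseteq> {-1, 1}"
  using supp p0 by (auto simp: set_pmf_eq)

lemma abs_mean_less_1: "\<bar>mean d\<bar> < 1"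
  using pmf_ternary_sum[OF supp] p0 lt1[of 1] lt1[of "-1"] unfolding mean_def by (simp add: abs_less_iff)

lemma cf_eq_cz: "cf d v = cz (mean d) v"
  using pmf_ternary_sum[OF supp] p0
  by (simp add: cf_ternary[OF supp] cz_def complex_eq_iff mean_def add.commute)

lemma prob_double_root_sign:
  assumes w: "w \<in> {1, -1 :: int}" and N: "4 dvd n + 1"
  shows "complex_of_real ((2 * pi)\<^sup>2 * iid_prob d {..n} {a. double_root_at n (of_int w) a}) =
    (LINT t:{-pi..pi}|lborel. (LINT s:{-pi..pi}|lborel. (\<Prod>j<n + 1. cz (mean d) (of_int (w ^ j) * (s + real j * t) / 2))))"
proof -
  have "w ^ j \<in> {-1, 1}" for j using w by (cases "even j") auto
  from prob_signed_sums_zero[OF supp_sign N this] show ?thesis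
    unfolding double_root_at_sign_iff[OF w] cf_eq_cz by (simp add: lessThan_Suc_atMost)
qed

lemma prob_double_root_sign_0:
  assumes w: "w \<in> {1, -1 :: int}" and N: "\<not> 4 dvd n + 1"
  shows "iid_prob d {..n} {a. double_root_at n (of_int w) a} = 0"
proof -
  have "{a. double_root_at n (of_int w) a} \<inter> set_pmf (iid d {..n}) = {}"
  proof (rule ccontr)
    assume "\<not> ?thesis"
    then obtain a where a: "double_root_at n (of_int w) a" "a \<in> set_pmf (iid d {..n})" by blast
    have "a j \<in> {-1, 1}" if "j < n + 1" for j
      using iid_value_in_support[OF _ a(2), of j] that supp_sign by auto
    moreover have "w ^ j \<in> {-1, 1}" for j using w by (cases "even j") auto
    ultimately have "4 dvd n + 1"
      using a(1) unfolding double_root_at_sign_iff[OF w] by (intro signed_sums_zero_imp_4_dvd[of "n + 1" a "\<lambda>j. w ^ j"]) auto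
    with N show False by simp
  qed
  then show ?thesis by (subst prob_pmf_cong_support) simp
qed

text \<open>The Fourier limit 16 sqrt 3 pi / (1 - mean^2) is divided by (2 pi)^2. A polynomial with
  n = 4 k + 7 has N = n + 1 = 4 k + 8 coefficients.\<close>

lemma prob_double_root_minus_1_limit:
  "(\<lambda>k. (real (4 * k + 8))\<^sup>2 * iid_prob d {..4 * k + 7} {a. double_root_at (4 * k + 7) (-1) a})
    \<longlonglongrightarrow> 4 * sqrt 3 / (pi * (1 - (mean d)\<^sup>2))"
proof -
  let ?P = "\<lambda>k. iid_prob d {..4 * k + 7} {a. double_root_at (4 * k + 7) (-1) a}"
  have "of_real ((real (4 * k + 8))\<^sup>2) * (LINT t:{-pi..pi}|lborel. (LINT s:{-pi..pi}|lborel. Phi (mean d) (4 * k + 8) s t))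
    = complex_of_real ((2 * pi)\<^sup>2 * ((real (4 * k + 8))\<^sup>2 * ?P k))" for k
  proof -
    have "complex_of_real ((2 * pi)\<^sup>2 * ?P k) = (LINT t:{-pi..pi}|lborel. (LINT s:{-pi..pi}|lborel. Phi (mean d) (4 * k + 8) s t))"
      using prob_double_root_sign[of "-1" "4 * k + 7"] by (simp add: Phi_def add.commute)
    then show ?thesis by (simp flip: of_real_mult) (simp add: mult_ac)
  qed
  then have "(\<lambda>k. of_real ((real (4 * k + 8))\<^sup>2) * (LINT t:{-pi..pi}|lborel. (LINT s:{-pi..pi}|lborel. Phi (mean d) (4 * k + 8) s t)))
    = (\<lambda>k. complex_of_real ((2 * pi)\<^sup>2 * ((real (4 * k + 8))\<^sup>2 * ?P k)))" by (rule ext)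
  from Phi_integral_limit[OF abs_mean_less_1, unfolded this]
  have "(\<lambda>k. complex_of_real ((2 * pi)\<^sup>2 * ((real (4 * k + 8))\<^sup>2 * ?P k))) \<longlonglongrightarrow> complex_of_real (16 * sqrt 3 * pi / (1 - (mean d)\<^sup>2))" .
  then have "(\<lambda>k. (2 * pi)\<^sup>2 * ((real (4 * k + 8))\<^sup>2 * ?P k)) \<longlonglongrightarrow> 16 * sqrt 3 * pi / (1 - (mean d)\<^sup>2)"
    by (simp only: tendsto_of_real_iff)
  then have "(\<lambda>k. (2 * pi)\<^sup>2 * ((real (4 * k + 8))\<^sup>2 * ?P k) / (2 * pi)\<^sup>2) \<longlonglongrightarrow> 16 * sqrt 3 * pi / (1 - (mean d)\<^sup>2) / (2 * pi)\<^sup>2"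
    by (intro tendsto_divide tendsto_const) auto
  moreover have "16 * a * pi / x / (2 * pi)\<^sup>2 = 4 * a / (pi * x)" for a x :: real
    by (cases "x = 0") (simp_all add: power2_eq_square field_simps)
  moreover have "(2 * pi)\<^sup>2 * x / (2 * pi)\<^sup>2 = x" for x :: real by simp
  ultimately show ?thesis by (simp only:)
qed

text \<open>For mean zero the factors are even, so the Fourier integrals at 1 and -1 coincide.\<close>
lemma prob_double_root_1_eq:
  assumes "mean d = 0" "4 dvd n + 1"
  shows "iid_prob d {..n} {a. double_root_at n 1 a} = iid_prob d {..n} {a. double_root_at n (-1) a}"
proof -
  have even: "cz 0 (of_int ((-1) ^ j) * x / 2) = cz 0 (of_int (1 ^ j) * x / 2)" for j :: nat and x :: real
    by (cases "even j") (simp_all add: cz_def)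
  have "complex_of_real ((2 * pi)\<^sup>2 * iid_prob d {..n} {a. double_root_at n (of_int 1) a}) =
     complex_of_real ((2 * pi)\<^sup>2 * iid_prob d {..n} {a. double_root_at n (of_int (-1)) a})"
    by (subst (1 2) prob_double_root_sign) (use assms in \<open>simp_all only: even insert_iff simp_thms\<close>)
  then show ?thesis by (simp only: of_real_eq_iff) simp
qed

text \<open>Chernoff bound with the optimal tilt l = sqrt (q / p): the mean of l^x is 2 sqrt (p q),
  which is below 1 because p and q differ. On the event the coefficients sum to 0, so the tilted
  product equals 1 there.\<close>

lemma prob_double_root_1_exp_small:
  assumes "mean d \<noteq> 0"
  obtains \<rho> where "0 \<le> \<rho>" "\<rho> < 1" "\<And>n. iid_prob d {..n} {a. double_root_at n 1 a} \<le> \<rho> ^ (n + 1)"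
proof -
  define p q where "p = pmf d 1" and "q = pmf d (-1)"
  have pq: "p + q = 1" "p > 0" "q > 0" "p \<noteq> q"
    using pmf_ternary_sum[OF supp] p0 lt1[of 1] lt1[of "-1"] assms by (auto simp: p_def q_def mean_def)
  define \<rho> where "\<rho> = 2 * sqrt (p * q)"
  have "(p - q)\<^sup>2 > 0" using pq by simp
  then have "4 * (p * q) < (p + q)\<^sup>2" by (simp add: power2_eq_square algebra_simps)
  then have "sqrt (4 * (p * q)) < sqrt 1" by (simp only: pq(1) real_sqrt_less_iff) simp
  then have \<rho>1: "\<rho> < 1" by (simp add: \<rho>_def real_sqrt_mult)
  show ?thesis
  proof (rule that[OF _ \<rho>1])
    show "0 \<le> \<rho>" using pq by (simp add: \<rho>_def)
    fix n
    define l where "l = sqrt (q / p)"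
    have l: "l > 0" using pq by (simp add: l_def)
    define F where "F = (\<lambda>x::int. exp (ln l * of_int x))"
    have EF: "measure_pmf.expectation d F = \<rho>"
    proof -
      have "measure_pmf.expectation d F = (\<Sum>x\<in>{-1, 1}. F x * pmf d x)"
        by (rule integral_measure_pmf_real) (use supp_sign in auto)
      also have "\<dots> = q / l + p * l" using l by (simp add: F_def p_def q_def exp_minus divide_inverse mult_ac)
      also have "q / l = sqrt (p * q)"
      proof -
        have "sqrt (p * q) * l = sqrt ((p * q) * (q / p))" by (simp only: l_def real_sqrt_mult)
        also have "(p * q) * (q / p) = q\<^sup>2" using pq by (simp add: power2_eq_square)
        finally have "sqrt (p * q) * l = q" using pq by simp
        then show ?thesis using l by (simp add: field_simps)
      qed
      also have "p * l = sqrt (p * q)"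
      proof -
        have "p * l = sqrt (p\<^sup>2) * sqrt (q / p)" using pq by (simp add: l_def)
        also have "\<dots> = sqrt (p\<^sup>2 * (q / p))" by (simp only: real_sqrt_mult)
        also have "p\<^sup>2 * (q / p) = p * q" using pq by (simp add: power2_eq_square)
        finally show ?thesis .
      qed
      finally show ?thesis by (simp add: \<rho>_def)
    qed
    have fin: "finite (set_pmf (iid d {..n}))"
      by (rule finite_set_iid) (use supp finite_subset in auto)
    have "iid_prob d {..n} {a. double_root_at n 1 a} = measure_pmf.expectation (iid d {..n}) (indicator {a. double_root_at n 1 a})"
      by simp
    also have "\<dots> \<le> measure_pmf.expectation (iid d {..n}) (\<lambda>a. \<Prod>j\<le>n. F (a j))"
    proof (rule integral_mono)
      show "integrable (iid d {..n}) (indicator {a. double_root_at n 1 a} :: _ \<Rightarrow> real)" by (rule integrable_measure_pmf_finite[OF fin])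
      show "integrable (iid d {..n}) (\<lambda>a. \<Prod>j\<le>n. F (a j))" by (rule integrable_measure_pmf_finite[OF fin])
      fix a :: "nat \<Rightarrow> int"
      have "(\<Prod>j\<le>n. F (a j)) = exp (ln l * of_int (\<Sum>j\<le>n. a j))"
        by (simp add: F_def exp_sum[symmetric] sum_distrib_left of_int_sum)
      moreover have "real_of_int (\<Sum>j\<le>n. a j) = 0" if "double_root_at n 1 a"
        using that double_root_at_sign_iff[of 1 n a] by (simp add: lessThan_Suc_atMost)
      ultimately show "indicator {a. double_root_at n 1 a} a \<le> (\<Prod>j\<le>n. F (a j))"
        by (auto simp: indicator_def simp del: of_int_sum)
    qed
    also have "\<dots> = (\<Prod>j\<le>n. measure_pmf.expectation d F)"
      using supp finite_subset[OF supp]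
      by (intro expectation_prod_Pi_pmf integrable_measure_pmf_finite) (auto simp: F_def)
    also have "\<dots> = \<rho> ^ (n + 1)" by (simp add: EF)
    finally show "iid_prob d {..n} {a. double_root_at n 1 a} \<le> \<rho> ^ (n + 1)" .
  qed
qed

end

subsection \<open>Asymptotics\<close>

text \<open>The three error terms for D of order K ln n, weighted by n^2. In the second, exp(-c n /
  (ln n)^2) defeats exp(O((ln n)^2)); in the third a power of ln n is lost against 1 / n.\<close>

lemma union_bound_limits:
  fixes K c C \<theta> :: real
  assumes "K > 0" "c > 0" "C > 0" "\<theta> < 1"
  shows "(\<lambda>n::nat. (real n)\<^sup>2 * (real n powr (-3) / (1 - \<theta>))) \<longlonglongrightarrow> 0"
    "(\<lambda>n::nat. (real n)\<^sup>2 * (exp ((K * ln (real n) + 4)\<^sup>2 * ln 3) * exp (- (c * (real n / (64 * (K * ln (real n) + 2)\<^sup>2)))))) \<longlonglongrightarrow> 0"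
    "(\<lambda>n::nat. (real n)\<^sup>2 * (C * (2 * (K * ln (real n) + 2)\<^sup>2) ^ 5 / real n ^ 3)) \<longlonglongrightarrow> 0"
proof -
  have t: "1 - \<theta> > 0" using assms by simp
  show "(\<lambda>n::nat. (real n)\<^sup>2 * (real n powr (-3) / (1 - \<theta>))) \<longlonglongrightarrow> 0"
    using t by real_asymp
  show "(\<lambda>n::nat. (real n)\<^sup>2 * (exp ((K * ln (real n) + 4)\<^sup>2 * ln 3) * exp (- (c * (real n / (64 * (K * ln (real n) + 2)\<^sup>2)))))) \<longlonglongrightarrow> 0"
    using assms(1,2) by real_asymp
  show "(\<lambda>n::nat. (real n)\<^sup>2 * (C * (2 * (K * ln (real n) + 2)\<^sup>2) ^ 5 / real n ^ 3)) \<longlonglongrightarrow> 0"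
    using assms(1,3) by real_asymp
qed

lemma large_root_bound_le:
  assumes D: "D > 0" "real D \<le> L" and M: "0 < M" "M < 1"
  shows "real (D * (2 * 3 ^ D + 1) ^ (D + 1)) * M ^ (n div (64 * D\<^sup>2) + 1)
    \<le> exp ((L + 2)\<^sup>2 * ln 3) * exp (- (- ln M * (real n / (64 * L\<^sup>2))))"
proof (rule mult_mono)
  \<comment> \<open>All factors become powers of 3, with total exponent D + (D + 1)^2 <= (D +
    2)^2.\<close>
  have "D * (2 * 3 ^ D + 1) ^ (D + 1) \<le> 3 ^ D * (3 ^ (D + 1)) ^ (D + 1)"
  proof (intro mult_mono power_mono)
    show "D \<le> 3 ^ D" by (intro less_imp_le power_gt_expt) simp
    have "(1::nat) \<le> 3 ^ D" by simp
    then show "2 * 3 ^ D + 1 \<le> (3::nat) ^ (D + 1)" by simp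
  qed auto
  also have "\<dots> = 3 ^ (D + (D + 1) * (D + 1))" by (simp only: power_add[symmetric] power_mult[symmetric])
  also have "\<dots> \<le> 3 ^ ((D + 2)\<^sup>2)" by (intro power_increasing) (auto simp: power2_eq_square algebra_simps)
  finally have "real (D * (2 * 3 ^ D + 1) ^ (D + 1)) \<le> real (3 ^ ((D + 2)\<^sup>2))" by (simp only: of_nat_le_iff)
  also have "\<dots> = exp (real ((D + 2)\<^sup>2) * ln 3)" unfolding exp_of_nat_mult by simp
  also have "\<dots> \<le> exp ((L + 2)\<^sup>2 * ln 3)"
  proof -
    have "(real D + 2)\<^sup>2 \<le> (L + 2)\<^sup>2" using D by (intro power_mono) auto
    then have "real ((D + 2)\<^sup>2) * ln 3 \<le> (L + 2)\<^sup>2 * ln 3" by (intro mult_right_mono) (auto simp: add.commute)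
    then show ?thesis by simp
  qed
  finally show "real (D * (2 * 3 ^ D + 1) ^ (D + 1)) \<le> exp ((L + 2)\<^sup>2 * ln 3)" .
  have "n < 64 * D\<^sup>2 * (n div (64 * D\<^sup>2) + 1)"
    using dividend_less_div_times[of "64 * D\<^sup>2" n] D by (simp add: algebra_simps)
  then have "real n < real (64 * D\<^sup>2) * real (n div (64 * D\<^sup>2) + 1)" by (metis of_nat_less_iff of_nat_mult)
  then have "real n / (64 * (real D)\<^sup>2) \<le> real (n div (64 * D\<^sup>2) + 1)" using D by (simp add: field_simps)
  moreover have "real n / (64 * L\<^sup>2) \<le> real n / (64 * (real D)\<^sup>2)"
    using D by (intro divide_left_mono mult_left_mono power_mono mult_pos_pos) auto
  ultimately have "- ln M * (real n / (64 * L\<^sup>2)) \<le> - ln M * real (n div (64 * D\<^sup>2) + 1)"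
    using M by (intro mult_left_mono) auto
  then have "exp (real (n div (64 * D\<^sup>2) + 1) * ln M) \<le> exp (- (- ln M * (real n / (64 * L\<^sup>2))))"
    by (simp add: mult.commute)
  moreover have "exp (real (n div (64 * D\<^sup>2) + 1) * ln M) = M ^ (n div (64 * D\<^sup>2) + 1)"
    using M by (simp only: exp_of_nat_mult exp_ln)
  ultimately show "M ^ (n div (64 * D\<^sup>2) + 1) \<le> exp (- (- ln M * (real n / (64 * L\<^sup>2))))" by (simp only:)
qed (use M in auto)

text \<open>The clause on \<open>a 0\<close> and \<open>a 1\<close> spells out a double root at 0
  when n >= 1; negated, it also rules out the zero polynomial.\<close>

definition exceptional :: "nat \<Rightarrow> (nat \<Rightarrow> int) set" where
  "exceptional n = {a. has_double_root (rand_poly n a) \<and> \<not> (a 0 = 0 \<and> a 1 = 0) \<and>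
     \<not> double_root_at n 1 a \<and> \<not> double_root_at n (-1) a}"

lemma double_root_at_0_iff: "n \<ge> 1 \<Longrightarrow> double_root_at n 0 a \<longleftrightarrow> a 0 = 0 \<and> a 1 = 0"
  by (simp add: double_root_at_def poly_0_coeff_0 coeff_pderiv coeff_map_poly coeff_int_poly)

lemma exceptional_subset:
  assumes supp: "set_pmf d \<subseteq> {-1, 0, 1}" and n: "n \<ge> 1" and D: "D > 0"
  shows "exceptional n \<inter> set_pmf (iid d {..n}) \<subseteq>
    square_factor_event n D \<union>
    large_root_event n D \<union> unity_event n (2 * D\<^sup>2)"
proof
  fix a assume a: "a \<in> exceptional n \<inter> set_pmf (iid d {..n})"
  then obtain z where z: "double_root_at n z a" by (auto simp: exceptional_def has_double_root_iff)
  have nz: "int_poly n a \<noteq> 0"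
  proof
    assume "int_poly n a = 0"
    then have "coeff (int_poly n a) 0 = 0" "coeff (int_poly n a) 1 = 0" by simp_all
    then show False using a n by (simp add: coeff_int_poly exceptional_def)
  qed
  have c: "coeff (int_poly n a) j \<in> {-1, 0, 1}" for j
    using iid_value_in_support[of "{..n}" a d j] a supp by (auto simp: coeff_int_poly)
  have z0: "z \<noteq> 0" using z a n double_root_at_0_iff[OF n] by (auto simp: exceptional_def)
  from double_root_cases[OF nz c _ _ D, of z] z z0
  consider (big) "\<exists>f. lead_coeff f = 1 \<and> degree f \<ge> D \<and> f\<^sup>2 dvd int_poly n a"
    | (large) "\<exists>b\<in>large_roots D. poly (cpoly (int_poly n a)) b = 0"
    | (unity) m where "0 < m" "m \<le> 2 * D\<^sup>2" "z ^ m = 1"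
    by (auto simp: double_root_at_def)
  then show "a \<in> square_factor_event n D \<union>
    large_root_event n D \<union> unity_event n (2 * D\<^sup>2)"
  proof cases
    case unity
    \<comment> \<open>A real root of unity is 1 or -1, and \<open>exceptional\<close> excludes
      both.\<close>
    have "Im z \<noteq> 0"
    proof
      assume im: "Im z = 0"
      have "cmod z ^ m = 1" using unity(3) by (metis norm_one norm_power)
      then have "cmod z = 1" using unity(1) power_eq_iff_eq_base[of m "cmod z" 1] by simp
      then have "\<bar>Re z\<bar> = 1" using im by (simp add: cmod_def)
      then have "z = 1 \<or> z = -1" using im by (auto simp: complex_eq_iff abs_if split: if_splits)
      then show False using z a by (auto simp: exceptional_def)
    qed
    then show ?thesis using unity z by blast
  qed (use nz in blast)+
qed

lemma prob_exceptional_negligible: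
  assumes supp: "set_pmf d \<subseteq> {-1, 0, 1}" and M: "\<And>x. pmf d x \<le> M" "M < 1 / sqrt 3"
  shows "(\<lambda>n. (real n)\<^sup>2 * iid_prob d {..n} (exceptional n)) \<longlonglongrightarrow> 0"
proof -
  have M0: "M > 0"
  proof (rule ccontr)
    assume "\<not> M > 0"
    then have "pmf d x = 0" for x using M(1)[of x] pmf_nonneg[of d x] by linarith
    then show False using pmf_ternary_sum[OF supp] by simp
  qed
  have "M\<^sup>2 < (1 / sqrt 3)\<^sup>2" using M M0 by (intro power_strict_mono) auto
  then have th: "3 * M\<^sup>2 < 1" by (simp add: power_divide)
  have "1 / sqrt 3 \<le> (1::real)" by simp
  then have M1: "M < 1" using M(2) by linarith
  then have small: "pmf d x < 1" for x using M(1)[of x] by linarith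
  define \<theta> where "\<theta> = 3 * M\<^sup>2"
  have \<theta>: "0 < \<theta>" "\<theta> < 1" using th M0 by (auto simp: \<theta>_def)
  \<comment> \<open>With this K, \<theta> to the power K ln n is n^(-3), one order better than
    required.\<close>
  define K where "K = - 3 / ln \<theta>"
  have K: "K > 0" using \<theta> by (simp add: K_def divide_neg_neg)
  obtain C where C: "C > 0" and unity: "\<And>n K. n \<ge> 1 \<Longrightarrow>
      iid_prob d {..n} (unity_event n K)
        \<le> C * real K ^ 5 / real n ^ 3"
    by (rule prob_double_root_small_unity[OF supp small]; rule that; blast)
  define b1 where "b1 = (\<lambda>n. real n powr (-3) / (1 - \<theta>))"
  define b2 where "b2 = (\<lambda>n. exp ((K * ln (real n) + 4)\<^sup>2 * ln 3) * exp (- (- ln M * (real n / (64 * (K * ln (real n) + 2)\<^sup>2)))))"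
  define b3 where "b3 = (\<lambda>n. C * (2 * (K * ln (real n) + 2)\<^sup>2) ^ 5 / real n ^ 3)"
  have bound: "iid_prob d {..n} (exceptional n) \<le> b1 n + b2 n + b3 n" if n: "n \<ge> 1" for n
  proof -
    let ?p = "iid_prob d {..n}"
    \<comment> \<open>The added 1 keeps D positive at n = 1, where the logarithm vanishes;
      \<open>L\<close> bounds D from above without rounding.\<close>
    define D where "D = nat \<lceil>K * ln (real n)\<rceil> + 1"
    define L where "L = K * ln (real n) + 2"
    have ln0: "K * ln (real n) \<ge> 0" using K n by simp
    have D: "D > 0" "K * ln (real n) \<le> real D" "real D \<le> L"
      using ln0 by (auto simp: D_def L_def) linarith+
    let ?A = "square_factor_event n D"
    let ?B = "large_root_event n D"
    let ?C = "unity_event n (2 * D\<^sup>2)"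
    have "?p (exceptional n) = ?p (exceptional n \<inter> set_pmf (iid d {..n}))" by (rule prob_pmf_cong_support)
    also have "\<dots> \<le> ?p (?A \<union> ?B \<union> ?C)"
      by (rule measure_pmf.finite_measure_mono[OF exceptional_subset[OF supp n D(1)]]) simp
    also have "\<dots> \<le> ?p (?A \<union> ?B) + ?p ?C" by (rule measure_Un_le) auto
    also have "?p (?A \<union> ?B) \<le> ?p ?A + ?p ?B" by (rule measure_Un_le) auto
    also have "?p ?A \<le> b1 n"
    proof -
      have "?p ?A \<le> \<theta> ^ D / (1 - \<theta>)"
        unfolding \<theta>_def by (rule prob_large_square_factor[OF supp M(1) th])
      also have "\<theta> ^ D = exp (real D * ln \<theta>)" using \<theta>(1) by (simp only: exp_of_nat_mult exp_ln)
      also have "real D * ln \<theta> \<le> (K * ln (real n)) * ln \<theta>" using D(2) \<theta> by (intro mult_right_mono_neg) auto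
      also have "(K * ln (real n)) * ln \<theta> = (-3) * ln (real n)" using \<theta> by (simp add: K_def)
      also have "exp ((-3) * ln (real n)) = real n powr (-3)" using n by (simp add: powr_def)
      finally show ?thesis using \<theta> by (simp add: b1_def divide_right_mono)
    qed
    also have "?p ?B \<le> b2 n"
    proof -
      have "?p ?B \<le> real (D * (2 * 3 ^ D + 1) ^ (D + 1)) * M ^ (n div (64 * D\<^sup>2) + 1)"
        by (rule prob_large_root[OF supp M(1) D(1)])
      also have "\<dots> \<le> exp ((L + 2)\<^sup>2 * ln 3) * exp (- (- ln M * (real n / (64 * L\<^sup>2))))"
        by (rule large_root_bound_le[OF D(1,3) M0 M1])
      also have "\<dots> = b2 n" by (simp add: b2_def L_def add.assoc)
      finally show ?thesis .
    qed
    also have "?p ?C \<le> b3 n"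
    proof -
      have "?p ?C \<le> C * real (2 * D\<^sup>2) ^ 5 / real n ^ 3" by (rule unity[OF n])
      also have "\<dots> \<le> C * (2 * L\<^sup>2) ^ 5 / real n ^ 3"
      proof -
        have "(real D)\<^sup>2 \<le> L\<^sup>2" using D by (intro power_mono) auto
        then have "real (2 * D\<^sup>2) ^ 5 \<le> (2 * L\<^sup>2) ^ 5" by (intro power_mono) auto
        then show ?thesis using C by (intro divide_right_mono mult_left_mono) auto
      qed
      finally show ?thesis by (simp add: b3_def L_def)
    qed
    finally show ?thesis by simp
  qed
  have c: "- ln M > 0" using M0 M1 by simp
  note lims = union_bound_limits[OF K c C \<theta>(2)]
  have "(\<lambda>n. (real n)\<^sup>2 * b1 n + (real n)\<^sup>2 * b2 n + (real n)\<^sup>2 * b3 n) \<longlonglongrightarrow> 0 + 0 + 0"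
    unfolding b1_def b2_def b3_def by (intro tendsto_add lims)
  then have lim: "(\<lambda>n. (real n)\<^sup>2 * b1 n + (real n)\<^sup>2 * b2 n + (real n)\<^sup>2 * b3 n) \<longlonglongrightarrow> 0" by simp
  show ?thesis
  proof (rule tendsto_sandwich[OF _ _ tendsto_const lim])
    show "\<forall>\<^sub>F n in sequentially. 0 \<le> (real n)\<^sup>2 * iid_prob d {..n} (exceptional n)" by simp
    show "\<forall>\<^sub>F n in sequentially. (real n)\<^sup>2 * iid_prob d {..n} (exceptional n)
       \<le> (real n)\<^sup>2 * b1 n + (real n)\<^sup>2 * b2 n + (real n)\<^sup>2 * b3 n"
    proof (rule eventually_sequentiallyI[of 1])
      fix n :: nat assume "1 \<le> n"
      from mult_left_mono[OF bound[OF this], of "(real n)\<^sup>2"]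
      show "(real n)\<^sup>2 * iid_prob d {..n} (exceptional n)
       \<le> (real n)\<^sup>2 * b1 n + (real n)\<^sup>2 * b2 n + (real n)\<^sup>2 * b3 n" by (simp add: distrib_left)
    qed
  qed
qed

lemma prob_double_root_at_0:
  assumes n: "n \<ge> 1"
  shows "iid_prob d {..n} {a. double_root_at n 0 a} = (pmf d 0)\<^sup>2"
proof -
  let ?B = "\<lambda>x::nat. if x \<le> 1 then {0::int} else UNIV"
  have "{a. double_root_at n 0 a} = Pi {..n} ?B"
    using n by (auto simp: double_root_at_0_iff[OF n] Pi_def le_Suc_eq)
  then have "iid_prob d {..n} {a. double_root_at n 0 a} = (\<Prod>x\<le>n. measure_pmf.prob d (?B x))"
    by (simp add: measure_Pi_pmf_Pi)
  also have "\<dots> = (\<Prod>x\<in>{0, 1}. measure_pmf.prob d (?B x))"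
    by (rule prod.mono_neutral_right) (use n in auto)
  also have "\<dots> = (pmf d 0)\<^sup>2" by (simp add: measure_pmf_single power2_eq_square)
  finally show ?thesis .
qed

text \<open>A union bound from above and inclusion-exclusion for 1 and -1 from below. The lower
  bound from the root 0 alone serves the first claim.\<close>

lemma prob_double_root_bounds:
  fixes d :: "int pmf"
  assumes n: "n \<ge> 1"
  defines "p \<equiv> iid_prob d {..n}"
  shows "prob_double_root d n \<le> (pmf d 0)\<^sup>2 + p {a. double_root_at n 1 a} + p {a. double_root_at n (-1) a} + p (exceptional n)"
    "(pmf d 0)\<^sup>2 \<le> prob_double_root d n"
    "p {a. double_root_at n 1 a} + p {a. double_root_at n (-1) a} - p {a. double_root_at n 1 a \<and> double_root_at n (-1) a} \<le> prob_double_root d n"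
proof -
  let ?E = "{a. has_double_root (rand_poly n a)}"
  let ?Z = "{a. double_root_at n 0 a}" and ?P = "{a. double_root_at n 1 a}" and ?M = "{a. double_root_at n (-1) a}"
  have P: "prob_double_root d n = p ?E" by (simp add: prob_double_root_def p_def)
  have sub: "p (A \<union> B) \<le> p A + p B" for A B
    unfolding p_def by (rule measure_Un_le) auto
  have mono: "p A \<le> p B" if "A \<subseteq> B" for A B
    unfolding p_def using that by (intro measure_pmf.finite_measure_mono) auto
  have "?E \<subseteq> ?Z \<union> ?P \<union> ?M \<union> exceptional n" by (auto simp: exceptional_def double_root_at_0_iff[OF n])
  then have "p ?E \<le> p (?Z \<union> ?P \<union> ?M \<union> exceptional n)" by (rule mono)
  also have "\<dots> \<le> p ?Z + p ?P + p ?M + p (exceptional n)"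
    using sub[of "?Z \<union> ?P \<union> ?M" "exceptional n"] sub[of "?Z \<union> ?P" ?M] sub[of ?Z ?P] by linarith
  finally show "prob_double_root d n \<le> (pmf d 0)\<^sup>2 + p ?P + p ?M + p (exceptional n)"
    using prob_double_root_at_0[OF n, of d] by (simp add: P p_def)
  have "p ?Z \<le> p ?E" by (rule mono) (auto simp: has_double_root_iff)
  then show "(pmf d 0)\<^sup>2 \<le> prob_double_root d n" using prob_double_root_at_0[OF n, of d] by (simp add: P p_def)
  have "p (?P \<union> ?M) = p ?P + p ?M - p (?P \<inter> ?M)"
    unfolding p_def by (subst measure_Un3) (auto simp: measure_pmf.fmeasurable_eq_sets)
  moreover have "p (?P \<union> ?M) \<le> p ?E" by (rule mono) (auto simp: has_double_root_iff)
  ultimately show "p ?P + p ?M - p {a. double_root_at n 1 a \<and> double_root_at n (-1) a} \<le> prob_double_root d n"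
    by (simp add: P Collect_conj_eq)
qed

lemma tendsto_zero_of_residue_class:
  fixes h :: "nat \<Rightarrow> real"
  assumes sub: "(\<lambda>k. h (4 * k + 7)) \<longlonglongrightarrow> 0" and z: "\<And>n. \<not> 4 dvd n + 1 \<Longrightarrow> h n = 0"
  shows "h \<longlonglongrightarrow> 0"
proof (rule LIMSEQ_I)
  fix e :: real assume e: "e > 0"
  then obtain k0 where k0: "\<And>k. k \<ge> k0 \<Longrightarrow> \<bar>h (4 * k + 7)\<bar> < e"
    using LIMSEQ_D[OF sub e] by auto
  have "norm (h n - 0) < e" if n: "n \<ge> 4 * k0 + 7" for n
  proof (cases "4 dvd n + 1")
    case True
    then obtain j where "n + 1 = 4 * j" by auto
    with n have "n = 4 * (j - 2) + 7" "j - 2 \<ge> k0" by auto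
    then show ?thesis using k0[of "j - 2"] by simp
  qed (use z e in simp)
  then show "\<exists>no. \<forall>n\<ge>no. norm (h n - 0) < e" by blast
qed

text \<open>\<open>V\<close> is the contribution of one root. The root -1 always yields V; the root
  1 yields V again if the mean is 0 and an exponentially small amount otherwise.\<close>

lemma prob_double_root_pm1_asymp:
  assumes supp: "set_pmf d \<subseteq> {-1, 0, 1}" and lt1: "\<And>x. pmf d x < 1" and p0: "pmf d 0 = 0"
  defines "p \<equiv> \<lambda>n z. iid_prob d {..n} {a. double_root_at n z a}"
  shows "(\<lambda>n. (real n)\<^sup>2 * (p n 1 + p n (-1)) - L_const d n) \<longlonglongrightarrow> 0"
proof (rule tendsto_zero_of_residue_class)
  note asm = supp lt1 p0
  show "(real n)\<^sup>2 * (p n 1 + p n (-1)) - L_const d n = 0" if "\<not> 4 dvd n + 1" for n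
    using prob_double_root_sign_0[OF asm, of 1 n] prob_double_root_sign_0[OF asm, of "-1" n] that
    by (simp add: p_def L_const_def)
  define V where "V = 4 * sqrt 3 / (pi * (1 - (mean d)\<^sup>2))"
  have lim: "(\<lambda>k. (real (4 * k + 7))\<^sup>2 * p (4 * k + 7) (-1)) \<longlonglongrightarrow> V"
  proof -
    \<comment> \<open>The local limit is normalised by (n + 1)^2, the claim by n^2.\<close>
    have "(\<lambda>k. (real (4 * k + 7) / real (4 * k + 8))\<^sup>2 * ((real (4 * k + 8))\<^sup>2 * p (4 * k + 7) (-1))) \<longlonglongrightarrow> 1 * V"
    proof (rule tendsto_mult)
      show "(\<lambda>k. (real (4 * k + 7) / real (4 * k + 8))\<^sup>2) \<longlonglongrightarrow> 1" by real_asymp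
      show "(\<lambda>k. (real (4 * k + 8))\<^sup>2 * p (4 * k + 7) (-1)) \<longlonglongrightarrow> V"
        unfolding p_def V_def by (rule prob_double_root_minus_1_limit[OF asm])
    qed
    then show ?thesis by (simp add: power_divide del: of_nat_add of_nat_mult)
  qed
  have L: "L_const d (4 * k + 7) = (if mean d = 0 then 2 * V else V)" for k
  proof -
    have "4 dvd 4 * k + 7 + 1" by simp
    then show ?thesis
      unfolding L_const_def expectation_variance_sign(2)[OF supp p0]
      unfolding expectation_variance_sign(1)[OF supp p0] V_def by simp
  qed
  show "(\<lambda>k. (real (4 * k + 7))\<^sup>2 * (p (4 * k + 7) 1 + p (4 * k + 7) (-1)) - L_const d (4 * k + 7)) \<longlonglongrightarrow> 0"
  proof (cases "mean d = 0")
    case True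
    have "p (4 * k + 7) 1 = p (4 * k + 7) (-1)" for k
      unfolding p_def by (rule prob_double_root_1_eq[OF asm True]) simp
    then have "(\<lambda>k. (real (4 * k + 7))\<^sup>2 * (p (4 * k + 7) 1 + p (4 * k + 7) (-1)) - L_const d (4 * k + 7)) =
      (\<lambda>k. 2 * ((real (4 * k + 7))\<^sup>2 * p (4 * k + 7) (-1)) - 2 * V)"
      by (simp add: L True mult.left_commute)
    moreover have "(\<lambda>k. 2 * ((real (4 * k + 7))\<^sup>2 * p (4 * k + 7) (-1)) - 2 * V) \<longlonglongrightarrow> 2 * V - 2 * V"
      by (intro tendsto_intros lim)
    ultimately show ?thesis by simp
  next
    case False
    obtain \<rho> where \<rho>: "0 \<le> \<rho>" "\<rho> < 1" 
      and le: "\<And>n. iid_prob d {..n} {a. double_root_at n 1 a} \<le> \<rho> ^ (n + 1)"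
      by (rule prob_double_root_1_exp_small[OF asm False]; rule that; blast)
    have "(\<lambda>n. (real n)\<^sup>2 * \<rho> ^ n) \<longlonglongrightarrow> 0"
    proof (cases "\<rho> = 0")
      case False
      then have "\<rho> > 0" using \<rho> by simp
      then show ?thesis using \<rho>(2) by real_asymp
    next
      case True
      then show ?thesis by (intro tendsto_eventually eventually_sequentiallyI[of 1]) auto
    qed
    then have z: "(\<lambda>n. (real n)\<^sup>2 * p n 1) \<longlonglongrightarrow> 0"
    proof (rule tendsto_sandwich[OF _ _ tendsto_const, rotated 2])
      show "\<forall>\<^sub>F n in sequentially. 0 \<le> (real n)\<^sup>2 * p n 1" by (simp add: p_def)
      have "(real n)\<^sup>2 * p n 1 \<le> (real n)\<^sup>2 * \<rho> ^ n" for n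
        using order_trans[OF le[of n] power_decreasing[of n "n + 1" \<rho>]] \<rho>
        by (intro mult_left_mono) (auto simp: p_def)
      then show "\<forall>\<^sub>F n in sequentially. (real n)\<^sup>2 * p n 1 \<le> (real n)\<^sup>2 * \<rho> ^ n" by simp
    qed
    have "filterlim (\<lambda>k. 4 * k + 7) sequentially sequentially"
      by (rule filterlim_subseq) (simp add: strict_mono_def)
    from filterlim_compose[OF z this]
    have "(\<lambda>k. (real (4 * k + 7))\<^sup>2 * p (4 * k + 7) 1 + (real (4 * k + 7))\<^sup>2 * p (4 * k + 7) (-1) - V) \<longlonglongrightarrow> 0 + V - V"
      by (intro tendsto_intros lim)
    then show ?thesis using False by (simp add: L distrib_left)
  qed
qed

theorem theorem1p2:
  fixes d :: "int pmf"
  assumes supp: "set_pmf d \<subseteq> {-1, 0, 1}"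
    and small: "\<forall>x\<in>{-1, 0, 1::int}. pmf d x < 1 / sqrt 3"
  shows "(prob_double_root d \<longlongrightarrow> (pmf d 0)\<^sup>2) at_top \<and>
         (pmf d 0 = 0 \<longrightarrow>
         ((\<lambda>n. (prob_double_root d n - L_const d n / (real n)\<^sup>2) * (real n)\<^sup>2) \<longlongrightarrow> 0) at_top)"
proof -
  define M where "M = Max (pmf d ` {-1, 0, 1})"
  have M: "pmf d x \<le> M" for x
  proof (cases "x \<in> {-1, 0, 1}")
    case True
    then show ?thesis unfolding M_def by (intro Max_ge) auto
  next
    case False
    then have "pmf d x = 0" using supp by (auto simp: set_pmf_eq)
    also have "0 \<le> pmf d 0" by simp
    also have "\<dots> \<le> M" unfolding M_def by (intro Max_ge) auto
    finally show ?thesis .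
  qed
  have M3: "M < 1 / sqrt 3" unfolding M_def using small by (subst Max_less_iff) auto
  have "1 / sqrt 3 \<le> (1::real)" by simp
  then have lt1: "pmf d x < 1" for x using M[of x] M3 by linarith
  define p where "p = (\<lambda>n z. iid_prob d {..n} {a. double_root_at n z a})"
  define e where "e = (\<lambda>n. iid_prob d {..n} (exceptional n))"
  have e2: "(\<lambda>n. (real n)\<^sup>2 * e n) \<longlonglongrightarrow> 0"
    unfolding e_def by (rule prob_exceptional_negligible[OF supp M M3])
  have e0: "e \<longlonglongrightarrow> 0"
  proof (rule tendsto_sandwich[OF _ _ tendsto_const e2])
    show "\<forall>\<^sub>F n in sequentially. 0 \<le> e n" by (simp add: e_def)
    show "\<forall>\<^sub>F n in sequentially. e n \<le> (real n)\<^sup>2 * e n"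
    proof (rule eventually_sequentiallyI[of 1])
      fix n :: nat assume "1 \<le> n"
      then have "1 \<le> (real n)\<^sup>2" by simp
      then show "e n \<le> (real n)\<^sup>2 * e n" using mult_right_mono[of 1 "(real n)\<^sup>2" "e n"] by (simp add: e_def)
    qed
  qed
  have pm: "(\<lambda>n. p n z) \<longlonglongrightarrow> 0" if z: "z \<in> {1, -1}" for z
  proof -
    obtain C where "C > 0" and C: "\<And>n z. z \<in> {1, -1} \<Longrightarrow>
        iid_prob d {..n} {a. double_root_at n z a} \<le> C * real (n + 1) powr (-3/2)"
      by (rule prob_double_root_pm1_le[OF supp lt1]; rule that; blast)
    have "(\<lambda>n. C * real (n + 1) powr (-3/2)) \<longlonglongrightarrow> 0" by real_asymp
    then show ?thesis
      by (rule tendsto_sandwich[OF _ _ tendsto_const, rotated 2]) (use C[OF z] in \<open>simp_all add: p_def\<close>)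
  qed
  have "prob_double_root d \<longlonglongrightarrow> (pmf d 0)\<^sup>2"
  proof (rule tendsto_sandwich)
    show "\<forall>\<^sub>F n in sequentially. (pmf d 0)\<^sup>2 \<le> prob_double_root d n"
      by (rule eventually_sequentiallyI[of 1]) (rule prob_double_root_bounds(2))
    show "\<forall>\<^sub>F n in sequentially. prob_double_root d n \<le> (pmf d 0)\<^sup>2 + p n 1 + p n (-1) + e n"
      unfolding p_def e_def by (rule eventually_sequentiallyI[of 1]) (rule prob_double_root_bounds(1))
    have "(\<lambda>n. (pmf d 0)\<^sup>2 + p n 1 + p n (-1) + e n) \<longlonglongrightarrow> (pmf d 0)\<^sup>2 + 0 + 0 + 0"
      by (intro tendsto_intros pm e0) auto
    then show "(\<lambda>n. (pmf d 0)\<^sup>2 + p n 1 + p n (-1) + e n) \<longlonglongrightarrow> (pmf d 0)\<^sup>2" by simp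
  qed simp
  moreover have "(\<lambda>n. (prob_double_root d n - L_const d n / (real n)\<^sup>2) * (real n)\<^sup>2) \<longlonglongrightarrow> 0" if p0: "pmf d 0 = 0"
  proof -
    obtain C where C: "C > 0" and both: "\<And>n. n \<ge> 1 \<Longrightarrow>
      iid_prob d {..n} {a. double_root_at n 1 a \<and> double_root_at n (-1) a} \<le> C * (2 / real n) ^ 3"
      by (rule prob_double_root_nonreal_unity[OF supp lt1]; rule that; blast)
    define q where "q = (\<lambda>n. p n 1 + p n (-1))"
    \<comment> \<open>Without an atom at 0 the root 0 drops out of the upper bound, and the lower
      bound loses only the O(n^(-3)) overlap of 1 and -1.\<close>
    have up: "prob_double_root d n - q n \<le> e n" and lo: "- (C * (2 / real n) ^ 3) \<le> prob_double_root d n - q n" if "n \<ge> 1" for n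
      using prob_double_root_bounds(1,3)[OF that, of d] both[OF that] p0 unfolding q_def p_def e_def by auto
    have "(\<lambda>n. (real n)\<^sup>2 * (prob_double_root d n - q n)) \<longlonglongrightarrow> 0"
    proof (rule tendsto_sandwich[OF _ _ _ e2])
      show "\<forall>\<^sub>F n in sequentially. (real n)\<^sup>2 * - (C * (2 / real n) ^ 3) \<le> (real n)\<^sup>2 * (prob_double_root d n - q n)"
        by (rule eventually_sequentiallyI[of 1]) (intro mult_left_mono lo, auto)
      show "\<forall>\<^sub>F n in sequentially. (real n)\<^sup>2 * (prob_double_root d n - q n) \<le> (real n)\<^sup>2 * e n"
        by (rule eventually_sequentiallyI[of 1]) (intro mult_left_mono up, auto)
      show "(\<lambda>n. (real n)\<^sup>2 * - (C * (2 / real n) ^ 3)) \<longlonglongrightarrow> 0" by real_asymp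
    qed
    moreover have "(\<lambda>n. (real n)\<^sup>2 * q n - L_const d n) \<longlonglongrightarrow> 0"
      unfolding q_def p_def by (rule prob_double_root_pm1_asymp[OF supp lt1 p0])
    ultimately have "(\<lambda>n. (real n)\<^sup>2 * (prob_double_root d n - q n) + ((real n)\<^sup>2 * q n - L_const d n)) \<longlonglongrightarrow> 0 + 0"
      by (rule tendsto_add)
    then have "(\<lambda>n. (real n)\<^sup>2 * prob_double_root d n - L_const d n) \<longlonglongrightarrow> 0" by (simp add: algebra_simps)
    moreover have "\<forall>\<^sub>F n in sequentially. (real n)\<^sup>2 * prob_double_root d n - L_const d n = (prob_double_root d n - L_const d n / (real n)\<^sup>2) * (real n)\<^sup>2"
      by (rule eventually_sequentiallyI[of 1]) (simp add: field_simps)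
    ultimately show ?thesis by (rule Lim_transform_eventually)
  qed
  ultimately show ?thesis by blast
qed

end
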